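(* Let $\mathbb{D}$ be a stable derivator and let $X\in\mathbb{D}([2]\times[1])$. If two of the squares $d_0(X)$, $d_1(X)$ and $d_2(X)$ are biCartesian, then so is the third one.
   Context: **Derivators.** $\mathsf{Cat}$ is the 2-category of small categories, $\mathsf{CAT}$ that of not necessarily small categories, $e$ the terminal category. A prederivator is a strict 2-functor $\mathbb{D}\colon\mathsf{Cat}^{op}\to\mathsf{CAT}$ (contravariant on functors, covariant on natural transformations). Write $u^\ast=\mathbb{D}(u)\colon\mathbb{D}(K)\to\mathbb{D}(J)$ for $u\colon J\to K$, and $\alpha^\ast=\mathbb{D}(\alpha)$. For $k\in K$, viewed as $k\colon e\to K$, write $X_k=k^\ast X\in\mathbb{D}(e)$, $f_k=k^\ast f$. $\mathbb{D}$ is a derivator if: (Der1) for all $J_1,J_2$ the functor $\mathbb{D}(J_1\sqcup J_2)\to\mathbb{D}(J_1)\times\mathbb{D}(J_2)$ induced by the inclusions is an equivalence, and $\mathbb{D}(\emptyset)$ is not the empty category; (Der2) a morphism $f$ in $\mathbb{D}(J)$ is an isomorphism iff $f_j$ is an isomorphism in $\mathbb{D}(e)$ for all $j\in J$; (Der3) every $u^\ast$ has a left adjoint $u_!$ and a right adjoint $u_\ast$ (homotopy left/right Kan extension); (Der4) for $u\colon J\to K$ and $k\in K$ let $J_{/k}$ be the category of pairs $(j,f\colon u(j)\to k)$ and $J_{k/}$ that of pairs $(j,f\colon k\to u(j))$, with projections $\mathrm{pr}$ to $J$ and $p$ to $e$, and let $\alpha\colon u\circ\mathrm{pr}\to k\circ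 p$, resp. $\alpha\colon k\circ p\to u\circ\mathrm{pr}$, be the transformation with components $f$. Then the maps $p_!\mathrm{pr}^\ast\xrightarrow{\eta}p_!\mathrm{pr}^\ast u^\ast u_!\xrightarrow{\alpha^\ast}p_!p^\ast k^\ast u_!\xrightarrow{\epsilon}k^\ast u_!$ and $k^\ast u_\ast\xrightarrow{\eta}p_\ast p^\ast k^\ast u_\ast\xrightarrow{\alpha^\ast}p_\ast\mathrm{pr}^\ast u^\ast u_\ast\xrightarrow{\epsilon}p_\ast\mathrm{pr}^\ast$ are isomorphisms. **Stable derivators.** $[n]$ is the poset $0<\dots<n$ as a category and $\square=[1]\times[1]$; $i_{\ulcorner}\colon\ulcorner\to\square$ is the full subposet on $(0,0),(1,0),(0,1)$ and $i_{\lrcorner}\colon\lrcorner\to\square$ the full subposet on $(1,0),(0,1),(1,1)$. $Y\in\mathbb{D}(\square)$ is coCartesian (Cartesian) if it lies in the essential image of $(i_{\ulcorner})_!$ (of $(i_{\lrcorner})_\ast$). $\mathbb{D}$ is pointed if $\mathbb{D}(e)$ has a zero object. $\mathbb{D}$ is strong if for each small $J$ the functor $\mathbb{D}([1]\times J)\to\mathbb{D}(J)^{[1]}$, sending $X$ to the morphism $(0\times\mathrm{id}_J)^\ast X\to(1\times\mathrm{id}_J)^\ast X$ induced by $0\to1$, is full and essentially surjective. $\mathbb{D}$ is stable if it is strong, pointed, and an object of $\mathbb{D}(\square)$ is coCartesian iff it is Cartesian; such squares are then called biCartesian. Let $d^i\colon[1]\to[2]$ be the monotone injection omitting $i$. For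 $X\in\mathbb{D}([2]\times[1])$ put $d_i(X)=(d^i\times\mathrm{id}_{[1]})^\ast X\in\mathbb{D}(\square)$. *)

theory Defs
  imports Main "HOL-Library.FuncSet"
begin

section \<open>Smallness\<close>

text \<open>
  Small categories have their objects and arrows in the type \<open>'v univ\<close>, which is closed under
  pairing and contains the natural numbers, so that products, coproducts, slices and the posets
  \<open>[n]\<close> need no change of type. Which sets are small is a parameter: if \<open>'v\<close> is (the type of
  elements of) a Grothendieck universe, take the sets equipotent to a member of it. The closure
  properties below are those of a Grothendieck universe with the exception of power sets, on which
  the notion of a derivator does not depend; without them every type \<open>'v\<close> carries a notion of
  smallness.
\<close>

datatype 'v univ = Atom 'v | Num nat | Pr (pfst: "'v univ") (psnd: "'v univ")

definition smallness :: "('v univ set \<Rightarrow> bool) \<Rightarrow> bool" where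
  "smallness S \<longleftrightarrow>
     S (range Num) \<and>
     (\<forall>A B. S A \<longrightarrow> B \<subseteq> A \<longrightarrow> S B) \<and>
     (\<forall>A (f :: 'v univ \<Rightarrow> 'v univ). S A \<longrightarrow> S (f ` A)) \<and>
     (\<forall>A (F :: 'v univ \<Rightarrow> 'v univ set). S A \<longrightarrow> (\<forall>x\<in>A. S (F x)) \<longrightarrow> S (\<Union>x\<in>A. F x))"

lemma smallness_all: "smallness (\<lambda>_ :: 'v univ set. True)"
  by (simp add: smallness_def)


section \<open>Categories, functors and natural transformations\<close>

text \<open>
  All structure maps are required to be \<^const>\<open>undefined\<close> outside their domains, so that equality
  of records is equality of categories, functors and natural transformations, as is needed to
  speak about strict 2-functors.
\<close>

record ('o, 'a) cat =
  Obj :: "'o set"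
  Arr :: "'a set"
  Dom :: "'a \<Rightarrow> 'o"
  Cod :: "'a \<Rightarrow> 'o"
  Id :: "'o \<Rightarrow> 'a"
  Comp :: "'a \<Rightarrow> 'a \<Rightarrow> 'a"  \<comment> \<open>\<open>Comp C g f\<close> is \<open>g \<circ> f\<close>\<close>

definition hom :: "('o, 'a) cat \<Rightarrow> 'o \<Rightarrow> 'o \<Rightarrow> 'a set" where
  "hom C x y = {f \<in> Arr C. Dom C f = x \<and> Cod C f = y}"

definition category :: "('o, 'a) cat \<Rightarrow> bool" where
  "category C \<longleftrightarrow>
     Dom C \<in> Arr C \<rightarrow>\<^sub>E Obj C \<and>
     Cod C \<in> Arr C \<rightarrow>\<^sub>E Obj C \<and>
     Id C \<in> extensional (Obj C) \<and>
     (\<forall>x\<in>Obj C. Id C x \<in> hom C x x) \<and>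
     (\<forall>f g. \<not> (f \<in> Arr C \<and> g \<in> Arr C \<and> Cod C f = Dom C g) \<longrightarrow> Comp C g f = undefined) \<and>
     (\<forall>f\<in>Arr C. \<forall>g\<in>Arr C. Cod C f = Dom C g \<longrightarrow> Comp C g f \<in> hom C (Dom C f) (Cod C g)) \<and>
     (\<forall>f\<in>Arr C. Comp C f (Id C (Dom C f)) = f \<and> Comp C (Id C (Cod C f)) f = f) \<and>
     (\<forall>f\<in>Arr C. \<forall>g\<in>Arr C. \<forall>h\<in>Arr C. Cod C f = Dom C g \<longrightarrow> Cod C g = Dom C h \<longrightarrow>
        Comp C h (Comp C g f) = Comp C (Comp C h g) f)"

definition mk_cat ::
  "'o set \<Rightarrow> 'a set \<Rightarrow> ('a \<Rightarrow> 'o) \<Rightarrow> ('a \<Rightarrow> 'o) \<Rightarrow> ('o \<Rightarrow> 'a) \<Rightarrow> ('a \<Rightarrow> 'a \<Rightarrow> 'a) \<Rightarrow> ('o, 'a) cat"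
  where
  "mk_cat obs ars d c i m =
     \<lparr>Obj = obs, Arr = ars, Dom = restrict d ars, Cod = restrict c ars, Id = restrict i obs,
      Comp = (\<lambda>g f. if f \<in> ars \<and> g \<in> ars \<and> c f = d g then m g f else undefined)\<rparr>"

definition iso_arr :: "('o, 'a) cat \<Rightarrow> 'a \<Rightarrow> bool" where
  "iso_arr C f \<longleftrightarrow> f \<in> Arr C \<and>
     (\<exists>g \<in> hom C (Cod C f) (Dom C f).
        Comp C g f = Id C (Dom C f) \<and> Comp C f g = Id C (Cod C f))"

definition isomorphic :: "('o, 'a) cat \<Rightarrow> 'o \<Rightarrow> 'o \<Rightarrow> bool" where
  "isomorphic C x y \<longleftrightarrow> (\<exists>f \<in> hom C x y. iso_arr C f)"

definition zero_object :: "('o, 'a) cat \<Rightarrow> 'o \<Rightarrow> bool" where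
  "zero_object C z \<longleftrightarrow> z \<in> Obj C \<and> (\<forall>x\<in>Obj C. (\<exists>!f. f \<in> hom C z x) \<and> (\<exists>!f. f \<in> hom C x z))"

record ('o, 'a, 'p, 'b) fctr =
  FDom :: "('o, 'a) cat"
  FCod :: "('p, 'b) cat"
  FObj :: "'o \<Rightarrow> 'p"
  FArr :: "'a \<Rightarrow> 'b"

definition is_fctr :: "('o, 'a, 'p, 'b) fctr \<Rightarrow> ('o, 'a) cat \<Rightarrow> ('p, 'b) cat \<Rightarrow> bool" where
  "is_fctr F C D \<longleftrightarrow>
     category C \<and> category D \<and> FDom F = C \<and> FCod F = D \<and>
     FObj F \<in> Obj C \<rightarrow>\<^sub>E Obj D \<and>
     FArr F \<in> extensional (Arr C) \<and>
     (\<forall>f\<in>Arr C. FArr F f \<in> hom D (FObj F (Dom C f)) (FObj F (Cod C f))) \<and>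
     (\<forall>x\<in>Obj C. FArr F (Id C x) = Id D (FObj F x)) \<and>
     (\<forall>f\<in>Arr C. \<forall>g\<in>Arr C. Cod C f = Dom C g \<longrightarrow>
        FArr F (Comp C g f) = Comp D (FArr F g) (FArr F f))"

definition mk_fctr ::
  "('o, 'a) cat \<Rightarrow> ('p, 'b) cat \<Rightarrow> ('o \<Rightarrow> 'p) \<Rightarrow> ('a \<Rightarrow> 'b) \<Rightarrow> ('o, 'a, 'p, 'b) fctr" where
  "mk_fctr C D fo fa =
     \<lparr>FDom = C, FCod = D, FObj = restrict fo (Obj C), FArr = restrict fa (Arr C)\<rparr>"

definition id_fctr :: "('o, 'a) cat \<Rightarrow> ('o, 'a, 'o, 'a) fctr" where
  "id_fctr C = mk_fctr C C (\<lambda>x. x) (\<lambda>f. f)"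

definition comp_fctr ::
  "('p, 'b, 'q, 'c) fctr \<Rightarrow> ('o, 'a, 'p, 'b) fctr \<Rightarrow> ('o, 'a, 'q, 'c) fctr"  (infixl "\<circ>\<^sub>F" 55)
  where
  "G \<circ>\<^sub>F F = mk_fctr (FDom F) (FCod G) (\<lambda>x. FObj G (FObj F x)) (\<lambda>f. FArr G (FArr F f))"

record ('o, 'a, 'p, 'b) ntrans =
  NSrc :: "('o, 'a, 'p, 'b) fctr"
  NTgt :: "('o, 'a, 'p, 'b) fctr"
  NMap :: "'o \<Rightarrow> 'b"

definition is_ntrans ::
  "('o, 'a, 'p, 'b) ntrans \<Rightarrow> ('o, 'a, 'p, 'b) fctr \<Rightarrow> ('o, 'a, 'p, 'b) fctr \<Rightarrow> bool" where
  "is_ntrans t F G \<longleftrightarrow>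
     is_fctr F (FDom F) (FCod F) \<and> is_fctr G (FDom F) (FCod F) \<and> NSrc t = F \<and> NTgt t = G \<and>
     NMap t \<in> extensional (Obj (FDom F)) \<and>
     (\<forall>x\<in>Obj (FDom F). NMap t x \<in> hom (FCod F) (FObj F x) (FObj G x)) \<and>
     (\<forall>f\<in>Arr (FDom F).
        Comp (FCod F) (FArr G f) (NMap t (Dom (FDom F) f)) =
        Comp (FCod F) (NMap t (Cod (FDom F) f)) (FArr F f))"

definition mk_ntrans ::
  "('o, 'a, 'p, 'b) fctr \<Rightarrow> ('o, 'a, 'p, 'b) fctr \<Rightarrow> ('o \<Rightarrow> 'b) \<Rightarrow> ('o, 'a, 'p, 'b) ntrans" where
  "mk_ntrans F G t = \<lparr>NSrc = F, NTgt = G, NMap = restrict t (Obj (FDom F))\<rparr>"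

definition id_ntrans :: "('o, 'a, 'p, 'b) fctr \<Rightarrow> ('o, 'a, 'p, 'b) ntrans" where
  "id_ntrans F = mk_ntrans F F (\<lambda>x. Id (FCod F) (FObj F x))"

definition vcomp ::
  "('o, 'a, 'p, 'b) ntrans \<Rightarrow> ('o, 'a, 'p, 'b) ntrans \<Rightarrow> ('o, 'a, 'p, 'b) ntrans"
  (infixl "\<bullet>" 55) where
  "t \<bullet> s = mk_ntrans (NSrc s) (NTgt t) (\<lambda>x. Comp (FCod (NSrc s)) (NMap t x) (NMap s x))"

definition hcomp ::
  "('p, 'b, 'q, 'c) ntrans \<Rightarrow> ('o, 'a, 'p, 'b) ntrans \<Rightarrow> ('o, 'a, 'q, 'c) ntrans"
  (infixl "\<star>" 60) where
  "t \<star> s = mk_ntrans (NSrc t \<circ>\<^sub>F NSrc s) (NTgt t \<circ>\<^sub>F NTgt s)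
     (\<lambda>x. Comp (FCod (NSrc t)) (FArr (NTgt t) (NMap s x)) (NMap t (FObj (NSrc s) x)))"

definition lwhisk ::
  "('p, 'b, 'q, 'c) fctr \<Rightarrow> ('o, 'a, 'p, 'b) ntrans \<Rightarrow> ('o, 'a, 'q, 'c) ntrans"
  (infixr "\<lhd>" 65) where
  "F \<lhd> t = mk_ntrans (F \<circ>\<^sub>F NSrc t) (F \<circ>\<^sub>F NTgt t) (\<lambda>x. FArr F (NMap t x))"

definition rwhisk ::
  "('p, 'b, 'q, 'c) ntrans \<Rightarrow> ('o, 'a, 'p, 'b) fctr \<Rightarrow> ('o, 'a, 'q, 'c) ntrans"
  (infixl "\<rhd>" 66) where
  "t \<rhd> F = mk_ntrans (NSrc t \<circ>\<^sub>F F) (NTgt t \<circ>\<^sub>F F) (\<lambda>x. NMap t (FObj F x))"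

definition nat_iso :: 
  "('o, 'a, 'p, 'b) ntrans \<Rightarrow> ('o, 'a, 'p, 'b) fctr \<Rightarrow> ('o, 'a, 'p, 'b) fctr \<Rightarrow> bool" where
  "nat_iso t F G \<longleftrightarrow>
     is_ntrans t F G \<and> (\<forall>x\<in>Obj (FDom F). iso_arr (FCod F) (NMap t x))"

text \<open>\<open>L\<close> is left adjoint to \<open>R\<close> with unit \<open>\<eta>\<close> and counit \<open>\<epsilon>\<close>.\<close>

definition adjunction ::
  "('o, 'a, 'p, 'b) fctr \<Rightarrow> ('p, 'b, 'o, 'a) fctr \<Rightarrow>
   ('o, 'a, 'o, 'a) ntrans \<Rightarrow> ('p, 'b, 'p, 'b) ntrans \<Rightarrow> bool" where
  "adjunction L R \<eta> \<epsilon> \<longleftrightarrow>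
     is_fctr L (FDom L) (FDom R) \<and> is_fctr R (FDom R) (FDom L) \<and>
     is_ntrans \<eta> (id_fctr (FDom L)) (R \<circ>\<^sub>F L) \<and>
     is_ntrans \<epsilon> (L \<circ>\<^sub>F R) (id_fctr (FDom R)) \<and>
     (\<epsilon> \<rhd> L) \<bullet> (L \<lhd> \<eta>) = id_ntrans L \<and>
     (R \<lhd> \<epsilon>) \<bullet> (\<eta> \<rhd> R) = id_ntrans R"

definition is_equivalence :: "('o, 'a, 'p, 'b) fctr \<Rightarrow> bool" where
  "is_equivalence F \<longleftrightarrow>
     (\<exists>G \<eta> \<epsilon>. is_fctr F (FDom F) (FCod F) \<and> is_fctr G (FCod F) (FDom F) \<and>
        nat_iso \<eta> (id_fctr (FDom F)) (G \<circ>\<^sub>F F) \<and> nat_iso \<epsilon> (F \<circ>\<^sub>F G) (id_fctr (FCod F)))"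

definition full_fctr :: "('o, 'a, 'p, 'b) fctr \<Rightarrow> bool" where
  "full_fctr F \<longleftrightarrow>
     (\<forall>x\<in>Obj (FDom F). \<forall>y\<in>Obj (FDom F).
        \<forall>g\<in>hom (FCod F) (FObj F x) (FObj F y). \<exists>f\<in>hom (FDom F) x y. FArr F f = g)"

definition ess_image :: "('o, 'a, 'p, 'b) fctr \<Rightarrow> 'p set" where
  "ess_image F = {y \<in> Obj (FCod F). \<exists>x\<in>Obj (FDom F). isomorphic (FCod F) (FObj F x) y}"

definition ess_surj :: "('o, 'a, 'p, 'b) fctr \<Rightarrow> bool" where
  "ess_surj F \<longleftrightarrow> ess_image F = Obj (FCod F)"

definition prod_cat :: "('o, 'a) cat \<Rightarrow> ('p, 'b) cat \<Rightarrow> ('o \<times> 'p, 'a \<times> 'b) cat" where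
  "prod_cat C D = mk_cat (Obj C \<times> Obj D) (Arr C \<times> Arr D)
     (\<lambda>(f, g). (Dom C f, Dom D g)) (\<lambda>(f, g). (Cod C f, Cod D g)) (\<lambda>(x, y). (Id C x, Id D y))
     (\<lambda>(f', g') (f, g). (Comp C f' f, Comp D g' g))"

definition pairing_fctr ::
  "('o, 'a, 'p, 'b) fctr \<Rightarrow> ('o, 'a, 'q, 'c) fctr \<Rightarrow> ('o, 'a, 'p \<times> 'q, 'b \<times> 'c) fctr" where
  "pairing_fctr F G = mk_fctr (FDom F) (prod_cat (FCod F) (FCod G))
     (\<lambda>x. (FObj F x, FObj G x)) (\<lambda>f. (FArr F f, FArr G f))"

text \<open>The functor category \<open>C\<^bsup>[1]\<^esup>\<close>: the arrow \<open>(f, g, a, b)\<close> is the commutative square with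
  \<open>b \<circ> f = g \<circ> a\<close>, regarded as a morphism from \<open>f\<close> to \<open>g\<close>.\<close>

definition arrow_cat :: "('o, 'a) cat \<Rightarrow> ('a, 'a \<times> 'a \<times> 'a \<times> 'a) cat" where
  "arrow_cat C = mk_cat (Arr C)
     {(f, g, a, b). f \<in> Arr C \<and> g \<in> Arr C \<and> a \<in> hom C (Dom C f) (Dom C g) \<and>
        b \<in> hom C (Cod C f) (Cod C g) \<and> Comp C b f = Comp C g a}
     (\<lambda>(f, g, a, b). f) (\<lambda>(f, g, a, b). g) (\<lambda>f. (f, f, Id C (Dom C f), Id C (Cod C f)))
     (\<lambda>(f', g', a', b') (f, g, a, b). (f, g', Comp C a' a, Comp C b' b))"


section \<open>Small categories\<close>

type_synonym 'v scat = "('v univ, 'v univ) cat"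
type_synonym 'v sfctr = "('v univ, 'v univ, 'v univ, 'v univ) fctr"
type_synonym 'v sntrans = "('v univ, 'v univ, 'v univ, 'v univ) ntrans"

definition small_cat :: "('v univ set \<Rightarrow> bool) \<Rightarrow> 'v scat \<Rightarrow> bool" where
  "small_cat S J \<longleftrightarrow> category J \<and> S (Obj J) \<and> S (Arr J)"

definition small_fctr :: "('v univ set \<Rightarrow> bool) \<Rightarrow> 'v sfctr \<Rightarrow> 'v scat \<Rightarrow> 'v scat \<Rightarrow> bool" where
  "small_fctr S u J K \<longleftrightarrow> small_cat S J \<and> small_cat S K \<and> is_fctr u J K"

definition empty_cat :: "'v scat" where
  "empty_cat = mk_cat {} {} (\<lambda>_. undefined) (\<lambda>_. undefined) (\<lambda>_. undefined) (\<lambda>_ _. undefined)"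

definition ord_cat :: "nat \<Rightarrow> 'v scat"  ("[_]\<^sub>c") where
  "[n]\<^sub>c = mk_cat (Num ` {..n}) {Pr (Num i) (Num j) | i j. i \<le> j \<and> j \<le> n}
     pfst psnd (\<lambda>x. Pr x x) (\<lambda>g f. Pr (pfst f) (psnd g))"

abbreviation pt_cat :: "'v scat"  ("e\<^sub>c") where
  "e\<^sub>c \<equiv> [0]\<^sub>c"

fun num_map :: "(nat \<Rightarrow> nat) \<Rightarrow> 'v univ \<Rightarrow> 'v univ" where
  "num_map h (Num i) = Num (h i)"
| "num_map h (Pr x y) = Pr (num_map h x) (num_map h y)"
| "num_map h (Atom a) = Atom a"

text \<open>The functor \<open>[m] \<rightarrow> [n]\<close> given by a monotone map \<open>h\<close>.\<close>

definition ord_fctr :: "nat \<Rightarrow> nat \<Rightarrow> (nat \<Rightarrow> nat) \<Rightarrow> 'v sfctr" where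
  "ord_fctr m n h = mk_fctr [m]\<^sub>c [n]\<^sub>c (num_map h) (num_map h)"

definition sprod_cat :: "'v scat \<Rightarrow> 'v scat \<Rightarrow> 'v scat"  (infixr "\<times>\<^sub>c" 70) where
  "J \<times>\<^sub>c K = mk_cat {Pr x y | x y. x \<in> Obj J \<and> y \<in> Obj K} {Pr f g | f g. f \<in> Arr J \<and> g \<in> Arr K}
     (\<lambda>f. Pr (Dom J (pfst f)) (Dom K (psnd f))) (\<lambda>f. Pr (Cod J (pfst f)) (Cod K (psnd f)))
     (\<lambda>x. Pr (Id J (pfst x)) (Id K (psnd x)))
     (\<lambda>g f. Pr (Comp J (pfst g) (pfst f)) (Comp K (psnd g) (psnd f)))"

definition sprod_fctr :: "'v sfctr \<Rightarrow> 'v sfctr \<Rightarrow> 'v sfctr"  (infixr "\<times>\<^sub>f" 70) where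
  "u \<times>\<^sub>f v = mk_fctr (FDom u \<times>\<^sub>c FDom v) (FCod u \<times>\<^sub>c FCod v)
     (\<lambda>x. Pr (FObj u (pfst x)) (FObj v (psnd x))) (\<lambda>f. Pr (FArr u (pfst f)) (FArr v (psnd f)))"

definition scoprod_cat :: "'v scat \<Rightarrow> 'v scat \<Rightarrow> 'v scat"  (infixr "\<squnion>\<^sub>c" 65) where
  "J \<squnion>\<^sub>c K = (let sel = (\<lambda>t. if t = Num 0 then J else K) in
     mk_cat (Pr (Num 0) ` Obj J \<union> Pr (Num 1) ` Obj K) (Pr (Num 0) ` Arr J \<union> Pr (Num 1) ` Arr K)
     (\<lambda>f. Pr (pfst f) (Dom (sel (pfst f)) (psnd f)))
     (\<lambda>f. Pr (pfst f) (Cod (sel (pfst f)) (psnd f)))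
     (\<lambda>x. Pr (pfst x) (Id (sel (pfst x)) (psnd x)))
     (\<lambda>g f. Pr (pfst f) (Comp (sel (pfst f)) (psnd g) (psnd f))))"

definition inl_fctr :: "'v scat \<Rightarrow> 'v scat \<Rightarrow> 'v sfctr" where
  "inl_fctr J K = mk_fctr J (J \<squnion>\<^sub>c K) (Pr (Num 0)) (Pr (Num 0))"

definition inr_fctr :: "'v scat \<Rightarrow> 'v scat \<Rightarrow> 'v sfctr" where
  "inr_fctr J K = mk_fctr K (J \<squnion>\<^sub>c K) (Pr (Num 1)) (Pr (Num 1))"

definition full_subcat :: "'v scat \<Rightarrow> 'v univ set \<Rightarrow> 'v scat" where
  "full_subcat K A = mk_cat (Obj K \<inter> A) {f \<in> Arr K. Dom K f \<in> A \<and> Cod K f \<in> A}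
     (Dom K) (Cod K) (Id K) (Comp K)"

definition subcat_incl :: "'v scat \<Rightarrow> 'v univ set \<Rightarrow> 'v sfctr" where
  "subcat_incl K A = mk_fctr (full_subcat K A) K (\<lambda>x. x) (\<lambda>f. f)"

definition obj_fctr :: "'v scat \<Rightarrow> 'v univ \<Rightarrow> 'v sfctr" where
  "obj_fctr K k = mk_fctr e\<^sub>c K (\<lambda>_. k) (\<lambda>_. Id K k)"

definition to_pt :: "'v scat \<Rightarrow> 'v sfctr" where
  "to_pt J = mk_fctr J e\<^sub>c (\<lambda>_. Num 0) (\<lambda>_. Pr (Num 0) (Num 0))"

text \<open>
  The slices \<open>J\<^bsub>/k\<^esub>\<close> and \<open>J\<^bsub>k/\<^esub>\<close> of a functor \<open>u : J \<rightarrow> K\<close>. The arrow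
  \<open>Pr x (Pr y a)\<close> is the morphism from \<open>x\<close> to \<open>y\<close> given by the arrow \<open>a\<close> of \<open>J\<close>.
\<close>

definition mk_slice ::
  "'v scat \<Rightarrow> 'v univ set \<Rightarrow> ('v univ \<Rightarrow> 'v univ \<Rightarrow> 'v univ \<Rightarrow> bool) \<Rightarrow> 'v scat" where
  "mk_slice J obs P = mk_cat obs
     {Pr x (Pr y a) | x y a. x \<in> obs \<and> y \<in> obs \<and> a \<in> hom J (pfst x) (pfst y) \<and> P (psnd x) (psnd y) a}
     pfst (\<lambda>m. pfst (psnd m)) (\<lambda>x. Pr x (Pr x (Id J (pfst x))))
     (\<lambda>n m. Pr (pfst m) (Pr (pfst (psnd n)) (Comp J (psnd (psnd n)) (psnd (psnd m)))))"

definition over_cat :: "'v sfctr \<Rightarrow> 'v univ \<Rightarrow> 'v scat" where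
  "over_cat u k = mk_slice (FDom u)
     {Pr j f | j f. j \<in> Obj (FDom u) \<and> f \<in> hom (FCod u) (FObj u j) k}
     (\<lambda>f f' a. Comp (FCod u) f' (FArr u a) = f)"

definition under_cat :: "'v sfctr \<Rightarrow> 'v univ \<Rightarrow> 'v scat" where
  "under_cat u k = mk_slice (FDom u)
     {Pr j f | j f. j \<in> Obj (FDom u) \<and> f \<in> hom (FCod u) k (FObj u j)}
     (\<lambda>f f' a. Comp (FCod u) (FArr u a) f = f')"

definition over_proj :: "'v sfctr \<Rightarrow> 'v univ \<Rightarrow> 'v sfctr" where
  "over_proj u k = mk_fctr (over_cat u k) (FDom u) pfst (\<lambda>m. psnd (psnd m))"

definition under_proj :: "'v sfctr \<Rightarrow> 'v univ \<Rightarrow> 'v sfctr" where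
  "under_proj u k = mk_fctr (under_cat u k) (FDom u) pfst (\<lambda>m. psnd (psnd m))"

definition over_nt :: "'v sfctr \<Rightarrow> 'v univ \<Rightarrow> 'v sntrans" where
  "over_nt u k = mk_ntrans (u \<circ>\<^sub>F over_proj u k) (obj_fctr (FCod u) k \<circ>\<^sub>F to_pt (over_cat u k)) psnd"

definition under_nt :: "'v sfctr \<Rightarrow> 'v univ \<Rightarrow> 'v sntrans" where
  "under_nt u k =
     mk_ntrans (obj_fctr (FCod u) k \<circ>\<^sub>F to_pt (under_cat u k)) (u \<circ>\<^sub>F under_proj u k) psnd"


section \<open>Prederivators and derivators\<close>

record ('v, 'o, 'a) preder =
  DCat :: "'v scat \<Rightarrow> ('o, 'a) cat"
  DFun :: "'v sfctr \<Rightarrow> ('o, 'a, 'o, 'a) fctr"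
  DNat :: "'v sntrans \<Rightarrow> ('o, 'a, 'o, 'a) ntrans"

definition prederivator :: "('v univ set \<Rightarrow> bool) \<Rightarrow> ('v, 'o, 'a) preder \<Rightarrow> bool" where
  "prederivator S D \<longleftrightarrow>
     (\<forall>J. small_cat S J \<longrightarrow> category (DCat D J)) \<and>
     (\<forall>J K u. small_fctr S u J K \<longrightarrow> is_fctr (DFun D u) (DCat D K) (DCat D J)) \<and>
     (\<forall>J K u v \<alpha>. small_fctr S u J K \<longrightarrow> small_fctr S v J K \<longrightarrow> is_ntrans \<alpha> u v \<longrightarrow>
        is_ntrans (DNat D \<alpha>) (DFun D u) (DFun D v)) \<and>
     (\<forall>J. small_cat S J \<longrightarrow> DFun D (id_fctr J) = id_fctr (DCat D J)) \<and>
     (\<forall>J K L u v. small_fctr S u J K \<longrightarrow> small_fctr S v K L \<longrightarrow>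
        DFun D (v \<circ>\<^sub>F u) = DFun D u \<circ>\<^sub>F DFun D v) \<and>
     (\<forall>J K u. small_fctr S u J K \<longrightarrow> DNat D (id_ntrans u) = id_ntrans (DFun D u)) \<and>
     (\<forall>J K u v w \<alpha> \<beta>. small_fctr S u J K \<longrightarrow> small_fctr S v J K \<longrightarrow> small_fctr S w J K \<longrightarrow>
        is_ntrans \<alpha> u v \<longrightarrow> is_ntrans \<beta> v w \<longrightarrow> DNat D (\<beta> \<bullet> \<alpha>) = DNat D \<beta> \<bullet> DNat D \<alpha>) \<and>
     (\<forall>J K L u u' v v' \<alpha> \<beta>. small_fctr S u J K \<longrightarrow> small_fctr S u' J K \<longrightarrow>
        small_fctr S v K L \<longrightarrow> small_fctr S v' K L \<longrightarrow>
        is_ntrans \<alpha> u u' \<longrightarrow> is_ntrans \<beta> v v' \<longrightarrow> DNat D (\<beta> \<star> \<alpha>) = DNat D \<alpha> \<star> DNat D \<beta>)"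

definition Der1 :: "('v univ set \<Rightarrow> bool) \<Rightarrow> ('v, 'o, 'a) preder \<Rightarrow> bool" where
  "Der1 S D \<longleftrightarrow>
     (\<forall>J K. small_cat S J \<longrightarrow> small_cat S K \<longrightarrow>
        is_equivalence (pairing_fctr (DFun D (inl_fctr J K)) (DFun D (inr_fctr J K)))) \<and>
     Obj (DCat D empty_cat) \<noteq> {}"

definition Der2 :: "('v univ set \<Rightarrow> bool) \<Rightarrow> ('v, 'o, 'a) preder \<Rightarrow> bool" where
  "Der2 S D \<longleftrightarrow>
     (\<forall>J. small_cat S J \<longrightarrow> (\<forall>f\<in>Arr (DCat D J).
        iso_arr (DCat D J) f \<longleftrightarrow>
        (\<forall>j\<in>Obj J. iso_arr (DCat D e\<^sub>c) (FArr (DFun D (obj_fctr J j)) f))))"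

text \<open>\<open>L = u\<^sub>!\<close>, resp. \<open>R = u\<^sub>\<star>\<close>, with the given unit and counit.\<close>

definition is_lan ::
  "('v, 'o, 'a) preder \<Rightarrow> 'v sfctr \<Rightarrow>
   ('o, 'a, 'o, 'a) fctr \<Rightarrow> ('o, 'a, 'o, 'a) ntrans \<Rightarrow> ('o, 'a, 'o, 'a) ntrans \<Rightarrow> bool" where
  "is_lan D u L \<eta> \<epsilon> \<longleftrightarrow> adjunction L (DFun D u) \<eta> \<epsilon>"

definition is_ran ::
  "('v, 'o, 'a) preder \<Rightarrow> 'v sfctr \<Rightarrow>
   ('o, 'a, 'o, 'a) fctr \<Rightarrow> ('o, 'a, 'o, 'a) ntrans \<Rightarrow> ('o, 'a, 'o, 'a) ntrans \<Rightarrow> bool" where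
  "is_ran D u R \<eta> \<epsilon> \<longleftrightarrow> adjunction (DFun D u) R \<eta> \<epsilon>"

definition Der3 :: "('v univ set \<Rightarrow> bool) \<Rightarrow> ('v, 'o, 'a) preder \<Rightarrow> bool" where
  "Der3 S D \<longleftrightarrow>
     (\<forall>J K u. small_fctr S u J K \<longrightarrow> (\<exists>L \<eta> \<epsilon>. is_lan D u L \<eta> \<epsilon>) \<and> (\<exists>R \<eta> \<epsilon>. is_ran D u R \<eta> \<epsilon>))"

text \<open>Kan extensions are only determined up to unique compatible isomorphism, and the condition
  below does not depend on their choice; it is imposed for all choices.\<close>

definition Der4 :: "('v univ set \<Rightarrow> bool) \<Rightarrow> ('v, 'o, 'a) preder \<Rightarrow> bool" where
  "Der4 S D \<longleftrightarrow>
     (\<forall>J K u k. small_fctr S u J K \<longrightarrow> k \<in> Obj K \<longrightarrow>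
        (let k' = DFun D (obj_fctr K k);
             pr' = DFun D (over_proj u k);
             p = to_pt (over_cat u k);
             \<alpha> = over_nt u k
         in \<forall>uL \<eta> \<epsilon> pL \<eta>p \<epsilon>p. is_lan D u uL \<eta> \<epsilon> \<longrightarrow> is_lan D p pL \<eta>p \<epsilon>p \<longrightarrow>
              nat_iso ((\<epsilon>p \<rhd> (k' \<circ>\<^sub>F uL)) \<bullet> (pL \<lhd> DNat D \<alpha> \<rhd> uL) \<bullet> ((pL \<circ>\<^sub>F pr') \<lhd> \<eta>))
                (pL \<circ>\<^sub>F pr') (k' \<circ>\<^sub>F uL)) \<and>
        (let k' = DFun D (obj_fctr K k);
             pr' = DFun D (under_proj u k);
             p = to_pt (under_cat u k);
             \<alpha> = under_nt u k
         in \<forall>uR \<eta> \<epsilon> pR \<eta>p \<epsilon>p. is_ran D u uR \<eta> \<epsilon> \<longrightarrow> is_ran D p pR \<eta>p \<epsilon>p \<longrightarrow>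
              nat_iso (((pR \<circ>\<^sub>F pr') \<lhd> \<epsilon>) \<bullet> (pR \<lhd> DNat D \<alpha> \<rhd> uR) \<bullet> (\<eta>p \<rhd> (k' \<circ>\<^sub>F uR)))
                (k' \<circ>\<^sub>F uR) (pR \<circ>\<^sub>F pr')))"

definition derivator :: "('v univ set \<Rightarrow> bool) \<Rightarrow> ('v, 'o, 'a) preder \<Rightarrow> bool" where
  "derivator S D \<longleftrightarrow> prederivator S D \<and> Der1 S D \<and> Der2 S D \<and> Der3 S D \<and> Der4 S D"


section \<open>Stable derivators\<close>

abbreviation square_cat :: "'v scat"  ("\<box>\<^sub>c") where
  "\<box>\<^sub>c \<equiv> [1]\<^sub>c \<times>\<^sub>c [1]\<^sub>c"

definition i_ul :: "'v sfctr" where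
  "i_ul = subcat_incl \<box>\<^sub>c {Pr (Num 0) (Num 0), Pr (Num 1) (Num 0), Pr (Num 0) (Num 1)}"

definition i_lr :: "'v sfctr" where
  "i_lr = subcat_incl \<box>\<^sub>c {Pr (Num 1) (Num 0), Pr (Num 0) (Num 1), Pr (Num 1) (Num 1)}"

definition coCartesian :: "('v, 'o, 'a) preder \<Rightarrow> 'o \<Rightarrow> bool" where
  "coCartesian D Y \<longleftrightarrow> (\<exists>L \<eta> \<epsilon>. is_lan D i_ul L \<eta> \<epsilon> \<and> Y \<in> ess_image L)"

definition Cartesian :: "('v, 'o, 'a) preder \<Rightarrow> 'o \<Rightarrow> bool" where
  "Cartesian D Y \<longleftrightarrow> (\<exists>R \<eta> \<epsilon>. is_ran D i_lr R \<eta> \<epsilon> \<and> Y \<in> ess_image R)"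

definition biCartesian :: "('v, 'o, 'a) preder \<Rightarrow> 'o \<Rightarrow> bool" where
  "biCartesian D Y \<longleftrightarrow> coCartesian D Y \<and> Cartesian D Y"

definition pointed :: "('v, 'o, 'a) preder \<Rightarrow> bool" where
  "pointed D \<longleftrightarrow> (\<exists>z. zero_object (DCat D e\<^sub>c) z)"

text \<open>\<open>i \<times> id\<^sub>J\<close>, regarded as a functor from \<open>J \<cong> e \<times> J\<close> to \<open>[1] \<times> J\<close>.\<close>

definition end_fctr :: "nat \<Rightarrow> 'v scat \<Rightarrow> 'v sfctr" where
  "end_fctr i J = mk_fctr J ([1]\<^sub>c \<times>\<^sub>c J) (Pr (Num i)) (Pr (Pr (Num i) (Num i)))"

definition end_nt :: "'v scat \<Rightarrow> 'v sntrans" where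
  "end_nt J = mk_ntrans (end_fctr 0 J) (end_fctr 1 J) (\<lambda>j. Pr (Pr (Num 0) (Num 1)) (Id J j))"

definition diagram_fctr ::
  "('v, 'o, 'a) preder \<Rightarrow> 'v scat \<Rightarrow> ('o, 'a, 'a, 'a \<times> 'a \<times> 'a \<times> 'a) fctr" where
  "diagram_fctr D J = (let C = DCat D ([1]\<^sub>c \<times>\<^sub>c J); t = NMap (DNat D (end_nt J)) in
     mk_fctr C (arrow_cat (DCat D J)) t
       (\<lambda>f. (t (Dom C f), t (Cod C f),
             FArr (DFun D (end_fctr 0 J)) f, FArr (DFun D (end_fctr 1 J)) f)))"

definition strong :: "('v univ set \<Rightarrow> bool) \<Rightarrow> ('v, 'o, 'a) preder \<Rightarrow> bool" where
  "strong S D \<longleftrightarrow>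
     (\<forall>J. small_cat S J \<longrightarrow> full_fctr (diagram_fctr D J) \<and> ess_surj (diagram_fctr D J))"

definition stable_derivator :: "('v univ set \<Rightarrow> bool) \<Rightarrow> ('v, 'o, 'a) preder \<Rightarrow> bool" where
  "stable_derivator S D \<longleftrightarrow>
     derivator S D \<and> strong S D \<and> pointed D \<and>
     (\<forall>Y\<in>Obj (DCat D \<box>\<^sub>c). coCartesian D Y \<longleftrightarrow> Cartesian D Y)"

text \<open>The monotone injection \<open>d\<^sup>i : [1] \<rightarrow> [2]\<close> omitting \<open>i\<close>, and \<open>d\<^sub>i(X)\<close>.\<close>

definition coface :: "nat \<Rightarrow> 'v sfctr" where
  "coface i = ord_fctr 1 2 (\<lambda>j. if j < i then j else Suc j)"

definition face :: "('v, 'o, 'a) preder \<Rightarrow> nat \<Rightarrow> 'o \<Rightarrow> 'o" where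
  "face D i X = FObj (DFun D (coface i \<times>\<^sub>f id_fctr [1]\<^sub>c)) X"

end

theory Submission
  imports Defs
begin

text \<open>
  Call an object \<open>v\<close> left extended along a functor \<open>F\<close> if every map \<open>F v \<rightarrow> F w\<close> is the image of a
  unique map \<open>v \<rightarrow> w\<close>. For the inclusion \<open>u\<close> of a full subcategory the objects left extended along
  \<open>u\<^sup>*\<close> are those in the essential image of \<open>u\<^sub>!\<close>, so a square is coCartesian iff it is left extended
  along restriction to its upper left corner, and Cartesian iff it is left extended, in the
  opposite categories, along restriction to its lower right corner.

  Let \<open>A\<close> consist of the points \<open>(0,0), (1,0), (2,0), (0,1)\<close> of \<open>[2] \<times> [1]\<close>. If \<open>X\<close> is left extended
  from \<open>A\<close>, then all three faces of \<open>X\<close> are coCartesian (\<open>faces_left_extended\<close>). For the face \<open>d\<^sub>1\<close>,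
  the prism has a monotone map \<open>s\<close> onto it with \<open>x \<le> s x\<close> which preserves \<open>A\<close>; restriction to the face
  is then left adjoint to restriction along \<open>s\<close>, and left extended objects are carried to left
  extended ones (\<open>retract_left_extended\<close>). The same holds for the face \<open>d\<^sub>0\<close> once \<open>A\<close> is enlarged by
  \<open>(1,1)\<close> to \<open>B\<close>. The face \<open>d\<^sub>2\<close> and the subposet \<open>B\<close> are downward closed, and for those one uses that
  the value at \<open>k\<close> of a left Kan extension from \<open>A\<close> is computed by the slice \<open>A\<^bsub>/k\<^esub>\<close>, which only sees the
  points below \<open>k\<close> (\<open>sieve_restriction\<close>).

  Conversely, let \<open>d\<^sub>2(X)\<close> and one other face be coCartesian, and let \<open>c : X' \<rightarrow> X\<close> be the counit, where
  \<open>X'\<close> is left extended from \<open>A\<close> and \<open>c\<close> is invertible on \<open>A\<close>. A map between left extended objects is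
  invertible if its restriction is; applied to \<open>d\<^sub>2(c)\<close> this shows that \<open>c\<close> is invertible at \<open>(1,1)\<close>,
  and applied to the other face that it is invertible at \<open>(2,1)\<close>. So \<open>X\<close> is left extended from \<open>A\<close>
  and its third face is coCartesian as well. In short: if \<open>d\<^sub>2(X)\<close> is coCartesian, then \<open>d\<^sub>0(X)\<close> is iff
  \<open>d\<^sub>1(X)\<close> is (\<open>pasting\<close>).

  The argument only refers to a poset, to the categories of diagrams on its subsets and to
  restriction along monotone maps. It is therefore carried out in a locale, \<open>poset_diagrams\<close>, which
  is interpreted once by the derivator and once by the opposites of its values with the order
  reversed. The second interpretation says: if \<open>d\<^sub>0(X)\<close> is Cartesian, then \<open>d\<^sub>2(X)\<close> is iff \<open>d\<^sub>1(X)\<close>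
  is. In a stable derivator coCartesian and Cartesian squares agree, and the two equivalences
  together contain the three implications.

  Der4 enters in a form without chosen Kan extensions: \<open>V\<close> is left extended along \<open>u\<^sup>*\<close> iff for each \<open>k\<close>
  the canonical map \<open>pr\<^sup>* u\<^sup>* V \<rightarrow> p\<^sup>* V\<^sub>k\<close> over the slice is a universal arrow to \<open>p\<^sup>*\<close>
  (\<open>left_extended_iff\<close>). This condition involves nothing but \<open>V\<close> and the slice over \<open>k\<close>.
\<close>

section \<open>Arrows, functors and isomorphisms\<close>

lemma homI: "f \<in> Arr C \<Longrightarrow> Dom C f = x \<Longrightarrow> Cod C f = y \<Longrightarrow> f \<in> hom C x y"
  by (simp add: hom_def)

lemma homD: "f \<in> hom C x y \<Longrightarrow> f \<in> Arr C \<and> Dom C f = x \<and> Cod C f = y"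
  by (simp add: hom_def)

lemma Dom_in: "category C \<Longrightarrow> f \<in> Arr C \<Longrightarrow> Dom C f \<in> Obj C"
  and Cod_in: "category C \<Longrightarrow> f \<in> Arr C \<Longrightarrow> Cod C f \<in> Obj C"
  by (auto simp: category_def)

lemma hom_obj: "category C \<Longrightarrow> f \<in> hom C x y \<Longrightarrow> x \<in> Obj C \<and> y \<in> Obj C"
  by (auto simp: hom_def Dom_in Cod_in)

lemma id_hom: "category C \<Longrightarrow> x \<in> Obj C \<Longrightarrow> Id C x \<in> hom C x x"
  by (simp add: category_def)

lemma comp_hom: "category C \<Longrightarrow> f \<in> hom C x y \<Longrightarrow> g \<in> hom C y z \<Longrightarrow> Comp C g f \<in> hom C x z"
  by (auto simp: category_def hom_def)

lemma comp_id: "category C \<Longrightarrow> f \<in> hom C x y \<Longrightarrow> Comp C f (Id C x) = f"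
  and id_comp: "category C \<Longrightarrow> f \<in> hom C x y \<Longrightarrow> Comp C (Id C y) f = f"
  by (auto simp: category_def hom_def)

lemma comp_assoc:
  "category C \<Longrightarrow> f \<in> hom C x y \<Longrightarrow> g \<in> hom C y z \<Longrightarrow> h \<in> hom C z w \<Longrightarrow>
     Comp C h (Comp C g f) = Comp C (Comp C h g) f"
  by (auto simp: category_def hom_def)

lemma fctr_cats: "is_fctr F C D \<Longrightarrow> category C \<and> category D \<and> FDom F = C \<and> FCod F = D"
  by (simp add: is_fctr_def)

lemma fctr_obj: "is_fctr F C D \<Longrightarrow> x \<in> Obj C \<Longrightarrow> FObj F x \<in> Obj D"
  by (auto simp: is_fctr_def)

lemma fctr_hom: "is_fctr F C D \<Longrightarrow> f \<in> hom C x y \<Longrightarrow> FArr F f \<in> hom D (FObj F x) (FObj F y)"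
  by (auto simp: is_fctr_def hom_def)

lemma fctr_id: "is_fctr F C D \<Longrightarrow> x \<in> Obj C \<Longrightarrow> FArr F (Id C x) = Id D (FObj F x)"
  by (auto simp: is_fctr_def)

lemma fctr_comp:
  "is_fctr F C D \<Longrightarrow> f \<in> hom C x y \<Longrightarrow> g \<in> hom C y z \<Longrightarrow>
     FArr F (Comp C g f) = Comp D (FArr F g) (FArr F f)"
  by (auto simp: is_fctr_def hom_def)

lemma iso_arrI:
  "f \<in> hom C x y \<Longrightarrow> g \<in> hom C y x \<Longrightarrow> Comp C g f = Id C x \<Longrightarrow> Comp C f g = Id C y \<Longrightarrow> iso_arr C f"
  unfolding iso_arr_def by (auto simp: hom_def)

lemma iso_arrE:
  assumes "iso_arr C f" "f \<in> hom C x y"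
  obtains g where "g \<in> hom C y x" "Comp C g f = Id C x" "Comp C f g = Id C y"
  using assms unfolding iso_arr_def by (auto simp: hom_def)

lemma fctr_iso:
  assumes F: "is_fctr F C D" and f: "iso_arr C f"
  shows "iso_arr D (FArr F f)"
proof -
  have h: "f \<in> hom C (Dom C f) (Cod C f)" using f by (auto simp: iso_arr_def hom_def)
  obtain g where g: "g \<in> hom C (Cod C f) (Dom C f)" "Comp C g f = Id C (Dom C f)"
     "Comp C f g = Id C (Cod C f)" using iso_arrE[OF f h] .
  note obs = hom_obj[OF _ h] fctr_cats[OF F]
  show ?thesis
  proof (rule iso_arrI[OF fctr_hom[OF F h] fctr_hom[OF F g(1)]])
    show "Comp D (FArr F g) (FArr F f) = Id D (FObj F (Dom C f))"
      using fctr_comp[OF F h g(1)] g(2) fctr_id[OF F] obs by simp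
    show "Comp D (FArr F f) (FArr F g) = Id D (FObj F (Cod C f))"
      using fctr_comp[OF F g(1) h] g(3) fctr_id[OF F] obs by simp
  qed
qed

lemma one_sided_inverse_iso:
  assumes C: "category C" and f: "f \<in> hom C x y" and g: "g \<in> hom C y x"
    and gf: "Comp C g f = Id C x" and iso: "iso_arr C f"
  shows "iso_arr C g"
proof -
  obtain h where h: "h \<in> hom C y x" "Comp C h f = Id C x" "Comp C f h = Id C y"
    using iso_arrE[OF iso f] .
  have "g = Comp C g (Comp C f h)" using h comp_id[OF C g] by simp
  also have "\<dots> = h" using comp_assoc[OF C h(1) f g] gf id_comp[OF C h(1)] by simp
  finally show ?thesis using h f g iso_arrI[of g C y x f] by simp
qed

section \<open>Opposite categories\<close>

text \<open>
  Right Kan extensions and Cartesian squares are treated as left Kan extensions and coCartesian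
  squares in opposite categories. Objects, arrows and the maps of functors are kept, so that passing
  to opposites needs no translation.
\<close>

definition op_cat :: "('o, 'a) cat \<Rightarrow> ('o, 'a) cat" where
  "op_cat C = \<lparr>Obj = Obj C, Arr = Arr C, Dom = Cod C, Cod = Dom C, Id = Id C,
     Comp = (\<lambda>g f. Comp C f g)\<rparr>"

definition op_fctr :: "('o, 'a, 'p, 'b) fctr \<Rightarrow> ('o, 'a, 'p, 'b) fctr" where
  "op_fctr F = \<lparr>FDom = op_cat (FDom F), FCod = op_cat (FCod F), FObj = FObj F, FArr = FArr F\<rparr>"

lemma op_cat_simps [simp]:
  "Obj (op_cat C) = Obj C" "Arr (op_cat C) = Arr C" "Dom (op_cat C) = Cod C"
  "Cod (op_cat C) = Dom C" "Id (op_cat C) = Id C" "Comp (op_cat C) g f = Comp C f g"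
  by (simp_all add: op_cat_def)

lemma op_fctr_simps [simp]:
  "FDom (op_fctr F) = op_cat (FDom F)" "FCod (op_fctr F) = op_cat (FCod F)"
  "FObj (op_fctr F) = FObj F" "FArr (op_fctr F) = FArr F"
  by (simp_all add: op_fctr_def)

lemma hom_op [simp]: "hom (op_cat C) x y = hom C y x"
  by (auto simp: hom_def)

lemma category_op: "category C \<Longrightarrow> category (op_cat C)"
  unfolding category_def by (auto simp: hom_def)

lemma is_fctr_op: "is_fctr F C D \<Longrightarrow> is_fctr (op_fctr F) (op_cat C) (op_cat D)"
  by (auto simp: is_fctr_def category_op hom_def)

lemma op_comp_fctr: "is_fctr F B B' \<Longrightarrow> op_fctr (G \<circ>\<^sub>F F) = op_fctr G \<circ>\<^sub>F op_fctr F"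
  by (simp add: op_fctr_def comp_fctr_def mk_fctr_def)

lemma op_id_fctr: "op_fctr (id_fctr B) = id_fctr (op_cat B)"
  by (simp add: op_fctr_def id_fctr_def mk_fctr_def)

lemma iso_arr_op [simp]: "iso_arr (op_cat C) f = iso_arr C f"
  by (auto simp: iso_arr_def)

section \<open>Universal arrows and left extended objects\<close>

definition universal :: "('o, 'a, 'p, 'b) fctr \<Rightarrow> 'p \<Rightarrow> 'o \<Rightarrow> 'b \<Rightarrow> bool" where
  "universal F y v m \<longleftrightarrow> v \<in> Obj (FDom F) \<and> m \<in> hom (FCod F) y (FObj F v) \<and>
     (\<forall>w\<in>Obj (FDom F). \<forall>g\<in>hom (FCod F) y (FObj F w).
        \<exists>!f. f \<in> hom (FDom F) v w \<and> Comp (FCod F) (FArr F f) m = g)"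

text \<open>
  The objects that the left adjoint of \<open>F\<close>, where there is one with invertible unit, produces up to
  isomorphism; the condition itself does not refer to an adjoint. For the opposite of \<open>F\<close> it
  describes the values of a right adjoint.
\<close>

definition left_extended :: "('o, 'a, 'p, 'b) fctr \<Rightarrow> 'o \<Rightarrow> bool" where
  "left_extended F v \<longleftrightarrow> v \<in> Obj (FDom F) \<and>
     (\<forall>w\<in>Obj (FDom F). \<forall>g\<in>hom (FCod F) (FObj F v) (FObj F w).
        \<exists>!f. f \<in> hom (FDom F) v w \<and> FArr F f = g)"

lemma universal_ex:
  assumes "universal F y v m" "w \<in> Obj (FDom F)" "g \<in> hom (FCod F) y (FObj F w)"
  obtains f where "f \<in> hom (FDom F) v w" "Comp (FCod F) (FArr F f) m = g"
  using assms unfolding universal_def by blast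

lemma universal_uniq:
  assumes "universal F y v m" "category (FDom F)" "is_fctr F (FDom F) (FCod F)"
   "f \<in> hom (FDom F) v w" "f' \<in> hom (FDom F) v w"
   "Comp (FCod F) (FArr F f) m = Comp (FCod F) (FArr F f') m"
  shows "f = f'"
proof -
  have "Comp (FCod F) (FArr F f) m \<in> hom (FCod F) y (FObj F w)"
    using assms comp_hom fctr_hom fctr_cats unfolding universal_def by metis
  then show ?thesis using assms hom_obj[OF assms(2,4)] unfolding universal_def by metis
qed

text \<open>
  This makes the lemmas on universal arrows available for left extended objects.
\<close>

lemma left_extended_universal:
  assumes F: "is_fctr F C D"
  shows "left_extended F v \<longleftrightarrow> universal F (FObj F v) v (Id D (FObj F v))"
proof -
  have c: "category C" "category D" "FDom F = C" "FCod F = D" using fctr_cats[OF F] by auto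
  have "Comp D (FArr F f) (Id D (FObj F v)) = FArr F f" if "f \<in> hom C v w" for f w
    using comp_id[OF c(2)] fctr_hom[OF F that] by blast
  then show ?thesis unfolding left_extended_def universal_def c
    using id_hom[OF c(2)] fctr_obj[OF F] by (metis (no_types, lifting))
qed

text \<open>
  The usual uniqueness of universal arrows, for a given comparison map: the comparison in the other
  direction is inverse to it because both composites are compatible with the universal arrows.
\<close>

lemma universal_comparison_iso:
  assumes F: "is_fctr F C D" and u: "universal F y v m" and u': "universal F y v' m'"
    and f: "f \<in> hom C v v'" and e: "Comp D (FArr F f) m = m'"
  shows "iso_arr C f"
proof -
  have c: "category C" "category D" "FDom F = C" "FCod F = D" using fctr_cats[OF F] by auto
  have o: "v \<in> Obj C" "v' \<in> Obj C" "m \<in> hom D y (FObj F v)" "m' \<in> hom D y (FObj F v')"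
    using u u' by (auto simp: universal_def c)
  obtain g where g: "g \<in> hom C v' v" "Comp D (FArr F g) m' = m"
    using universal_ex[OF u'] o c by metis
  have gf: "Comp C g f = Id C v"
  proof (rule universal_uniq[OF u, unfolded c, OF c(1) F])
    show "Comp D (FArr F (Comp C g f)) m = Comp D (FArr F (Id C v)) m"
      using fctr_comp[OF F f g(1)] comp_assoc[OF c(2) o(3) fctr_hom[OF F f] fctr_hom[OF F g(1)]]
        e g(2) fctr_id[OF F o(1)] id_comp[OF c(2) o(3)] by simp
  qed (use comp_hom[OF c(1) f g(1)] id_hom[OF c(1) o(1)] in auto)
  have fg: "Comp C f g = Id C v'"
  proof (rule universal_uniq[OF u', unfolded c, OF c(1) F])
    show "Comp D (FArr F (Comp C f g)) m' = Comp D (FArr F (Id C v')) m'"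
      using fctr_comp[OF F g(1) f] comp_assoc[OF c(2) o(4) fctr_hom[OF F g(1)] fctr_hom[OF F f]]
        e g(2) fctr_id[OF F o(2)] id_comp[OF c(2) o(4)] by simp
  qed (use comp_hom[OF c(1) g(1) f] id_hom[OF c(1) o(2)] in auto)
  show ?thesis by (rule iso_arrI[OF f g(1) gf fg])
qed

lemma iso_cancel_right:
  assumes C: "category C" and f: "f \<in> hom C x y" "iso_arr C f"
  shows "\<And>h h'. h \<in> hom C y z \<Longrightarrow> h' \<in> hom C y z \<Longrightarrow> Comp C h f = Comp C h' f \<Longrightarrow> h = h'"
    and "\<And>g. g \<in> hom C x z \<Longrightarrow> \<exists>h \<in> hom C y z. Comp C h f = g"
proof -
  obtain k where k: "k \<in> hom C y x" "Comp C k f = Id C x" "Comp C f k = Id C y"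
    using iso_arrE[OF f(2,1)] .
  show "h = h'" if "h \<in> hom C y z" "h' \<in> hom C y z" "Comp C h f = Comp C h' f" for h h'
    using comp_assoc[OF C k(1) f(1) that(1)] comp_assoc[OF C k(1) f(1) that(2)] that
      comp_id[OF C that(1)] comp_id[OF C that(2)] k by simp
  show "\<exists>h \<in> hom C y z. Comp C h f = g" if "g \<in> hom C x z" for g
    using comp_hom[OF C k(1) that] comp_assoc[OF C f(1) k(1) that] k comp_id[OF C that] by metis
qed

lemma universal_iso_target:
  assumes F: "is_fctr F C D" and u: "universal F y v m"
    and f: "f \<in> hom C v v'" "iso_arr C f"
  shows "universal F y v' (Comp D (FArr F f) m)"
proof -
  have c: "category C" "category D" "FDom F = C" "FCod F = D" using fctr_cats[OF F] by auto
  have o: "v \<in> Obj C" "v' \<in> Obj C" "m \<in> hom D y (FObj F v)"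
    using u hom_obj[OF c(1) f(1)] by (auto simp: universal_def c)
  have eq: "Comp D (FArr F h) (Comp D (FArr F f) m) = Comp D (FArr F (Comp C h f)) m"
    if "h \<in> hom C v' w" for h w
    using comp_assoc[OF c(2) o(3) fctr_hom[OF F f(1)] fctr_hom[OF F that]]
      fctr_comp[OF F f(1) that] by simp
  show ?thesis unfolding universal_def c
  proof (intro conjI ballI)
    fix w g assume w: "w \<in> Obj C" and g: "g \<in> hom D y (FObj F w)"
    obtain k where k: "k \<in> hom C v w" "Comp D (FArr F k) m = g"
      using universal_ex[OF u, unfolded c, OF w g] .
    obtain h where h: "h \<in> hom C v' w" "Comp C h f = k"
      using iso_cancel_right(2)[OF c(1) f k(1)] by blast
    show "\<exists>!h. h \<in> hom C v' w \<and> Comp D (FArr F h) (Comp D (FArr F f) m) = g"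
    proof (rule ex1I[of _ h])
      fix h' assume h': "h' \<in> hom C v' w \<and> Comp D (FArr F h') (Comp D (FArr F f) m) = g"
      have "Comp C h' f = Comp C h f"
        by (rule universal_uniq[OF u, unfolded c, OF c(1) F])
          (use eq h h' k comp_hom[OF c(1) f(1)] in auto)
      then show "h' = h" using iso_cancel_right(1)[OF c(1) f] h h' by blast
    qed (use eq h k in auto)
  qed (use o comp_hom[OF c(2) o(3) fctr_hom[OF F f(1)]] in auto)
qed

lemma universal_iso_left_extended:
  assumes F: "is_fctr F C D" and u: "universal F y v m" and m: "iso_arr D m"
  shows "left_extended F v"
proof -
  have c: "category C" "category D" "FDom F = C" "FCod F = D" using fctr_cats[OF F] by auto
  have o: "v \<in> Obj C" "m \<in> hom D y (FObj F v)"
    using u by (auto simp: universal_def c)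
  show ?thesis unfolding left_extended_def c
  proof (intro conjI ballI)
    fix w g assume w: "w \<in> Obj C" and g: "g \<in> hom D (FObj F v) (FObj F w)"
    obtain f where f: "f \<in> hom C v w" "Comp D (FArr F f) m = Comp D g m"
      using universal_ex[OF u, unfolded c, OF w comp_hom[OF c(2) o(2) g]] .
    show "\<exists>!f. f \<in> hom C v w \<and> FArr F f = g"
    proof (rule ex1I[of _ f])
      show "f \<in> hom C v w \<and> FArr F f = g"
        using f iso_cancel_right(1)[OF c(2) o(2) m fctr_hom[OF F f(1)] g] by simp
    qed (use f universal_uniq[OF u, unfolded c, OF c(1) F] in blast)
  qed (use o in auto)
qed

text \<open>
  The inverse of \<open>F f\<close> lifts uniquely. This is how a map that is known to be invertible on a
  corner is seen to be invertible on the whole square.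
\<close>

lemma left_extended_iso:
  assumes F: "is_fctr F C D" and v: "left_extended F v" "left_extended F w"
    and f: "f \<in> hom C v w" "iso_arr D (FArr F f)"
  shows "iso_arr C f"
proof -
  have c: "category C" "category D" "FDom F = C" "FCod F = D" using fctr_cats[OF F] by auto
  have "universal F (FObj F v) w (FArr F f)"
    unfolding universal_def c
  proof (intro conjI ballI)
    fix z g assume z: "z \<in> Obj C" and g: "g \<in> hom D (FObj F v) (FObj F z)"
    obtain h where h: "h \<in> hom D (FObj F w) (FObj F z)" "Comp D h (FArr F f) = g"
      using iso_cancel_right(2)[OF c(2) fctr_hom[OF F f(1)] f(2) g] by blast
    obtain k where k: "k \<in> hom C w z" "FArr F k = h"
      and ku: "\<And>k'. k' \<in> hom C w z \<Longrightarrow> FArr F k' = h \<Longrightarrow> k' = k"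
      using v(2) z h unfolding left_extended_def c by metis
    show "\<exists>!k. k \<in> hom C w z \<and> Comp D (FArr F k) (FArr F f) = g"
      using k ku h iso_cancel_right(1)[OF c(2) fctr_hom[OF F f(1)] f(2)] fctr_hom[OF F] by metis
  qed (use v fctr_hom[OF F f(1)] in \<open>auto simp: left_extended_def c\<close>)
  moreover have "universal F (FObj F v) v (Id D (FObj F v))"
    using v(1) left_extended_universal[OF F] by simp
  ultimately show ?thesis
    using universal_comparison_iso[OF F _ _ f(1)] comp_id[OF c(2) fctr_hom[OF F f(1)]] by blast
qed

lemma left_extended_lift:
  assumes F: "is_fctr F C D" and v: "left_extended F v" and w: "w \<in> Obj C"
    and g: "g \<in> hom D (FObj F v) (FObj F w)"
  obtains f where "f \<in> hom C v w" "FArr F f = g"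
  using assms fctr_cats[OF F] unfolding left_extended_def by metis

lemma left_extended_faithful:
  assumes F: "is_fctr F C D" and v: "left_extended F v" and f: "f \<in> hom C v w" "f' \<in> hom C v w"
    and e: "FArr F f = FArr F f'"
  shows "f = f'"
proof -
  have c: "category C" "FDom F = C" "FCod F = D" using fctr_cats[OF F] by auto
  then show ?thesis using v f e fctr_hom[OF F f(1)] hom_obj[OF c(1) f(1)] unfolding left_extended_def by metis
qed

lemma left_extended_iso_target:
  assumes F: "is_fctr F C D" and v: "left_extended F v" and f: "f \<in> hom C v w" "iso_arr C f"
  shows "left_extended F w"
proof -
  have c: "category C" "category D" using fctr_cats[OF F] by auto
  have u: "universal F (FObj F v) v (Id D (FObj F v))" using left_extended_universal[OF F] v by blast
  from universal_iso_target[OF F u f]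
  have "universal F (FObj F v) w (FArr F f)" using comp_id[OF c(2) fctr_hom[OF F f(1)]] by simp
  then show ?thesis using universal_iso_left_extended[OF F] fctr_iso[OF F f(2)] by blast
qed

text \<open>
  Here \<open>c\<close> is the counit at \<open>v\<close>: its image under \<open>F\<close> is a one-sided inverse of the unit \<open>m\<close>, hence
  invertible along with \<open>m\<close>.
\<close>

lemma universal_iso_replacement:
  assumes F: "is_fctr F C D" and v: "v \<in> Obj C" and u: "universal F (FObj F v) w m" and m: "iso_arr D m"
  shows "\<exists>c. c \<in> hom C w v \<and> left_extended F w \<and> iso_arr D (FArr F c)"
proof -
  have c: "category C" "category D" "FDom F = C" "FCod F = D" using fctr_cats[OF F] by auto
  have mh: "m \<in> hom D (FObj F v) (FObj F w)" using u by (simp add: universal_def c)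
  obtain f where f: "f \<in> hom C w v" "Comp D (FArr F f) m = Id D (FObj F v)"
    using universal_ex[OF u, unfolded c, OF v id_hom[OF c(2) fctr_obj[OF F v]]] .
  show ?thesis
    using one_sided_inverse_iso[OF c(2) mh fctr_hom[OF F f(1)] f(2) m] f(1)
      universal_iso_left_extended[OF F u m] by blast
qed

section \<open>Adjunctions\<close>

text \<open>
  The unit and the counit are given by their components, so that the lemma also applies to the
  opposite adjunction.
\<close>

lemma universal_unit:
  assumes L: "is_fctr L C D" and R: "is_fctr R D C"
    and et: "\<And>y. y \<in> Obj C \<Longrightarrow> et y \<in> hom C y (FObj R (FObj L y))"
    and et_nat: "\<And>y y' g. g \<in> hom C y y' \<Longrightarrow>
          Comp C (FArr R (FArr L g)) (et y) = Comp C (et y') g"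
    and ep: "\<And>x. x \<in> Obj D \<Longrightarrow> ep x \<in> hom D (FObj L (FObj R x)) x"
    and ep_nat: "\<And>x x' f. f \<in> hom D x x' \<Longrightarrow>
          Comp D f (ep x) = Comp D (ep x') (FArr L (FArr R f))"
    and tri_L: "\<And>y. y \<in> Obj C \<Longrightarrow> Comp D (ep (FObj L y)) (FArr L (et y)) = Id D (FObj L y)"
    and tri_R: "\<And>x. x \<in> Obj D \<Longrightarrow> Comp C (FArr R (ep x)) (et (FObj R x)) = Id C (FObj R x)"
    and y: "y \<in> Obj C"
  shows "universal R y (FObj L y) (et y)"
proof -
  have c: "category C" "category D" "FDom R = D" "FCod R = C"
    using fctr_cats[OF L] fctr_cats[OF R] by auto
  note Ly = fctr_obj[OF L y]
  show ?thesis unfolding universal_def c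
  proof (intro conjI ballI)
    fix w g assume w: "w \<in> Obj D" and g: "g \<in> hom C y (FObj R w)"
    note Lg = fctr_hom[OF L g]
    let ?f = "Comp D (ep w) (FArr L g)"
    have f: "?f \<in> hom D (FObj L y) w" using comp_hom[OF c(2) Lg ep[OF w]] .
    have "Comp C (FArr R ?f) (et y) = Comp C (FArr R (ep w)) (Comp C (FArr R (FArr L g)) (et y))"
      using fctr_comp[OF R Lg ep[OF w]]
        comp_assoc[OF c(1) et[OF y] fctr_hom[OF R Lg] fctr_hom[OF R ep[OF w]]] by simp
    also have "\<dots> = Comp C (Comp C (FArr R (ep w)) (et (FObj R w))) g"
      using et_nat[OF g] comp_assoc[OF c(1) g et[OF fctr_obj[OF R w]] fctr_hom[OF R ep[OF w]]]
      by simp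
    also have "\<dots> = g" using tri_R[OF w] id_comp[OF c(1) g] by simp
    finally have fg: "Comp C (FArr R ?f) (et y) = g" .
    have "h = ?f" if h: "h \<in> hom D (FObj L y) w" and hg: "Comp C (FArr R h) (et y) = g" for h
    proof -
      note Le = fctr_hom[OF L et[OF y]] note Rh = fctr_hom[OF R h]
      have "?f = Comp D (ep w) (Comp D (FArr L (FArr R h)) (FArr L (et y)))"
        using fctr_comp[OF L et[OF y] Rh] hg by simp
      also have "\<dots> = Comp D h (Comp D (ep (FObj L y)) (FArr L (et y)))"
        using comp_assoc[OF c(2) Le fctr_hom[OF L Rh] ep[OF w]] ep_nat[OF h]
          comp_assoc[OF c(2) Le ep[OF Ly] h] by simp
      finally show ?thesis using tri_L[OF y] comp_id[OF c(2) h] by simp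
    qed
    then show "\<exists>!f. f \<in> hom D (FObj L y) w \<and> Comp C (FArr R f) (et y) = g"
      using f fg by blast
  qed (use Ly et[OF y] in auto)
qed

lemma ntrans_hom: "is_ntrans t F G \<Longrightarrow> is_fctr F C D \<Longrightarrow> x \<in> Obj C \<Longrightarrow> NMap t x \<in> hom D (FObj F x) (FObj G x)"
  using fctr_cats[of F C D] by (auto simp: is_ntrans_def)

lemma ntrans_nat: "is_ntrans t F G \<Longrightarrow> is_fctr F C D \<Longrightarrow> f \<in> hom C x y \<Longrightarrow>
   Comp D (FArr G f) (NMap t x) = Comp D (NMap t y) (FArr F f)"
  using fctr_cats[of F C D] by (auto simp: is_ntrans_def hom_def)

lemma adjunctionD:
  assumes a: "adjunction L R \<eta> \<epsilon>" and L: "is_fctr L C D"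
  shows "is_fctr R D C"
    and "\<And>y. y \<in> Obj C \<Longrightarrow> NMap \<eta> y \<in> hom C y (FObj R (FObj L y))"
    and "\<And>y y' g. g \<in> hom C y y' \<Longrightarrow>
          Comp C (FArr R (FArr L g)) (NMap \<eta> y) = Comp C (NMap \<eta> y') g"
    and "\<And>x. x \<in> Obj D \<Longrightarrow> NMap \<epsilon> x \<in> hom D (FObj L (FObj R x)) x"
    and "\<And>x x' f. f \<in> hom D x x' \<Longrightarrow>
          Comp D f (NMap \<epsilon> x) = Comp D (NMap \<epsilon> x') (FArr L (FArr R f))"
    and "\<And>y. y \<in> Obj C \<Longrightarrow> Comp D (NMap \<epsilon> (FObj L y)) (FArr L (NMap \<eta> y)) = Id D (FObj L y)"
    and "\<And>x. x \<in> Obj D \<Longrightarrow> Comp C (FArr R (NMap \<epsilon> x)) (NMap \<eta> (FObj R x)) = Id C (FObj R x)"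
proof -
  have c: "FDom L = C" "FCod L = D" "category C" "category D" using fctr_cats[OF L] by auto
  have "is_fctr L C (FDom R)" using a c by (simp add: adjunction_def)
  then have "FDom R = D" using fctr_cats c by metis
  then have R: "is_fctr R D C" using a c by (simp add: adjunction_def)
  have r: "FDom R = D" "FCod R = C" using fctr_cats[OF R] by auto
  have u: "is_ntrans \<eta> (id_fctr C) (R \<circ>\<^sub>F L)" "is_ntrans \<epsilon> (L \<circ>\<^sub>F R) (id_fctr D)"
    and t: "(\<epsilon> \<rhd> L) \<bullet> (L \<lhd> \<eta>) = id_ntrans L" "(R \<lhd> \<epsilon>) \<bullet> (\<eta> \<rhd> R) = id_ntrans R"
    using a c r by (auto simp: adjunction_def)
  have s: "NSrc \<eta> = id_fctr C" "NTgt \<eta> = R \<circ>\<^sub>F L" "NSrc \<epsilon> = L \<circ>\<^sub>F R" "NTgt \<epsilon> = id_fctr D"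
    using u by (auto simp: is_ntrans_def)
  show "is_fctr R D C" by fact
  show "NMap \<eta> y \<in> hom C y (FObj R (FObj L y))" if "y \<in> Obj C" for y
    using u(1) that by (simp add: is_ntrans_def id_fctr_def comp_fctr_def mk_fctr_def c)
  show "NMap \<epsilon> x \<in> hom D (FObj L (FObj R x)) x" if "x \<in> Obj D" for x
    using u(2) that by (simp add: is_ntrans_def id_fctr_def comp_fctr_def mk_fctr_def c r)
  show "Comp C (FArr R (FArr L g)) (NMap \<eta> y) = Comp C (NMap \<eta> y') g" if "g \<in> hom C y y'" for g y y'
    using u(1) homD[OF that] by (auto simp: is_ntrans_def id_fctr_def comp_fctr_def mk_fctr_def c r)
  show "Comp D f (NMap \<epsilon> x) = Comp D (NMap \<epsilon> x') (FArr L (FArr R f))" if "f \<in> hom D x x'" for f x x'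
    using u(2) homD[OF that] by (auto simp: is_ntrans_def id_fctr_def comp_fctr_def mk_fctr_def c r)
  show "Comp D (NMap \<epsilon> (FObj L y)) (FArr L (NMap \<eta> y)) = Id D (FObj L y)" if "y \<in> Obj C" for y
    using arg_cong[OF t(1), of "\<lambda>t. NMap t y"] that fctr_obj[OF L that]
    by (simp add: vcomp_def rwhisk_def lwhisk_def id_ntrans_def mk_ntrans_def s c r
       id_fctr_def comp_fctr_def mk_fctr_def)
  show "Comp C (FArr R (NMap \<epsilon> x)) (NMap \<eta> (FObj R x)) = Id C (FObj R x)" if "x \<in> Obj D" for x
    using arg_cong[OF t(2), of "\<lambda>t. NMap t x"] that fctr_obj[OF R that]
    by (simp add: vcomp_def rwhisk_def lwhisk_def id_ntrans_def mk_ntrans_def s c r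
       id_fctr_def comp_fctr_def mk_fctr_def)
qed

lemma adjunction_fctr: "adjunction L R \<eta> \<epsilon> \<Longrightarrow> is_fctr L (FDom L) (FDom R)"
  by (simp add: adjunction_def)

lemma adjunction_universal:
  assumes a: "adjunction L R \<eta> \<epsilon>" and y: "y \<in> Obj (FDom L)"
  shows "universal R y (FObj L y) (NMap \<eta> y)"
proof -
  note L = adjunction_fctr[OF a]
  note d = adjunctionD[OF a L]
  show ?thesis by (rule universal_unit[OF L d(1-7) y])
qed

lemma adjunction_couniversal:
  assumes a: "adjunction L R \<eta> \<epsilon>" and y: "x \<in> Obj (FDom R)"
  shows "universal (op_fctr L) x (FObj R x) (NMap \<epsilon> x)"
proof -
  note L = adjunction_fctr[OF a]
  note d = adjunctionD[OF a L]
  have "universal (op_fctr L) x (FObj (op_fctr R) x) (NMap \<epsilon> x)"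
    by (rule universal_unit[OF is_fctr_op[OF d(1)] is_fctr_op[OF L], where ep = "NMap \<eta>"])
      (use d y in auto)
  then show ?thesis by simp
qed

text \<open>
  If the transpose of \<open>m\<close> is invertible, then \<open>m\<close> is the unit up to an isomorphism of targets. In this
  way Der4, which says that a certain transpose is invertible, becomes a statement that mentions
  the right adjoint only.
\<close>

lemma iso_transpose_universal:
  assumes a: "adjunction L R \<eta> \<epsilon>" and L: "is_fctr L C D" and m: "m \<in> hom C y (FObj R v)"
    and v: "v \<in> Obj D" and iso: "iso_arr D (Comp D (NMap \<epsilon> v) (FArr L m))"
  shows "universal R y v m"
proof -
  note d = adjunctionD[OF a L]
  have c: "category C" "category D" "FDom L = C" using fctr_cats[OF L] by auto
  have y: "y \<in> Obj C" using hom_obj[OF c(1) m] by blast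
  note Lm = fctr_hom[OF L m] and Rv = fctr_obj[OF d(1) v]
  have "Comp C (FArr R (Comp D (NMap \<epsilon> v) (FArr L m))) (NMap \<eta> y) =
      Comp C (FArr R (NMap \<epsilon> v)) (Comp C (FArr R (FArr L m)) (NMap \<eta> y))"
    using fctr_comp[OF d(1) Lm d(4)[OF v]]
      comp_assoc[OF c(1) d(2)[OF y] fctr_hom[OF d(1) Lm] fctr_hom[OF d(1) d(4)[OF v]]] by simp
  also have "\<dots> = m"
    using d(3)[OF m] comp_assoc[OF c(1) m d(2)[OF Rv] fctr_hom[OF d(1) d(4)[OF v]]]
      d(7)[OF v] id_comp[OF c(1) m] by simp
  finally show ?thesis
    using universal_iso_target[OF d(1) adjunction_universal[OF a] comp_hom[OF c(2) Lm d(4)[OF v]] iso]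
      y c by simp
qed

lemma iso_transpose_couniversal:
  assumes a: "adjunction L R \<eta> \<epsilon>" and L: "is_fctr L C D" and m: "m \<in> hom D (FObj L v) x"
    and v: "v \<in> Obj C" and iso: "iso_arr C (Comp C (FArr R m) (NMap \<eta> v))"
  shows "universal (op_fctr L) x v m"
proof -
  note d = adjunctionD[OF a L]
  have c: "category C" "category D" "FDom L = C" "FDom R = D" using fctr_cats[OF L] fctr_cats[OF d(1)] by auto
  have x: "x \<in> Obj D" using hom_obj[OF c(2) m] by blast
  note Rm = fctr_hom[OF d(1) m] and Lv = fctr_obj[OF L v]
  have "Comp D (NMap \<epsilon> x) (FArr L (Comp C (FArr R m) (NMap \<eta> v))) =
      Comp D (Comp D (NMap \<epsilon> x) (FArr L (FArr R m))) (FArr L (NMap \<eta> v))"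
    using fctr_comp[OF L d(2)[OF v] Rm]
      comp_assoc[OF c(2) fctr_hom[OF L d(2)[OF v]] fctr_hom[OF L Rm] d(4)[OF x]] by simp
  also have "\<dots> = m"
    using d(5)[OF m] comp_assoc[OF c(2) fctr_hom[OF L d(2)[OF v]] d(4)[OF Lv] m]
      d(6)[OF v] comp_id[OF c(2) m] by simp
  finally show ?thesis
    using universal_iso_target[OF is_fctr_op[OF L] adjunction_couniversal[OF a], of x
        "Comp C (FArr R m) (NMap \<eta> v)" v] comp_hom[OF c(1) d(2)[OF v] Rm] iso x c by simp
qed

text \<open>
  An object isomorphic to a value of the left adjoint receives a universal arrow that is
  invertible, because the unit is. For the converse compare the unit at \<open>F v\<close> with the identity,
  which is universal when \<open>v\<close> is left extended.
\<close>

lemma ess_image_left_extended: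
  assumes F: "is_fctr F C D" and v: "v \<in> Obj C"
    and u: "\<And>y. y \<in> Obj D \<Longrightarrow> universal F y (l y) (m y) \<and> iso_arr D (m y)"
  shows "(\<exists>y\<in>Obj D. isomorphic C (l y) v) \<longleftrightarrow> left_extended F v"
proof -
  have c: "category C" "category D" "FDom F = C" "FCod F = D" using fctr_cats[OF F] by auto
  show ?thesis
  proof
    assume "\<exists>y\<in>Obj D. isomorphic C (l y) v"
    then obtain y f where y: "y \<in> Obj D" and f: "f \<in> hom C (l y) v" "iso_arr C f"
      by (auto simp: isomorphic_def)
    have my: "m y \<in> hom D y (FObj F (l y))" using u[OF y] by (simp add: universal_def c)
    have z: "universal F y v (Comp D (FArr F f) (m y))"
      using universal_iso_target[OF F _ f] u[OF y] by blast
    have i: "iso_arr D (FArr F f)" using fctr_iso[OF F f(2)] .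
    note Ff = fctr_hom[OF F f(1)]
    obtain h where h: "h \<in> hom D (FObj F (l y)) y" "Comp D h (m y) = Id D y"
        "Comp D (m y) h = Id D (FObj F (l y))" using iso_arrE u[OF y] my by metis
    obtain k where k: "k \<in> hom D (FObj F v) (FObj F (l y))"
        "Comp D k (FArr F f) = Id D (FObj F (l y))" "Comp D (FArr F f) k = Id D (FObj F v)"
      using iso_arrE[OF i Ff] .
    note mf = comp_hom[OF c(2) my Ff] note hk = comp_hom[OF c(2) k(1) h(1)]
    have "iso_arr D (Comp D (FArr F f) (m y))"
    proof (rule iso_arrI[OF mf hk])
      show "Comp D (Comp D h k) (Comp D (FArr F f) (m y)) = Id D y"
        using comp_assoc[OF c(2) mf k(1) h(1)] comp_assoc[OF c(2) my Ff k(1)] k h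
          id_comp[OF c(2) my] by simp
      show "Comp D (Comp D (FArr F f) (m y)) (Comp D h k) = Id D (FObj F v)"
        using comp_assoc[OF c(2) hk my Ff] comp_assoc[OF c(2) k(1) h(1) my] k h
          id_comp[OF c(2) k(1)] by simp
    qed
    then show "left_extended F v" using universal_iso_left_extended[OF F z] by blast
  next
    assume e: "left_extended F v"
    note o = fctr_obj[OF F v]
    have z: "universal F (FObj F v) v (Id D (FObj F v))" using left_extended_universal[OF F] e by blast
    obtain f where f: "f \<in> hom C (l (FObj F v)) v"
        "Comp D (FArr F f) (m (FObj F v)) = Id D (FObj F v)"
      using universal_ex[OF conjunct1[OF u[OF o]], unfolded c, OF v id_hom[OF c(2) o]] .
    have "iso_arr C f" using universal_comparison_iso[OF F _ z f] u[OF o] by blast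
    then show "\<exists>y\<in>Obj D. isomorphic C (l y) v" using f o by (auto simp: isomorphic_def)
  qed
qed

lemma isomorphic_op: "isomorphic (op_cat C) x y \<longleftrightarrow> isomorphic C x y"
proof -
  have "\<exists>g \<in> hom C y x. iso_arr C g" if f: "f \<in> hom C x y" "iso_arr C f" for f x y
    using iso_arrE[OF f(2,1)] f(1) iso_arrI by metis
  then show ?thesis by (auto simp: isomorphic_def)
qed

section \<open>The pointwise criterion\<close>

text \<open>
  The situation of Der4 for a functor \<open>u : J \<rightarrow> K\<close>, abstracted so that it covers left Kan extensions
  and, in opposite categories, right ones. \<open>U\<close> is \<open>u\<^sup>*\<close>, \<open>Ev k\<close> is \<open>k\<^sup>*\<close>, \<open>CO k\<close> is the category of diagrams
  on the slice at \<open>k\<close>, and \<open>Pr k\<close>, \<open>Pt k\<close> and \<open>al k\<close> are restriction along the projections of the slice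
  and the transformation between them. The last assumption combines Der3 and Der4.
\<close>

locale pointwise_extension =
  fixes CK CJ Ce :: "('o, 'a) cat" and I :: "'k set" and U :: "('o, 'a, 'o, 'a) fctr"
    and Ev Pr Pt :: "'k \<Rightarrow> ('o, 'a, 'o, 'a) fctr" and CO :: "'k \<Rightarrow> ('o, 'a) cat"
    and al :: "'k \<Rightarrow> 'o \<Rightarrow> 'a"
  assumes U: "is_fctr U CK CJ"
    and Ev: "k \<in> I \<Longrightarrow> is_fctr (Ev k) CK Ce"
    and Pr: "k \<in> I \<Longrightarrow> is_fctr (Pr k) CJ (CO k)"
    and Pt: "k \<in> I \<Longrightarrow> is_fctr (Pt k) Ce (CO k)"
    and al: "k \<in> I \<Longrightarrow> v \<in> Obj CK \<Longrightarrow>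
      al k v \<in> hom (CO k) (FObj (Pr k) (FObj U v)) (FObj (Pt k) (FObj (Ev k) v))"
    and al_nat: "k \<in> I \<Longrightarrow> f \<in> hom CK v w \<Longrightarrow>
      Comp (CO k) (FArr (Pt k) (FArr (Ev k) f)) (al k v) =
      Comp (CO k) (al k w) (FArr (Pr k) (FArr U f))"
    and conservative: "f \<in> Arr CK \<Longrightarrow> (\<And>k. k \<in> I \<Longrightarrow> iso_arr Ce (FArr (Ev k) f)) \<Longrightarrow> iso_arr CK f"
    and universal_exists: "y \<in> Obj CJ \<Longrightarrow> \<exists>v m. universal U y v m \<and>
      (\<forall>k\<in>I. universal (Pt k) (FObj (Pr k) y) (FObj (Ev k) v) (Comp (CO k) (al k v) (FArr (Pr k) m)))"
begin

text \<open>
  The assumption on one universal arrow carries over to all of them, since they are isomorphic.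
\<close>

lemma pointwise:
  assumes u: "universal U y v m" and k: "k \<in> I"
  shows "universal (Pt k) (FObj (Pr k) y) (FObj (Ev k) v) (Comp (CO k) (al k v) (FArr (Pr k) m))"
proof -
  have c: "category CK" "category CJ" "FDom U = CK" "FCod U = CJ" using fctr_cats[OF U] by auto
  have cO: "category (CO k)" using fctr_cats[OF Pr[OF k]] by simp
  have v: "v \<in> Obj CK" and m: "m \<in> hom CJ y (FObj U v)" using u by (auto simp: universal_def c)
  have y: "y \<in> Obj CJ" using hom_obj[OF c(2) m] by blast
  obtain w n where w: "universal U y w n" and p: "universal (Pt k) (FObj (Pr k) y) (FObj (Ev k) w)
      (Comp (CO k) (al k w) (FArr (Pr k) n))" using universal_exists[OF y] k by blast
  have wo: "w \<in> Obj CK" and n: "n \<in> hom CJ y (FObj U w)" using w by (auto simp: universal_def c)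
  obtain f where f: "f \<in> hom CK w v" "Comp CJ (FArr U f) n = m"
    using universal_ex[OF w, unfolded c, OF v m] .
  have "iso_arr CK f" using universal_comparison_iso[OF U w u f] .
  note z = universal_iso_target[OF Pt[OF k] p fctr_hom[OF Ev[OF k] f(1)] fctr_iso[OF Ev[OF k] this]]
  note Prn = fctr_hom[OF Pr[OF k] n]
  note PrUf = fctr_hom[OF Pr[OF k] fctr_hom[OF U f(1)]]
  note PtEf = fctr_hom[OF Pt[OF k] fctr_hom[OF Ev[OF k] f(1)]]
  have "Comp (CO k) (FArr (Pt k) (FArr (Ev k) f)) (Comp (CO k) (al k w) (FArr (Pr k) n)) =
    Comp (CO k) (al k v) (FArr (Pr k) m)"
    using comp_assoc[OF cO Prn al[OF k wo] PtEf] comp_assoc[OF cO Prn PrUf al[OF k v]]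
      al_nat[OF k f(1)] fctr_comp[OF Pr[OF k] n fctr_hom[OF U f(1)]] f(2) by simp
  with z show ?thesis by simp
qed


text \<open>
  If \<open>v\<close> is left extended, its identity is a universal arrow and \<open>pointwise\<close> applies. Conversely
  compare \<open>v\<close> with the target \<open>w\<close> of a universal arrow from \<open>U v\<close>: at each \<open>k\<close> both have a universal
  arrow from the same object, so the comparison map is invertible at \<open>k\<close>.
\<close>

lemma left_extended_iff:
  "left_extended U v \<longleftrightarrow> v \<in> Obj CK \<and>
     (\<forall>k\<in>I. universal (Pt k) (FObj (Pr k) (FObj U v)) (FObj (Ev k) v) (al k v))"
proof -
  have c: "category CK" "category CJ" "FDom U = CK" "FCod U = CJ" using fctr_cats[OF U] by auto
  show ?thesis
  proof (intro iffI conjI ballI)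
    assume e: "left_extended U v"
    show v: "v \<in> Obj CK" using e by (simp add: left_extended_def c)
    fix k assume k: "k \<in> I"
    have "universal U (FObj U v) v (Id CJ (FObj U v))" using left_extended_universal[OF U] e by blast
    from pointwise[OF this k]
    show "universal (Pt k) (FObj (Pr k) (FObj U v)) (FObj (Ev k) v) (al k v)"
      using fctr_id[OF Pr[OF k] fctr_obj[OF U v]] comp_id[OF _ al[OF k v]] fctr_cats[OF Pr[OF k]]
      by simp
  next
    assume h: "v \<in> Obj CK \<and>
     (\<forall>k\<in>I. universal (Pt k) (FObj (Pr k) (FObj U v)) (FObj (Ev k) v) (al k v))"
    then have v: "v \<in> Obj CK" by blast
    note Uv = fctr_obj[OF U v]
    obtain w m where w: "universal U (FObj U v) w m" using universal_exists[OF Uv] by blast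
    then have wo: "w \<in> Obj CK" and m: "m \<in> hom CJ (FObj U v) (FObj U w)"
      by (auto simp: universal_def c)
    obtain f where f: "f \<in> hom CK w v" "Comp CJ (FArr U f) m = Id CJ (FObj U v)"
      using universal_ex[OF w, unfolded c, OF v id_hom[OF c(2) Uv]] .
    have "iso_arr CK f"
    proof (rule conservative)
      fix k assume k: "k \<in> I"
      have cO: "category (CO k)" using fctr_cats[OF Pr[OF k]] by simp
      note Prm = fctr_hom[OF Pr[OF k] m]
      note PrUf = fctr_hom[OF Pr[OF k] fctr_hom[OF U f(1)]]
      note PtEf = fctr_hom[OF Pt[OF k] fctr_hom[OF Ev[OF k] f(1)]]
      have "Comp (CO k) (FArr (Pt k) (FArr (Ev k) f)) (Comp (CO k) (al k w) (FArr (Pr k) m)) =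
        Comp (CO k) (al k v) (Comp (CO k) (FArr (Pr k) (FArr U f)) (FArr (Pr k) m))"
        using comp_assoc[OF cO Prm al[OF k wo] PtEf] comp_assoc[OF cO Prm PrUf al[OF k v]]
          al_nat[OF k f(1)] by simp
      also have "\<dots> = al k v"
        using fctr_comp[OF Pr[OF k] m fctr_hom[OF U f(1)]] f(2) fctr_id[OF Pr[OF k] Uv]
          comp_id[OF cO al[OF k v]] by simp
      finally show "iso_arr Ce (FArr (Ev k) f)"
        using universal_comparison_iso[OF Pt[OF k] pointwise[OF w k] _ fctr_hom[OF Ev[OF k] f(1)]] h k
        by blast
    qed (use f in \<open>auto simp: hom_def\<close>)
    then show "left_extended U v"
      using universal_iso_target[OF U w f(1)] f(2) left_extended_universal[OF U] by simp
  qed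
qed

end

text \<open>
  \<open>T\<close> is left adjoint to \<open>P\<close> with unit \<open>t\<close> and counit the identity. Hence \<open>t x\<close> is universal, and \<open>T m\<close>
  is the comparison of \<open>t x\<close> with \<open>m\<close>.
\<close>

lemma reflector_universal_iso:
  assumes P: "is_fctr P C D" and T: "is_fctr T D C"
    and TP: "\<And>x. x \<in> Obj C \<Longrightarrow> FObj T (FObj P x) = x" "\<And>f. f \<in> Arr C \<Longrightarrow> FArr T (FArr P f) = f"
    and t: "\<And>x. x \<in> Obj D \<Longrightarrow> t x \<in> hom D x (FObj P (FObj T x))"
    and t_nat: "\<And>x y f. f \<in> hom D x y \<Longrightarrow> Comp D (FArr P (FArr T f)) (t x) = Comp D (t y) f"
    and Tt: "\<And>x. x \<in> Obj D \<Longrightarrow> FArr T (t x) = Id C (FObj T x)"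
    and tP: "\<And>z. z \<in> Obj C \<Longrightarrow> t (FObj P z) = Id D (FObj P z)"
    and u: "universal P x v m"
  shows "iso_arr C (FArr T m)"
proof -
  have c: "category C" "category D" "FDom P = C" "FCod P = D" using fctr_cats[OF P] by auto
  have v: "v \<in> Obj C" and m: "m \<in> hom D x (FObj P v)" using u by (auto simp: universal_def c)
  have x: "x \<in> Obj D" using hom_obj[OF c(2) m] by blast
  note Tx = fctr_obj[OF T x]
  have 1: "Comp D (FArr P (FArr T h)) (t x) = h" if "h \<in> hom D x (FObj P z)" "z \<in> Obj C" for h z
    using t_nat[OF that(1)] tP[OF that(2)] id_comp[OF c(2) that(1)] by simp
  have Th: "FArr T h \<in> hom C (FObj T x) z" if "h \<in> hom D x (FObj P z)" "z \<in> Obj C" for h z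
    using fctr_hom[OF T that(1)] TP that by simp
  have 2: "g = FArr T (Comp D (FArr P g) (t x))" if "g \<in> hom C (FObj T x) z" for g z
    using fctr_comp[OF T t[OF x] fctr_hom[OF P that]] Tt[OF x] TP(2) comp_id[OF c(1) that] homD[OF that]
    by simp
  have "universal P x (FObj T x) (t x)" unfolding universal_def c
  proof (intro conjI ballI)
    fix z h assume z: "z \<in> Obj C" and h: "h \<in> hom D x (FObj P z)"
    show "\<exists>!f. f \<in> hom C (FObj T x) z \<and> Comp D (FArr P f) (t x) = h"
      by (rule ex1I[of _ "FArr T h"]) (use 1[OF h z] Th[OF h z] 2 in auto)
  qed (use Tx t[OF x] in auto)
  from universal_comparison_iso[OF P this u Th[OF m v] 1[OF m v]] show ?thesis .
qed

section \<open>Categories, functors and transformations given by formulas\<close>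

lemma mk_cat_simps [simp]:
  "Obj (mk_cat obs ars d c i m) = obs" "Arr (mk_cat obs ars d c i m) = ars"
  "f \<in> ars \<Longrightarrow> Dom (mk_cat obs ars d c i m) f = d f" "f \<in> ars \<Longrightarrow> Cod (mk_cat obs ars d c i m) f = c f"
  "x \<in> obs \<Longrightarrow> Id (mk_cat obs ars d c i m) x = i x"
  "f \<in> ars \<Longrightarrow> g \<in> ars \<Longrightarrow> c f = d g \<Longrightarrow> Comp (mk_cat obs ars d c i m) g f = m g f"
  by (simp_all add: mk_cat_def)

lemma hom_mk_cat: "hom (mk_cat obs ars d c i m) x y = {f \<in> ars. d f = x \<and> c f = y}"
  by (auto simp: hom_def mk_cat_def)

lemma category_mk_cat:
  assumes "\<And>f. f \<in> ars \<Longrightarrow> d f \<in> obs \<and> c f \<in> obs"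
    and "\<And>x. x \<in> obs \<Longrightarrow> i x \<in> ars \<and> d (i x) = x \<and> c (i x) = x"
    and "\<And>f g. f \<in> ars \<Longrightarrow> g \<in> ars \<Longrightarrow> c f = d g \<Longrightarrow> m g f \<in> ars \<and> d (m g f) = d f \<and> c (m g f) = c g"
    and "\<And>f. f \<in> ars \<Longrightarrow> m f (i (d f)) = f \<and> m (i (c f)) f = f"
    and "\<And>f g h. f \<in> ars \<Longrightarrow> g \<in> ars \<Longrightarrow> h \<in> ars \<Longrightarrow> c f = d g \<Longrightarrow> c g = d h \<Longrightarrow>
           m h (m g f) = m (m h g) f"
  shows "category (mk_cat obs ars d c i m)"
  unfolding category_def hom_mk_cat using assms by (auto simp: mk_cat_def hom_mk_cat)

lemma fctr_mk_simps [simp]: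
  "FDom (mk_fctr C D fo fa) = C" "FCod (mk_fctr C D fo fa) = D"
  "x \<in> Obj C \<Longrightarrow> FObj (mk_fctr C D fo fa) x = fo x" "f \<in> Arr C \<Longrightarrow> FArr (mk_fctr C D fo fa) f = fa f"
  by (simp_all add: mk_fctr_def)

lemma is_fctr_mk:
  assumes "category C" "category D" "\<And>x. x \<in> Obj C \<Longrightarrow> fo x \<in> Obj D"
    and "\<And>f x y. f \<in> hom C x y \<Longrightarrow> fa f \<in> hom D (fo x) (fo y)"
    and "\<And>x. x \<in> Obj C \<Longrightarrow> fa (Id C x) = Id D (fo x)"
    and "\<And>f g x y z. f \<in> hom C x y \<Longrightarrow> g \<in> hom C y z \<Longrightarrow> fa (Comp C g f) = Comp D (fa g) (fa f)"
  shows "is_fctr (mk_fctr C D fo fa) C D"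
proof -
  have "Id C x \<in> Arr C" if "x \<in> Obj C" for x using id_hom[OF assms(1) that] homD by fast
  moreover have "Comp C g f \<in> Arr C" if "f \<in> Arr C" "g \<in> Arr C" "Cod C f = Dom C g" for f g
    using comp_hom[OF assms(1)] that unfolding hom_def by auto
  moreover have "fa (Comp C g f) = Comp D (fa g) (fa f)"
    if "f \<in> Arr C" "g \<in> Arr C" "Cod C f = Dom C g" for f g
    using assms(6)[OF homI homI] that by blast
  ultimately show ?thesis
    unfolding is_fctr_def using assms(1-5) Dom_in[OF assms(1)] Cod_in[OF assms(1)]
    by (auto simp: mk_fctr_def homI)
qed

lemma fctr_eqI:
  assumes "is_fctr F C D" "is_fctr G C D"
    "\<And>x. x \<in> Obj C \<Longrightarrow> FObj F x = FObj G x" "\<And>f. f \<in> Arr C \<Longrightarrow> FArr F f = FArr G f"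
  shows "F = G"
proof (rule fctr.equality)
  have "FObj F \<in> extensional (Obj C)" "FObj G \<in> extensional (Obj C)"
    using assms by (auto simp: is_fctr_def PiE_def)
  then show "FObj F = FObj G" by (rule extensionalityI) (rule assms(3))
  have "FArr F \<in> extensional (Arr C)" "FArr G \<in> extensional (Arr C)"
    using assms by (auto simp: is_fctr_def)
  then show "FArr F = FArr G" by (rule extensionalityI) (rule assms(4))
qed (use assms fctr_cats[of F C D] fctr_cats[of G C D] in auto)

lemma comp_fctr_simps:
  assumes "is_fctr F C D"
  shows "FDom (G \<circ>\<^sub>F F) = C" "FCod (G \<circ>\<^sub>F F) = FCod G"
    "x \<in> Obj C \<Longrightarrow> FObj (G \<circ>\<^sub>F F) x = FObj G (FObj F x)"
    "f \<in> Arr C \<Longrightarrow> FArr (G \<circ>\<^sub>F F) f = FArr G (FArr F f)"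
  using fctr_cats[OF assms] by (simp_all add: comp_fctr_def)

lemma is_fctr_comp:
  assumes F: "is_fctr F C D" and G: "is_fctr G D E"
  shows "is_fctr (G \<circ>\<^sub>F F) C E"
proof -
  have *: "FDom F = C" "FCod G = E" "category C" "category E"
    using fctr_cats[OF F] fctr_cats[OF G] by auto
  show ?thesis unfolding comp_fctr_def *
    by (rule is_fctr_mk[OF *(3,4)])
      (auto simp: fctr_obj[OF F] fctr_obj[OF G] fctr_id[OF F] fctr_id[OF G]
        fctr_comp[OF F] intro: fctr_hom[OF F] fctr_hom[OF G] fctr_comp[OF G])
qed

lemma comp_fctr_assoc:
  assumes F: "is_fctr F C1 C2" and H: "is_fctr H C2 C3" and G: "is_fctr G C3 C4"
  shows "G \<circ>\<^sub>F (H \<circ>\<^sub>F F) = (G \<circ>\<^sub>F H) \<circ>\<^sub>F F"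
proof (rule fctr_eqI[OF is_fctr_comp[OF is_fctr_comp[OF F H] G] is_fctr_comp[OF F is_fctr_comp[OF H G]]])
  show "FObj (G \<circ>\<^sub>F (H \<circ>\<^sub>F F)) x = FObj ((G \<circ>\<^sub>F H) \<circ>\<^sub>F F) x" if "x \<in> Obj C1" for x
    using that fctr_obj[OF F that]
    by (simp add: comp_fctr_simps[OF F] comp_fctr_simps[OF H] comp_fctr_simps[OF is_fctr_comp[OF F H]])
  show "FArr (G \<circ>\<^sub>F (H \<circ>\<^sub>F F)) f = FArr ((G \<circ>\<^sub>F H) \<circ>\<^sub>F F) f" if "f \<in> Arr C1" for f
    using that homD[OF fctr_hom[OF F homI[OF that]]]
    by (simp add: comp_fctr_simps[OF F] comp_fctr_simps[OF H] comp_fctr_simps[OF is_fctr_comp[OF F H]])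
qed

lemma is_fctr_id: "category C \<Longrightarrow> is_fctr (id_fctr C) C C"
  unfolding id_fctr_def by (rule is_fctr_mk) (auto intro: id_hom)

lemma id_fctr_simps [simp]:
  "x \<in> Obj C \<Longrightarrow> FObj (id_fctr C) x = x" "f \<in> Arr C \<Longrightarrow> FArr (id_fctr C) f = f"
  by (simp_all add: id_fctr_def)

lemma is_ntrans_mk:
  assumes F: "is_fctr F C D" and G: "is_fctr G C D"
    and "\<And>x. x \<in> Obj C \<Longrightarrow> t x \<in> hom D (FObj F x) (FObj G x)"
    and "\<And>f x y. f \<in> hom C x y \<Longrightarrow> Comp D (FArr G f) (t x) = Comp D (t y) (FArr F f)"
  shows "is_ntrans (mk_ntrans F G t) F G"
proof -
  have c: "FDom F = C" "FCod F = D" "category C" using fctr_cats[OF F] by auto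
  then show ?thesis using assms Dom_in[OF c(3)] Cod_in[OF c(3)]
    by (auto simp: is_ntrans_def mk_ntrans_def homI)
qed

lemma NMap_mk: "is_fctr F C D \<Longrightarrow> x \<in> Obj C \<Longrightarrow> NMap (mk_ntrans F G t) x = t x"
  by (auto simp: mk_ntrans_def dest: fctr_cats)

lemma ntrans_eqI:
  assumes "is_ntrans s F G" "is_ntrans t F G" "is_fctr F C D" "\<And>x. x \<in> Obj C \<Longrightarrow> NMap s x = NMap t x"
  shows "s = t"
proof (rule ntrans.equality)
  have c: "FDom F = C" using fctr_cats[OF assms(3)] by auto
  have "NMap s \<in> extensional (Obj C)" "NMap t \<in> extensional (Obj C)"
    using assms c by (auto simp: is_ntrans_def)
  then show "NMap s = NMap t" by (rule extensionalityI) (rule assms(4))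
qed (use assms in \<open>auto simp: is_ntrans_def\<close>)

lemma is_ntrans_id: assumes F: "is_fctr F C D" shows "is_ntrans (id_ntrans F) F F"
proof -
  have c: "FCod F = D" "category D" using fctr_cats[OF F] by auto
  show ?thesis unfolding id_ntrans_def c
    by (rule is_ntrans_mk[OF F F])
      (auto intro: id_hom[OF c(2)] fctr_obj[OF F]
         simp: comp_id[OF c(2) fctr_hom[OF F]] id_comp[OF c(2) fctr_hom[OF F]])
qed

lemma NMap_id: "is_fctr F C D \<Longrightarrow> x \<in> Obj C \<Longrightarrow> NMap (id_ntrans F) x = Id D (FObj F x)"
  by (auto simp: id_ntrans_def mk_ntrans_def dest: fctr_cats)

lemma is_ntrans_hcomp_id_left:
  assumes t: "is_ntrans t F G" and F: "is_fctr F C D" and H: "is_fctr H D E"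
  shows "is_ntrans (id_ntrans H \<star> t) (H \<circ>\<^sub>F F) (H \<circ>\<^sub>F G)"
    and "x \<in> Obj C \<Longrightarrow> NMap (id_ntrans H \<star> t) x = FArr H (NMap t x)"
proof -
  have G: "is_fctr G C D" using t fctr_cats[OF F] by (simp add: is_ntrans_def)
  have s: "NSrc t = F" "NTgt t = G" "NSrc (id_ntrans H) = H" "NTgt (id_ntrans H) = H"
    "FCod H = E" "category E"
    using t fctr_cats[OF H] by (auto simp: is_ntrans_def id_ntrans_def mk_ntrans_def)
  have v: "Comp E (FArr H (NMap t x)) (NMap (id_ntrans H) (FObj F x)) = FArr H (NMap t x)"
    if x: "x \<in> Obj C" for x
    using NMap_id[OF H fctr_obj[OF F x]] comp_id[OF s(6) fctr_hom[OF H ntrans_hom[OF t F x]]] by simp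
  note HF = is_fctr_comp[OF F H] and HG = is_fctr_comp[OF G H]
  show "is_ntrans (id_ntrans H \<star> t) (H \<circ>\<^sub>F F) (H \<circ>\<^sub>F G)"
    unfolding hcomp_def s
  proof (rule is_ntrans_mk[OF HF HG])
    fix f x y assume f: "f \<in> hom C x y"
    have o: "x \<in> Obj C" "y \<in> Obj C" "f \<in> Arr C" using hom_obj[OF _ f] fctr_cats[OF F] homD[OF f] by auto
    show "Comp E (FArr (H \<circ>\<^sub>F G) f) (Comp E (FArr H (NMap t x)) (NMap (id_ntrans H) (FObj F x))) =
       Comp E (Comp E (FArr H (NMap t y)) (NMap (id_ntrans H) (FObj F y))) (FArr (H \<circ>\<^sub>F F) f)"
      unfolding v[OF o(1)] v[OF o(2)] comp_fctr_simps(4)[OF F o(3)] comp_fctr_simps(4)[OF G o(3)]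
      using fctr_comp[OF H ntrans_hom[OF t F o(1)] fctr_hom[OF G f]]
        fctr_comp[OF H fctr_hom[OF F f] ntrans_hom[OF t F o(2)]] ntrans_nat[OF t F f] by simp
  qed (simp add: v comp_fctr_simps(3)[OF F] comp_fctr_simps(3)[OF G] fctr_hom[OF H ntrans_hom[OF t F]])
  show "NMap (id_ntrans H \<star> t) x = FArr H (NMap t x)" if "x \<in> Obj C"
    unfolding hcomp_def s using NMap_mk[OF HF that] v[OF that] by simp
qed

lemma is_ntrans_hcomp_id_right:
  assumes t: "is_ntrans t F G" and F: "is_fctr F C D" and H: "is_fctr H B C"
  shows "is_ntrans (t \<star> id_ntrans H) (F \<circ>\<^sub>F H) (G \<circ>\<^sub>F H)"
    and "x \<in> Obj B \<Longrightarrow> NMap (t \<star> id_ntrans H) x = NMap t (FObj H x)"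
proof -
  have G: "is_fctr G C D" using t fctr_cats[OF F] by (simp add: is_ntrans_def)
  have s: "NSrc t = F" "NTgt t = G" "NSrc (id_ntrans H) = H" "NTgt (id_ntrans H) = H"
    "FCod F = D" "category D"
    using t fctr_cats[OF F] by (auto simp: is_ntrans_def id_ntrans_def mk_ntrans_def)
  have v: "Comp D (FArr G (NMap (id_ntrans H) x)) (NMap t (FObj H x)) = NMap t (FObj H x)"
    if x: "x \<in> Obj B" for x
    using NMap_id[OF H x] fctr_id[OF G fctr_obj[OF H x]]
      id_comp[OF s(6) ntrans_hom[OF t F fctr_obj[OF H x]]] by simp
  note HF = is_fctr_comp[OF H F] and HG = is_fctr_comp[OF H G]
  show "is_ntrans (t \<star> id_ntrans H) (F \<circ>\<^sub>F H) (G \<circ>\<^sub>F H)"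
    unfolding hcomp_def s
  proof (rule is_ntrans_mk[OF HF HG])
    fix f x y assume f: "f \<in> hom B x y"
    have o: "x \<in> Obj B" "y \<in> Obj B" "f \<in> Arr B" using hom_obj[OF _ f] fctr_cats[OF H] homD[OF f] by auto
    show "Comp D (FArr (G \<circ>\<^sub>F H) f) (Comp D (FArr G (NMap (id_ntrans H) x)) (NMap t (FObj H x))) =
       Comp D (Comp D (FArr G (NMap (id_ntrans H) y)) (NMap t (FObj H y))) (FArr (F \<circ>\<^sub>F H) f)"
      unfolding v[OF o(1)] v[OF o(2)] comp_fctr_simps(4)[OF H o(3)]
      using ntrans_nat[OF t F fctr_hom[OF H f]] by simp
  qed (simp add: v comp_fctr_simps(3)[OF H] ntrans_hom[OF t F fctr_obj[OF H]])
  show "NMap (t \<star> id_ntrans H) x = NMap t (FObj H x)" if "x \<in> Obj B"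
    unfolding hcomp_def s using NMap_mk[OF HF that] v[OF that] by simp
qed

section \<open>Small categories and full subcategories\<close>

lemma small_subset: "smallness S \<Longrightarrow> S A \<Longrightarrow> B \<subseteq> A \<Longrightarrow> S B"
  and small_image: "smallness S \<Longrightarrow> S A \<Longrightarrow> S (f ` A)"
  and small_UN: "smallness S \<Longrightarrow> S A \<Longrightarrow> (\<And>x. x \<in> A \<Longrightarrow> S (F x)) \<Longrightarrow> S (\<Union>x\<in>A. F x)"
  unfolding smallness_def by blast+

lemma small_pairs:
  assumes "smallness S" "S A" "S B" shows "S {Pr a b | a b. a \<in> A \<and> b \<in> B}"
proof -
  have "S (\<Union>a\<in>A. Pr a ` B)" using assms small_UN small_image by metis
  moreover have "(\<Union>a\<in>A. Pr a ` B) = {Pr a b | a b. a \<in> A \<and> b \<in> B}" by auto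
  ultimately show ?thesis by simp
qed

lemma small_ord_cat:
  assumes S: "smallness S" shows "small_cat S [n]\<^sub>c"
  unfolding small_cat_def
proof (intro conjI)
  show "category ([n]\<^sub>c :: 'a scat)"
    unfolding ord_cat_def by (rule category_mk_cat) auto
  have N: "S (range Num)" using S unfolding smallness_def by blast
  show "S (Obj [n]\<^sub>c)" by (rule small_subset[OF S N]) (auto simp: ord_cat_def)
  show "S (Arr [n]\<^sub>c)" by (rule small_subset[OF S small_pairs[OF S N N]]) (auto simp: ord_cat_def)
qed

lemma hom_ord_cat: "hom [n]\<^sub>c x y = {Pr x y | i j. x = Num i \<and> y = Num j \<and> i \<le> j \<and> j \<le> n}"
  unfolding ord_cat_def hom_mk_cat by auto

lemma small_sprod_cat:
  assumes S: "smallness S" and J: "small_cat S J" and K: "small_cat S K"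
  shows "small_cat S (J \<times>\<^sub>c K)"
  unfolding small_cat_def
proof (intro conjI)
  have c: "category J" "category K" using J K by (auto simp: small_cat_def)
  show "category (J \<times>\<^sub>c K)"
    unfolding sprod_cat_def
    apply (rule category_mk_cat)
    using c by (auto simp: category_def hom_def)
  show "S (Obj (J \<times>\<^sub>c K))" "S (Arr (J \<times>\<^sub>c K))"
    using J K small_pairs[OF S] by (auto simp: sprod_cat_def small_cat_def)
qed

lemma hom_sprod_cat:
  "hom (J \<times>\<^sub>c K) x y = {Pr f g | f g. \<exists>x1 x2 y1 y2. x = Pr x1 x2 \<and> y = Pr y1 y2 \<and>
      f \<in> hom J x1 y1 \<and> g \<in> hom K x2 y2}"
  unfolding sprod_cat_def hom_mk_cat by (auto simp: hom_def)

lemma full_subcat_simps: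
  "Obj (full_subcat K A) = Obj K \<inter> A"
  "Arr (full_subcat K A) = {f \<in> Arr K. Dom K f \<in> A \<and> Cod K f \<in> A}"
  by (simp_all add: full_subcat_def)

lemma hom_full_subcat: "f \<in> hom (full_subcat K A) x y \<longleftrightarrow> f \<in> hom K x y \<and> x \<in> A \<and> y \<in> A"
  unfolding full_subcat_def hom_mk_cat by (auto simp: hom_def)

lemma full_subcat_Id: "x \<in> Obj K \<Longrightarrow> x \<in> A \<Longrightarrow> Id (full_subcat K A) x = Id K x"
  by (simp add: full_subcat_def)

lemma full_subcat_Comp:
  "f \<in> hom (full_subcat K A) x y \<Longrightarrow> g \<in> hom (full_subcat K A) y z \<Longrightarrow>
     Comp (full_subcat K A) g f = Comp K g f"
  unfolding full_subcat_def hom_mk_cat by (auto simp: mk_cat_def)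

lemma category_full_subcat: "category K \<Longrightarrow> category (full_subcat K A)"
  unfolding full_subcat_def by (rule category_mk_cat) (auto simp: category_def hom_def)

lemma small_full_subcat: "smallness S \<Longrightarrow> small_cat S K \<Longrightarrow> small_cat S (full_subcat K A)"
  unfolding small_cat_def
  by (auto simp: category_full_subcat full_subcat_simps intro: small_subset)

lemma full_subcat_full_subcat: "full_subcat (full_subcat K A) B = full_subcat K (A \<inter> B)"
proof -
  have 1: "Obj K \<inter> A \<inter> B = Obj K \<inter> (A \<inter> B)" by auto
  have 2: "{f \<in> {f \<in> Arr K. Dom K f \<in> A \<and> Cod K f \<in> A}. Dom (full_subcat K A) f \<in> B \<and> Cod (full_subcat K A) f \<in> B}
     = {f \<in> Arr K. Dom K f \<in> A \<inter> B \<and> Cod K f \<in> A \<inter> B}"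
    by (auto simp: full_subcat_def)
  show ?thesis
    unfolding full_subcat_def[of "full_subcat K A"] full_subcat_simps 1 2
    unfolding full_subcat_def mk_cat_def
    by (auto intro!: restrict_ext ext)
qed

lemma full_subcat_all: 
  assumes "category K" "Obj K \<subseteq> A" shows "full_subcat K A = K"
proof -
  have 1: "Obj K \<inter> A = Obj K" "{f \<in> Arr K. Dom K f \<in> A \<and> Cod K f \<in> A} = Arr K"
    using assms Dom_in Cod_in by fastforce+
  have 2: "restrict (Dom K) (Arr K) = Dom K" "restrict (Cod K) (Arr K) = Cod K" "restrict (Id K) (Obj K) = Id K"
    using assms(1) by (auto simp: category_def PiE_def intro!: extensional_restrict)
  have 3: "(\<lambda>g f. if f \<in> Arr K \<and> g \<in> Arr K \<and> Cod K f = Dom K g then Comp K g f else undefined) = Comp K"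
    using assms(1) by (auto simp: category_def fun_eq_iff)
  show ?thesis unfolding full_subcat_def mk_cat_def 1 2 3 by simp
qed

lemma is_fctr_subcat_incl: "category K \<Longrightarrow> is_fctr (subcat_incl K A) (full_subcat K A) K"
  unfolding subcat_incl_def
  by (rule is_fctr_mk)
   (auto simp: category_full_subcat full_subcat_simps hom_full_subcat full_subcat_Id intro: full_subcat_Comp)

lemma small_subcat_incl:
  "smallness S \<Longrightarrow> small_cat S K \<Longrightarrow> small_fctr S (subcat_incl K A) (full_subcat K A) K"
  using is_fctr_subcat_incl[of K A] small_full_subcat[of S K A] by (simp add: small_fctr_def small_cat_def)

lemma is_fctr_obj: "category K \<Longrightarrow> k \<in> Obj K \<Longrightarrow> is_fctr (obj_fctr K k) e\<^sub>c K"
  unfolding obj_fctr_def using small_ord_cat[OF smallness_all]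
  by (intro is_fctr_mk) (auto simp: small_cat_def hom_ord_cat id_hom comp_id[OF _ id_hom])

lemma is_fctr_to_pt: "category J \<Longrightarrow> is_fctr (to_pt J) J e\<^sub>c"
  unfolding to_pt_def using small_ord_cat[OF smallness_all]
  by (intro is_fctr_mk) (auto simp: small_cat_def hom_ord_cat, auto simp: ord_cat_def)

lemma obj_fctr_apply: "x \<in> Obj e\<^sub>c \<Longrightarrow> FObj (obj_fctr K k) x = k"
  by (simp add: obj_fctr_def)

lemma to_pt_comp:
  assumes u: "is_fctr u J K"
  shows "to_pt K \<circ>\<^sub>F u = to_pt J"
proof -
  have c: "category J" "category K" using fctr_cats[OF u] by auto
  have a: "FArr u f \<in> Arr K" if "f \<in> Arr J" for f
    using homD[OF fctr_hom[OF u homI[OF that]]] by blast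
  show ?thesis
    by (rule fctr_eqI[OF is_fctr_comp[OF u is_fctr_to_pt[OF c(2)]] is_fctr_to_pt[OF c(1)]])
      (simp_all add: comp_fctr_simps[OF u], simp_all add: to_pt_def fctr_obj[OF u] a)
qed

lemma obj_fctr_comp:
  assumes u: "is_fctr u J K" and j: "j \<in> Obj J"
  shows "u \<circ>\<^sub>F obj_fctr J j = obj_fctr K (FObj u j)"
proof -
  have c: "category J" "category K" using fctr_cats[OF u] by auto
  note o = is_fctr_obj[OF c(1) j]
  show ?thesis
    by (rule fctr_eqI[OF is_fctr_comp[OF o u] is_fctr_obj[OF c(2) fctr_obj[OF u j]]])
      (auto simp: comp_fctr_simps[OF o], auto simp: obj_fctr_def fctr_id[OF u j])
qed

section \<open>Slices\<close>

text \<open>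
  What \<open>mk_slice\<close> needs to produce a category; it holds for the slices over and under an object.
\<close>

locale slice =
  fixes J :: "'v scat" and obs :: "'v univ set" and P :: "'v univ \<Rightarrow> 'v univ \<Rightarrow> 'v univ \<Rightarrow> bool"
  assumes J: "category J"
    and obs: "x \<in> obs \<Longrightarrow> pfst x \<in> Obj J"
    and P_id: "x \<in> obs \<Longrightarrow> P (psnd x) (psnd x) (Id J (pfst x))"
    and P_comp: "\<lbrakk>x \<in> obs; y \<in> obs; z \<in> obs; a \<in> hom J (pfst x) (pfst y); b \<in> hom J (pfst y) (pfst z);
       P (psnd x) (psnd y) a; P (psnd y) (psnd z) b\<rbrakk> \<Longrightarrow> P (psnd x) (psnd z) (Comp J b a)"
begin

abbreviation C where "C \<equiv> mk_slice J obs P"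

lemma Obj_slice: "Obj C = obs" by (simp add: mk_slice_def)

lemma hom_slice: "hom C x y =
    {Pr x (Pr y a) | a. x \<in> obs \<and> y \<in> obs \<and> a \<in> hom J (pfst x) (pfst y) \<and> P (psnd x) (psnd y) a}"
  unfolding mk_slice_def hom_mk_cat by auto

lemma Id_slice: "x \<in> obs \<Longrightarrow> Id C x = Pr x (Pr x (Id J (pfst x)))"
  by (simp add: mk_slice_def)

lemma Comp_slice:
  "f \<in> hom C x y \<Longrightarrow> g \<in> hom C y z \<Longrightarrow> Comp C g f = Pr x (Pr z (Comp J (psnd (psnd g)) (psnd (psnd f))))"
  unfolding hom_slice by (auto simp: mk_slice_def mk_cat_def)

lemma category_slice: "category C"
proof -
  have "\<And>f g x y z w a b c. \<lbrakk>a \<in> hom J x y; b \<in> hom J y z; c \<in> hom J z w\<rbrakk> \<Longrightarrow>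
     Comp J c (Comp J b a) = Comp J (Comp J c b) a"
    by (rule comp_assoc[OF J])
  then show ?thesis
    unfolding mk_slice_def
    by (intro category_mk_cat)
     (auto simp: P_id obs id_hom[OF J] comp_id[OF J] id_comp[OF J] intro: comp_hom[OF J] P_comp)
qed

lemma is_fctr_proj: "is_fctr (mk_fctr C J pfst (\<lambda>m. psnd (psnd m))) C J"
proof (rule is_fctr_mk[OF category_slice J])
  show "psnd (psnd (Comp C g f)) = Comp J (psnd (psnd g)) (psnd (psnd f))"
    if "f \<in> hom C x y" "g \<in> hom C y z" for f g x y z
    using Comp_slice[OF that] by simp
qed (auto simp: Obj_slice obs Id_slice hom_slice)

lemma small_slice:
  assumes S: "smallness S" and o: "S obs" and a: "S (Arr J)"
  shows "small_cat S C"
  unfolding small_cat_def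
proof (intro conjI)
  show "S (Arr C)"
    by (rule small_subset[OF S small_pairs[OF S o small_pairs[OF S o a]]])
      (auto simp: mk_slice_def hom_def)
qed (auto simp: category_slice Obj_slice o)

end

lemma mk_slice_cong:
  assumes o: "obs = obs'"
    and h: "\<And>x y. x \<in> obs \<Longrightarrow> y \<in> obs \<Longrightarrow> hom J (pfst x) (pfst y) = hom J' (pfst x) (pfst y)"
    and P: "\<And>x y a. x \<in> obs \<Longrightarrow> y \<in> obs \<Longrightarrow> a \<in> hom J (pfst x) (pfst y) \<Longrightarrow>
        P (psnd x) (psnd y) a = P' (psnd x) (psnd y) a"
    and i: "\<And>x. x \<in> obs \<Longrightarrow> Id J (pfst x) = Id J' (pfst x)"
    and m: "\<And>x y z a b. x \<in> obs \<Longrightarrow> y \<in> obs \<Longrightarrow> z \<in> obs \<Longrightarrow> a \<in> hom J (pfst x) (pfst y) \<Longrightarrow>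
        b \<in> hom J (pfst y) (pfst z) \<Longrightarrow> Comp J b a = Comp J' b a"
  shows "mk_slice J obs P = mk_slice J' obs' P'"
proof -
  define A where "A = {Pr x (Pr y a) | x y a. x \<in> obs \<and> y \<in> obs \<and>
      a \<in> hom J (pfst x) (pfst y) \<and> P (psnd x) (psnd y) a}"
  have A': "A = {Pr x (Pr y a) | x y a. x \<in> obs \<and> y \<in> obs \<and>
      a \<in> hom J' (pfst x) (pfst y) \<and> P' (psnd x) (psnd y) a}"
    unfolding A_def using h P by fastforce
  have "Comp J (psnd (psnd g)) (psnd (psnd f)) = Comp J' (psnd (psnd g)) (psnd (psnd f))"
    if fg: "f \<in> A" "g \<in> A" "pfst (psnd f) = pfst g" for f g
  proof -
    obtain x y a z b where "f = Pr x (Pr y a)" "g = Pr y (Pr z b)" "x \<in> obs" "y \<in> obs" "z \<in> obs"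
        "a \<in> hom J (pfst x) (pfst y)" "b \<in> hom J (pfst y) (pfst z)"
      using fg unfolding A_def by auto
    then show ?thesis using m[of x y z a b] by simp
  qed
  then show ?thesis
    unfolding mk_slice_def o[symmetric] A_def[symmetric] A'[symmetric] mk_cat_def
    using i by (intro cat.equality) (simp_all add: fun_eq_iff restrict_def)
qed

lemma over_slice:
  assumes u: "is_fctr u J K"
  shows "slice J {Pr j f | j f. j \<in> Obj J \<and> f \<in> hom K (FObj u j) k} (\<lambda>f f' a. Comp K f' (FArr u a) = f)"
proof
  have c: "category J" "category K" using fctr_cats[OF u] by auto
  show "category J" by fact
  let ?o = "{Pr j f | j f. j \<in> Obj J \<and> f \<in> hom K (FObj u j) k}"
  fix x y z a b
  assume x: "x \<in> ?o"
  then show "pfst x \<in> Obj J" by auto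
  show "Comp K (psnd x) (FArr u (Id J (pfst x))) = psnd x"
    using x fctr_id[OF u] comp_id[OF c(2)] by auto
  assume yz: "y \<in> ?o" "z \<in> ?o" and ab: "a \<in> hom J (pfst x) (pfst y)" "b \<in> hom J (pfst y) (pfst z)"
    and e: "Comp K (psnd y) (FArr u a) = psnd x" "Comp K (psnd z) (FArr u b) = psnd y"
  have "psnd z \<in> hom K (FObj u (pfst z)) k" using yz by auto
  then show "Comp K (psnd z) (FArr u (Comp J b a)) = psnd x"
    using comp_assoc[OF c(2) fctr_hom[OF u ab(1)] fctr_hom[OF u ab(2)]] fctr_comp[OF u ab] e by simp
qed

lemma under_slice:
  assumes u: "is_fctr u J K"
  shows "slice J {Pr j f | j f. j \<in> Obj J \<and> f \<in> hom K k (FObj u j)} (\<lambda>f f' a. Comp K (FArr u a) f = f')"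
proof
  have c: "category J" "category K" using fctr_cats[OF u] by auto
  show "category J" by fact
  let ?o = "{Pr j f | j f. j \<in> Obj J \<and> f \<in> hom K k (FObj u j)}"
  fix x y z a b
  assume x: "x \<in> ?o"
  then show "pfst x \<in> Obj J" by auto
  show "Comp K (FArr u (Id J (pfst x))) (psnd x) = psnd x"
    using x fctr_id[OF u] id_comp[OF c(2)] by auto
  assume yz: "y \<in> ?o" "z \<in> ?o" and ab: "a \<in> hom J (pfst x) (pfst y)" "b \<in> hom J (pfst y) (pfst z)"
    and e: "Comp K (FArr u a) (psnd x) = psnd y" "Comp K (FArr u b) (psnd y) = psnd z"
  have "psnd x \<in> hom K k (FObj u (pfst x))" using x by auto
  then have h: "psnd x \<in> hom K k (FObj u (pfst x))" .
  show "Comp K (FArr u (Comp J b a)) (psnd x) = psnd z"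
    using comp_assoc[OF c(2) h fctr_hom[OF u ab(1)] fctr_hom[OF u ab(2)]] fctr_comp[OF u ab] e by simp
qed

lemma over_cat_eq: "is_fctr u J K \<Longrightarrow> over_cat u k =
    mk_slice J {Pr j f | j f. j \<in> Obj J \<and> f \<in> hom K (FObj u j) k} (\<lambda>f f' a. Comp K f' (FArr u a) = f)"
  and under_cat_eq: "is_fctr u J K \<Longrightarrow> under_cat u k =
    mk_slice J {Pr j f | j f. j \<in> Obj J \<and> f \<in> hom K k (FObj u j)} (\<lambda>f f' a. Comp K (FArr u a) f = f')"
  by (auto simp: over_cat_def under_cat_def dest: fctr_cats)

lemma over_cat_facts:
  assumes u: "is_fctr u J K"
  shows "category (over_cat u k)"
    and "x \<in> Obj (over_cat u k) \<longleftrightarrow> (\<exists>j f. x = Pr j f \<and> j \<in> Obj J \<and> f \<in> hom K (FObj u j) k)"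
    and "m \<in> hom (over_cat u k) x y \<longleftrightarrow> (\<exists>a. m = Pr x (Pr y a) \<and> x \<in> Obj (over_cat u k) \<and>
       y \<in> Obj (over_cat u k) \<and> a \<in> hom J (pfst x) (pfst y) \<and> Comp K (psnd y) (FArr u a) = psnd x)"
    and "x \<in> Obj (over_cat u k) \<Longrightarrow> Id (over_cat u k) x = Pr x (Pr x (Id J (pfst x)))"
    and "m \<in> hom (over_cat u k) x y \<Longrightarrow> n \<in> hom (over_cat u k) y z \<Longrightarrow>
       Comp (over_cat u k) n m = Pr x (Pr z (Comp J (psnd (psnd n)) (psnd (psnd m))))"
    and "is_fctr (over_proj u k) (over_cat u k) J"
proof -
  interpret slice J "{Pr j f | j f. j \<in> Obj J \<and> f \<in> hom K (FObj u j) k}" "\<lambda>f f' a. Comp K f' (FArr u a) = f"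
    by (rule over_slice[OF u])
  show "category (over_cat u k)"
    and "x \<in> Obj (over_cat u k) \<longleftrightarrow> (\<exists>j f. x = Pr j f \<and> j \<in> Obj J \<and> f \<in> hom K (FObj u j) k)"
    and "m \<in> hom (over_cat u k) x y \<longleftrightarrow> (\<exists>a. m = Pr x (Pr y a) \<and> x \<in> Obj (over_cat u k) \<and>
       y \<in> Obj (over_cat u k) \<and> a \<in> hom J (pfst x) (pfst y) \<and> Comp K (psnd y) (FArr u a) = psnd x)"
    and "x \<in> Obj (over_cat u k) \<Longrightarrow> Id (over_cat u k) x = Pr x (Pr x (Id J (pfst x)))"
    and "m \<in> hom (over_cat u k) x y \<Longrightarrow> n \<in> hom (over_cat u k) y z \<Longrightarrow>
       Comp (over_cat u k) n m = Pr x (Pr z (Comp J (psnd (psnd n)) (psnd (psnd m))))"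
    and "is_fctr (over_proj u k) (over_cat u k) J"
    using category_slice is_fctr_proj Comp_slice[of m x y n z] Id_slice[of x] fctr_cats[OF u]
    unfolding over_proj_def over_cat_eq[OF u] hom_slice Obj_slice by auto
qed

lemma under_cat_facts:
  assumes u: "is_fctr u J K"
  shows "category (under_cat u k)"
    and "x \<in> Obj (under_cat u k) \<longleftrightarrow> (\<exists>j f. x = Pr j f \<and> j \<in> Obj J \<and> f \<in> hom K k (FObj u j))"
    and "m \<in> hom (under_cat u k) x y \<longleftrightarrow> (\<exists>a. m = Pr x (Pr y a) \<and> x \<in> Obj (under_cat u k) \<and>
       y \<in> Obj (under_cat u k) \<and> a \<in> hom J (pfst x) (pfst y) \<and> Comp K (FArr u a) (psnd x) = psnd y)"
    and "x \<in> Obj (under_cat u k) \<Longrightarrow> Id (under_cat u k) x = Pr x (Pr x (Id J (pfst x)))"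
    and "m \<in> hom (under_cat u k) x y \<Longrightarrow> n \<in> hom (under_cat u k) y z \<Longrightarrow>
       Comp (under_cat u k) n m = Pr x (Pr z (Comp J (psnd (psnd n)) (psnd (psnd m))))"
    and "is_fctr (under_proj u k) (under_cat u k) J"
proof -
  interpret slice J "{Pr j f | j f. j \<in> Obj J \<and> f \<in> hom K k (FObj u j)}" "\<lambda>f f' a. Comp K (FArr u a) f = f'"
    by (rule under_slice[OF u])
  show "category (under_cat u k)"
    and "x \<in> Obj (under_cat u k) \<longleftrightarrow> (\<exists>j f. x = Pr j f \<and> j \<in> Obj J \<and> f \<in> hom K k (FObj u j))"
    and "m \<in> hom (under_cat u k) x y \<longleftrightarrow> (\<exists>a. m = Pr x (Pr y a) \<and> x \<in> Obj (under_cat u k) \<and>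
       y \<in> Obj (under_cat u k) \<and> a \<in> hom J (pfst x) (pfst y) \<and> Comp K (FArr u a) (psnd x) = psnd y)"
    and "x \<in> Obj (under_cat u k) \<Longrightarrow> Id (under_cat u k) x = Pr x (Pr x (Id J (pfst x)))"
    and "m \<in> hom (under_cat u k) x y \<Longrightarrow> n \<in> hom (under_cat u k) y z \<Longrightarrow>
       Comp (under_cat u k) n m = Pr x (Pr z (Comp J (psnd (psnd n)) (psnd (psnd m))))"
    and "is_fctr (under_proj u k) (under_cat u k) J"
    using category_slice is_fctr_proj Comp_slice[of m x y n z] Id_slice[of x] fctr_cats[OF u]
    unfolding under_proj_def under_cat_eq[OF u] hom_slice Obj_slice by auto
qed

lemma small_over_under:
  assumes S: "smallness S" and u: "small_fctr S u J K"
  shows "small_cat S (over_cat u k)" "small_cat S (under_cat u k)"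
proof -
  have s: "S (Obj J)" "S (Arr J)" "S (Arr K)" and f: "is_fctr u J K"
    using u by (auto simp: small_fctr_def small_cat_def)
  have p: "S {Pr a b | a b. a \<in> Obj J \<and> b \<in> Arr K}" using small_pairs[OF S s(1,3)] .
  have "S {Pr j f | j f. j \<in> Obj J \<and> f \<in> hom K (FObj u j) k}"
    "S {Pr j f | j f. j \<in> Obj J \<and> f \<in> hom K k (FObj u j)}"
    by (rule small_subset[OF S p]; auto simp: hom_def)+
  then show "small_cat S (over_cat u k)" "small_cat S (under_cat u k)"
    unfolding over_cat_eq[OF f] under_cat_eq[OF f]
    using slice.small_slice[OF over_slice[OF f] S _ s(2)] slice.small_slice[OF under_slice[OF f] S _ s(2)]
    by blast+
qed

text \<open>
  Naturality is the commutativity of the triangles that are the arrows of the slice.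
\<close>

lemma over_nt_is_ntrans:
  assumes u: "is_fctr u J K" and k: "k \<in> Obj K"
  shows "is_ntrans (over_nt u k) (u \<circ>\<^sub>F over_proj u k) (obj_fctr K k \<circ>\<^sub>F to_pt (over_cat u k))"
    and "x \<in> Obj (over_cat u k) \<Longrightarrow> NMap (over_nt u k) x = psnd x"
proof -
  have c: "category K" "FCod u = K" using fctr_cats[OF u] by auto
  note o = over_cat_facts[OF u, where k = k]
  note pr = o(6) and pt = is_fctr_to_pt[OF o(1)] and ob = is_fctr_obj[OF c(1) k]
  note F = is_fctr_comp[OF pr u] and G = is_fctr_comp[OF pt ob]
  have v: "FObj (u \<circ>\<^sub>F over_proj u k) x = FObj u (pfst x)"
     "FObj (obj_fctr K k \<circ>\<^sub>F to_pt (over_cat u k)) x = k" if "x \<in> Obj (over_cat u k)" for x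
    using that by (simp_all add: comp_fctr_simps(3)[OF pr] comp_fctr_simps(3)[OF pt])
      (auto simp: over_proj_def obj_fctr_def to_pt_def ord_cat_def)
  show "is_ntrans (over_nt u k) (u \<circ>\<^sub>F over_proj u k) (obj_fctr K k \<circ>\<^sub>F to_pt (over_cat u k))"
    unfolding over_nt_def c
  proof (rule is_ntrans_mk[OF F G])
    show h: "psnd x \<in> hom K (FObj (u \<circ>\<^sub>F over_proj u k) x) (FObj (obj_fctr K k \<circ>\<^sub>F to_pt (over_cat u k)) x)"
      if "x \<in> Obj (over_cat u k)" for x
      using that unfolding v[OF that] o(2) by auto
    fix f x y assume f: "f \<in> hom (over_cat u k) x y"
    have fa: "f \<in> Arr (over_cat u k)" using homD[OF f] by blast
    have xy: "x \<in> Obj (over_cat u k)" "y \<in> Obj (over_cat u k)" using hom_obj[OF o(1) f] by auto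
    have "FArr (u \<circ>\<^sub>F over_proj u k) f = FArr u (psnd (psnd f))"
      unfolding comp_fctr_simps(4)[OF pr fa] using fa by (simp add: over_proj_def)
    moreover have "FArr (obj_fctr K k \<circ>\<^sub>F to_pt (over_cat u k)) f = Id K k"
      using fa by (simp add: comp_fctr_simps(4)[OF pt])
         (auto simp: obj_fctr_def to_pt_def ord_cat_def)
    ultimately show "Comp K (FArr (obj_fctr K k \<circ>\<^sub>F to_pt (over_cat u k)) f) (psnd x) =
       Comp K (psnd y) (FArr (u \<circ>\<^sub>F over_proj u k) f)"
      using f h[OF xy(1)] v[OF xy(1)] id_comp[OF c(1)] by (auto simp: o(3))
  qed
  show "x \<in> Obj (over_cat u k) \<Longrightarrow> NMap (over_nt u k) x = psnd x"
    unfolding over_nt_def c by (rule NMap_mk[OF F])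
qed

lemma under_nt_is_ntrans:
  assumes u: "is_fctr u J K" and k: "k \<in> Obj K"
  shows "is_ntrans (under_nt u k) (obj_fctr K k \<circ>\<^sub>F to_pt (under_cat u k)) (u \<circ>\<^sub>F under_proj u k)"
    and "x \<in> Obj (under_cat u k) \<Longrightarrow> NMap (under_nt u k) x = psnd x"
proof -
  have c: "category K" "FCod u = K" using fctr_cats[OF u] by auto
  note o = under_cat_facts[OF u, where k = k]
  note pr = o(6) and pt = is_fctr_to_pt[OF o(1)] and ob = is_fctr_obj[OF c(1) k]
  note F = is_fctr_comp[OF pr u] and G = is_fctr_comp[OF pt ob]
  have v: "FObj (u \<circ>\<^sub>F under_proj u k) x = FObj u (pfst x)"
     "FObj (obj_fctr K k \<circ>\<^sub>F to_pt (under_cat u k)) x = k" if "x \<in> Obj (under_cat u k)" for x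
    using that by (simp_all add: comp_fctr_simps(3)[OF pr] comp_fctr_simps(3)[OF pt])
      (auto simp: under_proj_def obj_fctr_def to_pt_def ord_cat_def)
  show "is_ntrans (under_nt u k) (obj_fctr K k \<circ>\<^sub>F to_pt (under_cat u k)) (u \<circ>\<^sub>F under_proj u k)"
    unfolding under_nt_def c
  proof (rule is_ntrans_mk[OF G F])
    show h: "psnd x \<in> hom K (FObj (obj_fctr K k \<circ>\<^sub>F to_pt (under_cat u k)) x) (FObj (u \<circ>\<^sub>F under_proj u k) x)"
      if "x \<in> Obj (under_cat u k)" for x
      using that unfolding v[OF that] o(2) by auto
    fix f x y assume f: "f \<in> hom (under_cat u k) x y"
    have fa: "f \<in> Arr (under_cat u k)" using homD[OF f] by blast
    have xy: "x \<in> Obj (under_cat u k)" "y \<in> Obj (under_cat u k)" using hom_obj[OF o(1) f] by auto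
    have "FArr (u \<circ>\<^sub>F under_proj u k) f = FArr u (psnd (psnd f))"
      unfolding comp_fctr_simps(4)[OF pr fa] using fa by (simp add: under_proj_def)
    moreover have "FArr (obj_fctr K k \<circ>\<^sub>F to_pt (under_cat u k)) f = Id K k"
      using fa by (simp add: comp_fctr_simps(4)[OF pt])
         (auto simp: obj_fctr_def to_pt_def ord_cat_def)
    ultimately show "Comp K (FArr (u \<circ>\<^sub>F under_proj u k) f) (psnd x) =
       Comp K (psnd y) (FArr (obj_fctr K k \<circ>\<^sub>F to_pt (under_cat u k)) f)"
      using f h[OF xy(2)] v[OF xy(2)] comp_id[OF c(1)] by (auto simp: o(3))
  qed
  show "x \<in> Obj (under_cat u k) \<Longrightarrow> NMap (under_nt u k) x = psnd x"
    unfolding under_nt_def c by (rule NMap_mk[OF G])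
qed

lemma subcat_incl_simps:
  "x \<in> Obj K \<Longrightarrow> x \<in> A \<Longrightarrow> FObj (subcat_incl K A) x = x"
  "f \<in> hom (full_subcat K A) x y \<Longrightarrow> FArr (subcat_incl K A) f = f"
  by (simp_all add: subcat_incl_def full_subcat_simps hom_def)

lemma subcat_incl_comp_eq:
  assumes c: "category K" and F: "is_fctr F B (full_subcat K A)"
    and G: "is_fctr G B (full_subcat (full_subcat K N) A)"
    and o: "\<And>x. x \<in> Obj B \<Longrightarrow> FObj F x = FObj G x" and a: "\<And>f. f \<in> Arr B \<Longrightarrow> FArr F f = FArr G f"
  shows "subcat_incl K A \<circ>\<^sub>F F = subcat_incl K N \<circ>\<^sub>F (subcat_incl (full_subcat K N) A \<circ>\<^sub>F G)"
proof -
  note c' = category_full_subcat[OF c, of N]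
  note uf = is_fctr_subcat_incl[OF c, of A] and qf = is_fctr_subcat_incl[OF c, of N]
    and vf = is_fctr_subcat_incl[OF c', of A]
  note vG = is_fctr_comp[OF G vf]
  note s = comp_fctr_simps[OF F] comp_fctr_simps[OF G] comp_fctr_simps[OF vG]
  show ?thesis
  proof (rule fctr_eqI[OF is_fctr_comp[OF F uf] is_fctr_comp[OF vG qf]])
    fix x assume x: "x \<in> Obj B"
    show "FObj (subcat_incl K A \<circ>\<^sub>F F) x = FObj (subcat_incl K N \<circ>\<^sub>F (subcat_incl (full_subcat K N) A \<circ>\<^sub>F G)) x"
      using x o[OF x] fctr_obj[OF G x] by (simp add: s full_subcat_simps subcat_incl_simps)
  next
    fix f assume f: "f \<in> Arr B"
    note h = fctr_hom[OF F homI[OF f refl refl]] fctr_hom[OF G homI[OF f refl refl]]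
    have "FArr G f \<in> hom (full_subcat K N) (FObj G (Dom B f)) (FObj G (Cod B f))"
      using h(2) by (simp add: hom_full_subcat)
    from subcat_incl_simps(2)[OF this]
    show "FArr (subcat_incl K A \<circ>\<^sub>F F) f = FArr (subcat_incl K N \<circ>\<^sub>F (subcat_incl (full_subcat K N) A \<circ>\<^sub>F G)) f"
      using f a[OF f] subcat_incl_simps(2)[OF h(1)] subcat_incl_simps(2)[OF h(2)] by (simp add: s)
  qed
qed

lemma full_subcat_nested:
  fixes K :: "'v scat" and A N :: "'v univ set"
  defines "J' \<equiv> full_subcat (full_subcat K N) A"
  shows "x \<in> Obj J' \<Longrightarrow> y \<in> Obj J' \<Longrightarrow> hom J' x y = hom (full_subcat K A) x y"
    and "x \<in> Obj J' \<Longrightarrow> Id J' x = Id (full_subcat K A) x"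
    and "a \<in> hom J' x y \<Longrightarrow> b \<in> hom J' y z \<Longrightarrow> Comp J' b a = Comp (full_subcat K A) b a"
proof -
  show "x \<in> Obj J' \<Longrightarrow> y \<in> Obj J' \<Longrightarrow> hom J' x y = hom (full_subcat K A) x y"
    unfolding J'_def by (auto simp: hom_full_subcat full_subcat_simps)
  show "x \<in> Obj J' \<Longrightarrow> Id J' x = Id (full_subcat K A) x"
    unfolding J'_def by (simp add: full_subcat_full_subcat full_subcat_simps full_subcat_Id)
  show "Comp J' b a = Comp (full_subcat K A) b a" if "a \<in> hom J' x y" "b \<in> hom J' y z"
    using full_subcat_Comp[OF that[unfolded J'_def]] full_subcat_Comp[of a K A x y b z]
      full_subcat_Comp[of a K N x y b z] that
    unfolding J'_def by (simp add: hom_full_subcat)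
qed

text \<open>
  For \<open>k\<close> in a downward closed \<open>N\<close>, every object of \<open>A\<close> with an arrow to \<open>k\<close> lies in \<open>N\<close>. As full
  subcategories have the same arrows, the two slices are not only isomorphic but equal, and no
  transport along an isomorphism of categories is needed.
\<close>

lemma over_sieve:
  fixes K :: "'v scat" and A N :: "'v univ set"
  assumes c: "category K" and N: "\<And>f. f \<in> Arr K \<Longrightarrow> Cod K f \<in> N \<Longrightarrow> Dom K f \<in> N" and k: "k \<in> Obj K" "k \<in> N"
  defines "q \<equiv> subcat_incl K N" and "u \<equiv> subcat_incl K A" and "v \<equiv> subcat_incl (full_subcat K N) A"
  shows "over_cat v k = over_cat u k"
    and "u \<circ>\<^sub>F over_proj u k = q \<circ>\<^sub>F (v \<circ>\<^sub>F over_proj v k)"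
    and "over_nt u k = id_ntrans q \<star> over_nt v k"
proof -
  let ?K = "full_subcat K N" and ?u = "subcat_incl K A" and ?q = "subcat_incl K N"
  let ?v = "subcat_incl ?K A" and ?J = "full_subcat K A" and ?J' = "full_subcat ?K A"
  have c': "category ?K" using category_full_subcat[OF c] .
  note uf = is_fctr_subcat_incl[OF c, of A] and qf = is_fctr_subcat_incl[OF c, of N]
    and vf = is_fctr_subcat_incl[OF c', of A]
  have kK: "k \<in> Obj ?K" using k by (simp add: full_subcat_simps)
  have N': "x \<in> N" if "f \<in> hom K x k" for f x using N[of f] that k by (auto simp: hom_def)
  have uo: "FObj ?u j = j" if "j \<in> Obj ?J" for j
    using that by (simp add: full_subcat_simps subcat_incl_simps)
  have vo: "FObj ?v j = j" if "j \<in> Obj ?J'" for j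
    using that by (simp add: full_subcat_simps subcat_incl_simps)
  have O: "over_cat ?v k = over_cat ?u k"
    unfolding over_cat_eq[OF uf] over_cat_eq[OF vf]
  proof (rule mk_slice_cong)
    let ?o = "{Pr j f | j f. j \<in> Obj ?J' \<and> f \<in> hom ?K (FObj ?v j) k}"
    have m: "pfst x \<in> Obj ?J'" "psnd x \<in> hom K (pfst x) k" if "x \<in> ?o" for x
      using that vo by (auto simp: hom_full_subcat)
    show "?o = {Pr j f | j f. j \<in> Obj ?J \<and> f \<in> hom K (FObj ?u j) k}"
      using vo uo N' k by (auto simp: hom_full_subcat full_subcat_simps)
    fix x y z a b assume x: "x \<in> ?o"
    show "Id ?J' (pfst x) = Id ?J (pfst x)" using full_subcat_nested(2)[OF m(1)[OF x]] .
    assume y: "y \<in> ?o"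
    show h: "hom ?J' (pfst x) (pfst y) = hom ?J (pfst x) (pfst y)"
      using full_subcat_nested(1)[OF m(1)[OF x] m(1)[OF y]] .
    { assume a: "a \<in> hom ?J' (pfst x) (pfst y)"
      then have a': "a \<in> hom ?K (pfst x) (pfst y)" "a \<in> hom K (pfst x) (pfst y)"
        by (auto simp: hom_full_subcat)
      have "psnd y \<in> hom ?K (pfst y) k" using m[OF y] kK by (auto simp: hom_full_subcat full_subcat_simps)
      then show "(Comp ?K (psnd y) (FArr ?v a) = psnd x) = (Comp K (psnd y) (FArr ?u a) = psnd x)"
        using a full_subcat_Comp[OF a'(1)] h subcat_incl_simps(2) by metis }
    assume "z \<in> ?o" and a: "a \<in> hom ?J' (pfst x) (pfst y)" and b: "b \<in> hom ?J' (pfst y) (pfst z)"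
    show "Comp ?J' b a = Comp ?J b a"
      using full_subcat_nested(3)[OF a b] .
  qed
  then show "over_cat v k = over_cat u k" unfolding u_def v_def .
  note puf = over_cat_facts(6)[OF uf, of k] and pvf = over_cat_facts(6)[OF vf, of k]
  note vpf = is_fctr_comp[OF pvf vf]
  have P: "?u \<circ>\<^sub>F over_proj ?u k = ?q \<circ>\<^sub>F (?v \<circ>\<^sub>F over_proj ?v k)"
    by (rule subcat_incl_comp_eq[OF c puf pvf[unfolded O]]) (simp_all add: over_proj_def O)
  then show "u \<circ>\<^sub>F over_proj u k = q \<circ>\<^sub>F (v \<circ>\<^sub>F over_proj v k)" unfolding u_def v_def q_def .
  have ok: "obj_fctr K k \<circ>\<^sub>F to_pt (over_cat ?u k) = ?q \<circ>\<^sub>F (obj_fctr ?K k \<circ>\<^sub>F to_pt (over_cat ?v k))"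
    using comp_fctr_assoc[OF is_fctr_to_pt[OF over_cat_facts(1)[OF vf, of k]] is_fctr_obj[OF c' kK] qf]
      obj_fctr_comp[OF qf kK] subcat_incl_simps(1)[OF k] O by simp
  note nu = over_nt_is_ntrans[OF uf k(1)] and nv = over_nt_is_ntrans[OF vf kK]
  note oc = is_fctr_comp[OF is_fctr_to_pt[OF over_cat_facts(1)[OF vf]] is_fctr_obj[OF c' kK]]
    and ou = is_fctr_comp[OF is_fctr_to_pt[OF over_cat_facts(1)[OF uf]] is_fctr_obj[OF c k(1)]]
  note nq = is_ntrans_hcomp_id_left[OF nv(1) vpf qf, folded P ok]
  have "over_nt ?u k = id_ntrans ?q \<star> over_nt ?v k"
  proof (rule ntrans_eqI[OF nu(1) nq(1) is_fctr_comp[OF puf uf]])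
    fix x assume x: "x \<in> Obj (over_cat ?u k)"
    then have x': "x \<in> Obj (over_cat ?v k)" using O by simp
    show "NMap (over_nt ?u k) x = NMap (id_ntrans ?q \<star> over_nt ?v k) x"
      using nu(2)[OF x] nv(2)[OF x'] nq(2)[OF x'] subcat_incl_simps(2)[OF ntrans_hom[OF nv(1) vpf x']] by simp
  qed
  then show "over_nt u k = id_ntrans q \<star> over_nt v k" unfolding u_def v_def q_def .
qed

lemma under_cosieve:
  fixes K :: "'v scat" and A N :: "'v univ set"
  assumes c: "category K" and N: "\<And>f. f \<in> Arr K \<Longrightarrow> Dom K f \<in> N \<Longrightarrow> Cod K f \<in> N" and k: "k \<in> Obj K" "k \<in> N"
  defines "q \<equiv> subcat_incl K N" and "u \<equiv> subcat_incl K A" and "v \<equiv> subcat_incl (full_subcat K N) A"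
  shows "under_cat v k = under_cat u k"
    and "u \<circ>\<^sub>F under_proj u k = q \<circ>\<^sub>F (v \<circ>\<^sub>F under_proj v k)"
    and "under_nt u k = id_ntrans q \<star> under_nt v k"
proof -
  let ?K = "full_subcat K N" and ?u = "subcat_incl K A" and ?q = "subcat_incl K N"
  let ?v = "subcat_incl ?K A" and ?J = "full_subcat K A" and ?J' = "full_subcat ?K A"
  have c': "category ?K" using category_full_subcat[OF c] .
  note uf = is_fctr_subcat_incl[OF c, of A] and qf = is_fctr_subcat_incl[OF c, of N]
    and vf = is_fctr_subcat_incl[OF c', of A]
  have kK: "k \<in> Obj ?K" using k by (simp add: full_subcat_simps)
  have N': "x \<in> N" if "f \<in> hom K k x" for f x using N[of f] that k by (auto simp: hom_def)
  have uo: "FObj ?u j = j" if "j \<in> Obj ?J" for j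
    using that by (simp add: full_subcat_simps subcat_incl_simps)
  have vo: "FObj ?v j = j" if "j \<in> Obj ?J'" for j
    using that by (simp add: full_subcat_simps subcat_incl_simps)
  have O: "under_cat ?v k = under_cat ?u k"
    unfolding under_cat_eq[OF uf] under_cat_eq[OF vf]
  proof (rule mk_slice_cong)
    let ?o = "{Pr j f | j f. j \<in> Obj ?J' \<and> f \<in> hom ?K k (FObj ?v j)}"
    have m: "pfst x \<in> Obj ?J'" "psnd x \<in> hom K k (pfst x)" if "x \<in> ?o" for x
      using that vo by (auto simp: hom_full_subcat)
    show "?o = {Pr j f | j f. j \<in> Obj ?J \<and> f \<in> hom K k (FObj ?u j)}"
      using vo uo N' k by (auto simp: hom_full_subcat full_subcat_simps)
    fix x y z a b assume x: "x \<in> ?o"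
    show "Id ?J' (pfst x) = Id ?J (pfst x)" using full_subcat_nested(2)[OF m(1)[OF x]] .
    assume y: "y \<in> ?o"
    show h: "hom ?J' (pfst x) (pfst y) = hom ?J (pfst x) (pfst y)"
      using full_subcat_nested(1)[OF m(1)[OF x] m(1)[OF y]] .
    { assume a: "a \<in> hom ?J' (pfst x) (pfst y)"
      then have a': "a \<in> hom ?K (pfst x) (pfst y)" "a \<in> hom K (pfst x) (pfst y)"
        by (auto simp: hom_full_subcat)
      have "psnd x \<in> hom ?K k (pfst x)" using m[OF x] kK by (auto simp: hom_full_subcat full_subcat_simps)
      then show "(Comp ?K (FArr ?v a) (psnd x) = psnd y) = (Comp K (FArr ?u a) (psnd x) = psnd y)"
        using a full_subcat_Comp[OF _ a'(1)] h subcat_incl_simps(2) by metis }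
    assume "z \<in> ?o" and a: "a \<in> hom ?J' (pfst x) (pfst y)" and b: "b \<in> hom ?J' (pfst y) (pfst z)"
    show "Comp ?J' b a = Comp ?J b a"
      using full_subcat_nested(3)[OF a b] .
  qed
  then show "under_cat v k = under_cat u k" unfolding u_def v_def .
  note puf = under_cat_facts(6)[OF uf, of k] and pvf = under_cat_facts(6)[OF vf, of k]
  note vpf = is_fctr_comp[OF pvf vf]
  have P: "?u \<circ>\<^sub>F under_proj ?u k = ?q \<circ>\<^sub>F (?v \<circ>\<^sub>F under_proj ?v k)"
    by (rule subcat_incl_comp_eq[OF c puf pvf[unfolded O]]) (simp_all add: under_proj_def O)
  then show "u \<circ>\<^sub>F under_proj u k = q \<circ>\<^sub>F (v \<circ>\<^sub>F under_proj v k)" unfolding u_def v_def q_def .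
  have ok: "obj_fctr K k \<circ>\<^sub>F to_pt (under_cat ?u k) = ?q \<circ>\<^sub>F (obj_fctr ?K k \<circ>\<^sub>F to_pt (under_cat ?v k))"
    using comp_fctr_assoc[OF is_fctr_to_pt[OF under_cat_facts(1)[OF vf, of k]] is_fctr_obj[OF c' kK] qf]
      obj_fctr_comp[OF qf kK] subcat_incl_simps(1)[OF k] O by simp
  note nu = under_nt_is_ntrans[OF uf k(1)] and nv = under_nt_is_ntrans[OF vf kK]
  note oc = is_fctr_comp[OF is_fctr_to_pt[OF under_cat_facts(1)[OF vf]] is_fctr_obj[OF c' kK]]
    and ou = is_fctr_comp[OF is_fctr_to_pt[OF under_cat_facts(1)[OF uf]] is_fctr_obj[OF c k(1)]]
  note nq = is_ntrans_hcomp_id_left[OF nv(1) oc qf, folded P ok]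
  have "under_nt ?u k = id_ntrans ?q \<star> under_nt ?v k"
  proof (rule ntrans_eqI[OF nu(1) nq(1) ou])
    fix x assume x: "x \<in> Obj (under_cat ?u k)"
    then have x': "x \<in> Obj (under_cat ?v k)" using O by simp
    show "NMap (under_nt ?u k) x = NMap (id_ntrans ?q \<star> under_nt ?v k) x"
      using nu(2)[OF x] nv(2)[OF x'] nq(2)[OF x'] subcat_incl_simps(2)[OF ntrans_hom[OF nv(1) oc x']] by simp
  qed
  then show "under_nt u k = id_ntrans q \<star> under_nt v k" unfolding u_def v_def q_def .
qed

section \<open>Derivators\<close>

locale derivator_setting =
  fixes S :: "'v univ set \<Rightarrow> bool" and D :: "('v, 'o, 'a) preder"
  assumes S: "smallness S" and D: "derivator S D"
begin

lemma small_cats: "small_fctr S u J K \<Longrightarrow> small_cat S J \<and> small_cat S K \<and> is_fctr u J K"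
  by (simp add: small_fctr_def)

lemma DCat_category: "small_cat S J \<Longrightarrow> category (DCat D J)"
  using D by (simp add: derivator_def prederivator_def)

lemma DFun_fctr: "small_fctr S u J K \<Longrightarrow> is_fctr (DFun D u) (DCat D K) (DCat D J)"
  using D[unfolded derivator_def prederivator_def, THEN conjunct1, THEN conjunct2, THEN conjunct1, rule_format] .

lemma DFun_id: "small_cat S J \<Longrightarrow> DFun D (id_fctr J) = id_fctr (DCat D J)"
  using D by (simp add: derivator_def prederivator_def)

lemma DFun_comp:
  "small_fctr S u J K \<Longrightarrow> small_fctr S v K L \<Longrightarrow> DFun D (v \<circ>\<^sub>F u) = DFun D u \<circ>\<^sub>F DFun D v"
  using D[unfolded derivator_def prederivator_def, THEN conjunct1, THEN conjunct2, THEN conjunct2, THEN conjunct2, THEN conjunct2, THEN conjunct1, rule_format] .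

lemma DFun_comp_apply:
  assumes u: "small_fctr S u J K" and v: "small_fctr S v K L"
  shows "x \<in> Obj (DCat D L) \<Longrightarrow> FObj (DFun D (v \<circ>\<^sub>F u)) x = FObj (DFun D u) (FObj (DFun D v) x)"
    and "f \<in> Arr (DCat D L) \<Longrightarrow> FArr (DFun D (v \<circ>\<^sub>F u)) f = FArr (DFun D u) (FArr (DFun D v) f)"
  unfolding DFun_comp[OF u v] by (simp_all add: comp_fctr_simps[OF DFun_fctr[OF v]])

lemma small_comp: "small_fctr S u J K \<Longrightarrow> small_fctr S v K L \<Longrightarrow> small_fctr S (v \<circ>\<^sub>F u) J L"
  unfolding small_fctr_def using is_fctr_comp by blast

lemma small_id: "small_cat S J \<Longrightarrow> small_fctr S (id_fctr J) J J"
  by (simp add: small_fctr_def small_cat_def is_fctr_id)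

lemma DNat_ntrans:
  "small_fctr S u J K \<Longrightarrow> small_fctr S v J K \<Longrightarrow> is_ntrans a u v \<Longrightarrow>
     is_ntrans (DNat D a) (DFun D u) (DFun D v)"
  using D[unfolded derivator_def prederivator_def, THEN conjunct1, THEN conjunct2, THEN conjunct2, THEN conjunct1, rule_format] .

lemma DNat_id: "small_fctr S u J K \<Longrightarrow> DNat D (id_ntrans u) = id_ntrans (DFun D u)"
  using D[unfolded derivator_def prederivator_def, THEN conjunct1, THEN conjunct2, THEN conjunct2, THEN conjunct2, THEN conjunct2, THEN conjunct2, THEN conjunct1, rule_format] .

lemma DNat_hcomp:
  "small_fctr S u J K \<Longrightarrow> small_fctr S u' J K \<Longrightarrow> small_fctr S v K L \<Longrightarrow> small_fctr S v' K L \<Longrightarrow>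
   is_ntrans a u u' \<Longrightarrow> is_ntrans b v v' \<Longrightarrow> DNat D (b \<star> a) = DNat D a \<star> DNat D b"
  using D[unfolded derivator_def prederivator_def, THEN conjunct1, THEN conjunct2, THEN conjunct2, THEN conjunct2, THEN conjunct2, THEN conjunct2, THEN conjunct2, THEN conjunct2, rule_format] .

lemma DNat_id_apply:
  "small_fctr S u J K \<Longrightarrow> x \<in> Obj (DCat D K) \<Longrightarrow>
     NMap (DNat D (id_ntrans u)) x = Id (DCat D J) (FObj (DFun D u) x)"
  using DNat_id NMap_id[OF DFun_fctr] by simp

text \<open>
  The 2-functor turns around composition of functors: whiskering with \<open>q\<close> on the left becomes
  evaluation at \<open>q\<^sup>* x\<close>, and whiskering on the right becomes application of \<open>q\<^sup>*\<close>.
\<close>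

lemma DNat_whisker_left:
  assumes a: "is_ntrans a u u'" and s: "small_fctr S u J K" "small_fctr S u' J K" "small_fctr S q K L"
    and x: "x \<in> Obj (DCat D L)"
  shows "NMap (DNat D (id_ntrans q \<star> a)) x = NMap (DNat D a) (FObj (DFun D q) x)"
proof -
  have "is_fctr q K L" using s by (simp add: small_fctr_def)
  from DNat_hcomp[OF s(1,2,3,3) a is_ntrans_id[OF this]]
  show ?thesis unfolding DNat_id[OF s(3)]
    using is_ntrans_hcomp_id_right(2)[OF DNat_ntrans[OF s(1,2) a] DFun_fctr[OF s(1)] DFun_fctr[OF s(3)] x]
    by simp
qed

lemma DNat_whisker_right:
  assumes a: "is_ntrans a u u'" and s: "small_fctr S u J K" "small_fctr S u' J K" "small_fctr S q L J"
    and x: "x \<in> Obj (DCat D K)"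
  shows "NMap (DNat D (a \<star> id_ntrans q)) x = FArr (DFun D q) (NMap (DNat D a) x)"
proof -
  have "is_fctr q L J" using s by (simp add: small_fctr_def)
  from DNat_hcomp[OF s(3,3,1,2) is_ntrans_id[OF this] a]
  show ?thesis unfolding DNat_id[OF s(3)]
    using is_ntrans_hcomp_id_left(2)[OF DNat_ntrans[OF s(1,2) a] DFun_fctr[OF s(1)] DFun_fctr[OF s(3)] x]
    by simp
qed

lemma conservative:
  assumes J: "small_cat S J" and f: "f \<in> Arr (DCat D J)"
    and i: "\<And>j. j \<in> Obj J \<Longrightarrow> iso_arr (DCat D e\<^sub>c) (FArr (DFun D (obj_fctr J j)) f)"
  shows "iso_arr (DCat D J) f"
  using D J f i unfolding derivator_def Der2_def by blast

lemma small_pt: "small_cat S e\<^sub>c" by (rule small_ord_cat[OF S])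

lemma small_obj: "small_cat S K \<Longrightarrow> k \<in> Obj K \<Longrightarrow> small_fctr S (obj_fctr K k) e\<^sub>c K"
  using is_fctr_obj small_pt by (auto simp: small_fctr_def small_cat_def)

lemma small_to_pt: "small_cat S J \<Longrightarrow> small_fctr S (to_pt J) J e\<^sub>c"
  using is_fctr_to_pt small_pt by (auto simp: small_fctr_def small_cat_def)

lemma small_over_proj: "small_fctr S u J K \<Longrightarrow> small_fctr S (over_proj u k) (over_cat u k) J"
  and small_under_proj: "small_fctr S u J K \<Longrightarrow> small_fctr S (under_proj u k) (under_cat u k) J"
  using small_over_under[OF S] over_cat_facts(6) under_cat_facts(6) by (auto simp: small_fctr_def)

lemma to_pt_comp_obj:
  fixes J :: "'v scat"
  assumes J: "category J" and j: "j \<in> Obj J"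
  shows "to_pt J \<circ>\<^sub>F obj_fctr J j = id_fctr e\<^sub>c"
proof -
  have e: "category (e\<^sub>c :: 'v scat)" using small_pt by (simp add: small_cat_def)
  have i: "Id J j \<in> Arr J" using id_hom[OF J j] homD by fast
  show ?thesis
    by (rule fctr_eqI[OF is_fctr_comp[OF is_fctr_obj[OF J j] is_fctr_to_pt[OF J]] is_fctr_id[OF e]])
      (auto simp: comp_fctr_simps[OF is_fctr_obj[OF J j]],
       auto simp: to_pt_def obj_fctr_def j i, auto simp: ord_cat_def)
qed

section \<open>Kan extensions computed by slices\<close>

lemma kan_left:
  assumes u: "small_fctr S u J K"
  obtains L \<eta> \<epsilon> where "adjunction L (DFun D u) \<eta> \<epsilon>" "is_fctr L (DCat D J) (DCat D K)"
proof -
  obtain L \<eta> \<epsilon> where a: "adjunction L (DFun D u) \<eta> \<epsilon>"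
    using D u unfolding derivator_def Der3_def is_lan_def by metis
  have "FDom (DFun D u) = DCat D K" "FCod (DFun D u) = DCat D J"
    using fctr_cats[OF DFun_fctr[OF u]] by auto
  then show thesis using that a adjunction_fctr[OF a] adjunctionD(1)[OF a adjunction_fctr[OF a]] fctr_cats
    by metis
qed

lemma kan_right:
  assumes u: "small_fctr S u J K"
  obtains R \<eta> \<epsilon> where "adjunction (DFun D u) R \<eta> \<epsilon>" "is_fctr R (DCat D J) (DCat D K)"
proof -
  obtain R \<eta> \<epsilon> where a: "adjunction (DFun D u) R \<eta> \<epsilon>"
    using D u unfolding derivator_def Der3_def is_ran_def by metis
  then show thesis using that adjunctionD(1)[OF a DFun_fctr[OF u]] by blast
qed

lemma over_comparison_hom:
  assumes u: "small_fctr S u J K" and k: "k \<in> Obj K"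
  shows "v \<in> Obj (DCat D K) \<Longrightarrow> NMap (DNat D (over_nt u k)) v \<in> hom (DCat D (over_cat u k))
        (FObj (DFun D (over_proj u k)) (FObj (DFun D u) v))
        (FObj (DFun D (to_pt (over_cat u k))) (FObj (DFun D (obj_fctr K k)) v))"
    and "f \<in> hom (DCat D K) v w \<Longrightarrow>
      Comp (DCat D (over_cat u k)) (FArr (DFun D (to_pt (over_cat u k))) (FArr (DFun D (obj_fctr K k)) f))
        (NMap (DNat D (over_nt u k)) v) =
      Comp (DCat D (over_cat u k)) (NMap (DNat D (over_nt u k)) w)
        (FArr (DFun D (over_proj u k)) (FArr (DFun D u) f))"
    and "is_ntrans (DNat D (over_nt u k)) (DFun D (u \<circ>\<^sub>F over_proj u k))
       (DFun D (obj_fctr K k \<circ>\<^sub>F to_pt (over_cat u k)))"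
proof -
  have uf: "is_fctr u J K" and K: "small_cat S K" using small_cats[OF u] by auto
  note s = small_over_proj[OF u, of k] small_obj[OF K k] small_to_pt[OF small_over_under(1)[OF S u], of k]
  note sc = small_comp[OF s(1) u] small_comp[OF s(3) s(2)]
  show n: "is_ntrans (DNat D (over_nt u k)) (DFun D (u \<circ>\<^sub>F over_proj u k))
       (DFun D (obj_fctr K k \<circ>\<^sub>F to_pt (over_cat u k)))"
    by (rule DNat_ntrans[OF sc over_nt_is_ntrans(1)[OF uf k]])
  note c = DFun_comp_apply[OF s(1) u] DFun_comp_apply[OF s(3) s(2)]
  show "v \<in> Obj (DCat D K) \<Longrightarrow> NMap (DNat D (over_nt u k)) v \<in> hom (DCat D (over_cat u k))
        (FObj (DFun D (over_proj u k)) (FObj (DFun D u) v))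
        (FObj (DFun D (to_pt (over_cat u k))) (FObj (DFun D (obj_fctr K k)) v))"
    using ntrans_hom[OF n DFun_fctr[OF sc(1)], of v] by (simp add: c)
  show "f \<in> hom (DCat D K) v w \<Longrightarrow>
      Comp (DCat D (over_cat u k)) (FArr (DFun D (to_pt (over_cat u k))) (FArr (DFun D (obj_fctr K k)) f))
        (NMap (DNat D (over_nt u k)) v) =
      Comp (DCat D (over_cat u k)) (NMap (DNat D (over_nt u k)) w)
        (FArr (DFun D (over_proj u k)) (FArr (DFun D u) f))"
    using ntrans_nat[OF n DFun_fctr[OF sc(1)], of f v w] homD[of f "DCat D K" v w] by (simp add: c)
qed

lemma under_comparison_hom:
  assumes u: "small_fctr S u J K" and k: "k \<in> Obj K"
  shows "v \<in> Obj (DCat D K) \<Longrightarrow> NMap (DNat D (under_nt u k)) v \<in> hom (DCat D (under_cat u k))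
        (FObj (DFun D (to_pt (under_cat u k))) (FObj (DFun D (obj_fctr K k)) v))
        (FObj (DFun D (under_proj u k)) (FObj (DFun D u) v))"
    and "f \<in> hom (DCat D K) v w \<Longrightarrow>
      Comp (DCat D (under_cat u k)) (FArr (DFun D (under_proj u k)) (FArr (DFun D u) f))
        (NMap (DNat D (under_nt u k)) v) =
      Comp (DCat D (under_cat u k)) (NMap (DNat D (under_nt u k)) w)
        (FArr (DFun D (to_pt (under_cat u k))) (FArr (DFun D (obj_fctr K k)) f))"
    and "is_ntrans (DNat D (under_nt u k)) (DFun D (obj_fctr K k \<circ>\<^sub>F to_pt (under_cat u k)))
      (DFun D (u \<circ>\<^sub>F under_proj u k))"
proof -
  have uf: "is_fctr u J K" and K: "small_cat S K" using small_cats[OF u] by auto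
  note s = small_under_proj[OF u, of k] small_obj[OF K k] small_to_pt[OF small_over_under(2)[OF S u], of k]
  note sc = small_comp[OF s(1) u] small_comp[OF s(3) s(2)]
  show n: "is_ntrans (DNat D (under_nt u k)) (DFun D (obj_fctr K k \<circ>\<^sub>F to_pt (under_cat u k)))
      (DFun D (u \<circ>\<^sub>F under_proj u k))"
    by (rule DNat_ntrans[OF sc(2,1) under_nt_is_ntrans(1)[OF uf k]])
  note c = DFun_comp_apply[OF s(1) u] DFun_comp_apply[OF s(3) s(2)]
  show "v \<in> Obj (DCat D K) \<Longrightarrow> NMap (DNat D (under_nt u k)) v \<in> hom (DCat D (under_cat u k))
        (FObj (DFun D (to_pt (under_cat u k))) (FObj (DFun D (obj_fctr K k)) v))
        (FObj (DFun D (under_proj u k)) (FObj (DFun D u) v))"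
    using ntrans_hom[OF n DFun_fctr[OF sc(2)], of v] by (simp add: c)
  show "f \<in> hom (DCat D K) v w \<Longrightarrow>
      Comp (DCat D (under_cat u k)) (FArr (DFun D (under_proj u k)) (FArr (DFun D u) f))
        (NMap (DNat D (under_nt u k)) v) =
      Comp (DCat D (under_cat u k)) (NMap (DNat D (under_nt u k)) w)
        (FArr (DFun D (to_pt (under_cat u k))) (FArr (DFun D (obj_fctr K k)) f))"
    using ntrans_nat[OF n DFun_fctr[OF sc(2)], of f v w] homD[of f "DCat D K" v w] by (simp add: c)
qed

text \<open>
  The canonical map of Der4 at \<open>y\<close> is the transpose, under \<open>p\<^sub>!\<close> and \<open>p\<^sup>*\<close>, of the map that is
  claimed to be universal.
\<close>

lemma Der4_left:
  assumes u: "small_fctr S u J K" and k: "k \<in> Obj K"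
    and a: "adjunction L (DFun D u) \<eta> \<epsilon>" and L: "is_fctr L (DCat D J) (DCat D K)"
    and y: "y \<in> Obj (DCat D J)"
  shows "universal (DFun D (to_pt (over_cat u k))) (FObj (DFun D (over_proj u k)) y)
     (FObj (DFun D (obj_fctr K k)) (FObj L y))
     (Comp (DCat D (over_cat u k)) (NMap (DNat D (over_nt u k)) (FObj L y))
        (FArr (DFun D (over_proj u k)) (NMap \<eta> y)))"
proof -
  have K: "small_cat S K" using small_cats[OF u] by auto
  let ?O = "over_cat u k" let ?k = "DFun D (obj_fctr K k)" let ?pr = "DFun D (over_proj u k)"
  let ?p = "to_pt ?O" let ?\<alpha> = "DNat D (over_nt u k)"
  note sO = small_over_under(1)[OF S u, of k]
  note pr = DFun_fctr[OF small_over_proj[OF u, of k]] and kf = DFun_fctr[OF small_obj[OF K k]]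
  note al = over_comparison_hom[OF u k]
  obtain pL \<eta>p \<epsilon>p where p: "adjunction pL (DFun D ?p) \<eta>p \<epsilon>p"
    and pL: "is_fctr pL (DCat D ?O) (DCat D e\<^sub>c)"
    using kan_left[OF small_to_pt[OF sO]] .
  note Ly = fctr_obj[OF L y]
  let ?m = "Comp (DCat D ?O) (NMap ?\<alpha> (FObj L y)) (FArr ?pr (NMap \<eta> y))"
  note d = adjunctionD[OF a L]
  note e = d(2)[OF y]
  have cO: "category (DCat D ?O)" and cE: "category (DCat D e\<^sub>c)" using fctr_cats[OF pL] by auto
  have m: "?m \<in> hom (DCat D ?O) (FObj ?pr y) (FObj (DFun D ?p) (FObj ?k (FObj L y)))"
    by (rule comp_hom[OF cO fctr_hom[OF pr e] al(1)[OF Ly]])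
  let ?\<beta> = "(\<epsilon>p \<rhd> (?k \<circ>\<^sub>F L)) \<bullet> (pL \<lhd> ?\<alpha> \<rhd> L) \<bullet> ((pL \<circ>\<^sub>F ?pr) \<lhd> \<eta>)"
  have "nat_iso ?\<beta> (pL \<circ>\<^sub>F ?pr) (?k \<circ>\<^sub>F L)"
    using D u k a p unfolding derivator_def Der4_def is_lan_def Let_def by blast
  then have "iso_arr (DCat D e\<^sub>c) (NMap ?\<beta> y)"
    using y fctr_cats[OF pL] fctr_cats[OF pr] by (simp add: nat_iso_def comp_fctr_def)
  moreover have "NMap ?\<beta> y = Comp (DCat D e\<^sub>c)
      (Comp (DCat D e\<^sub>c) (NMap \<epsilon>p (FObj ?k (FObj L y))) (FArr pL (NMap ?\<alpha> (FObj L y))))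
      (FArr pL (FArr ?pr (NMap \<eta> y)))"
  proof -
    have "NSrc \<eta> = id_fctr (DCat D J)" "NSrc \<epsilon>p = pL \<circ>\<^sub>F DFun D ?p"
      using a p fctr_cats[OF L] by (auto simp: adjunction_def is_ntrans_def)
    moreover have "NMap \<eta> y \<in> Arr (DCat D J)" using homD[OF e] by blast
    moreover have "NSrc ?\<alpha> = DFun D (u \<circ>\<^sub>F over_proj u k)" using al(3) by (simp add: is_ntrans_def)
    moreover note fctr_cats[OF L] fctr_cats[OF pL] fctr_cats[OF pr] fctr_cats[OF kf] d(1)
    ultimately show ?thesis using y Ly fctr_obj[OF kf Ly]
      by (simp add: vcomp_def rwhisk_def lwhisk_def mk_ntrans_def comp_fctr_def mk_fctr_def id_fctr_def)
  qed
  \<comment> \<open>apart from the counit all factors are images under \<open>p\<^sub>!\<close>, so the composite is the transpose of \<open>?m\<close>\<close>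
  moreover have "\<dots> = Comp (DCat D e\<^sub>c) (NMap \<epsilon>p (FObj ?k (FObj L y))) (FArr pL ?m)"
    using fctr_comp[OF pL fctr_hom[OF pr e] al(1)[OF Ly]]
      comp_assoc[OF cE fctr_hom[OF pL fctr_hom[OF pr e]] fctr_hom[OF pL al(1)[OF Ly]]
        adjunctionD(4)[OF p pL fctr_obj[OF kf Ly]]] by simp
  ultimately have "iso_arr (DCat D e\<^sub>c) (Comp (DCat D e\<^sub>c) (NMap \<epsilon>p (FObj ?k (FObj L y))) (FArr pL ?m))"
    by simp
  then show ?thesis by (rule iso_transpose_universal[OF p pL m fctr_obj[OF kf Ly]])
qed

lemma Der4_right:
  assumes u: "small_fctr S u J K" and k: "k \<in> Obj K"
    and a: "adjunction (DFun D u) R \<eta> \<epsilon>" and y: "y \<in> Obj (DCat D J)"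
  shows "universal (op_fctr (DFun D (to_pt (under_cat u k)))) (FObj (DFun D (under_proj u k)) y)
     (FObj (DFun D (obj_fctr K k)) (FObj R y))
     (Comp (DCat D (under_cat u k)) (FArr (DFun D (under_proj u k)) (NMap \<epsilon> y))
       (NMap (DNat D (under_nt u k)) (FObj R y)))"
proof -
  have K: "small_cat S K" using small_cats[OF u] by auto
  let ?O = "under_cat u k" let ?k = "DFun D (obj_fctr K k)" let ?pr = "DFun D (under_proj u k)"
  let ?p = "to_pt ?O" let ?\<alpha> = "DNat D (under_nt u k)"
  note sO = small_over_under(2)[OF S u, of k]
  note uf = DFun_fctr[OF u] and pf = DFun_fctr[OF small_to_pt[OF sO]]
  note pr = DFun_fctr[OF small_under_proj[OF u, of k]] and kf = DFun_fctr[OF small_obj[OF K k]]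
  note al = under_comparison_hom[OF u k]
  obtain pR \<eta>p \<epsilon>p where p: "adjunction (DFun D ?p) pR \<eta>p \<epsilon>p"
    and pR: "is_fctr pR (DCat D ?O) (DCat D e\<^sub>c)"
    using kan_right[OF small_to_pt[OF sO]] .
  note d = adjunctionD[OF a uf]
  note R = d(1)
  note Ry = fctr_obj[OF R y]
  let ?m = "Comp (DCat D ?O) (FArr ?pr (NMap \<epsilon> y)) (NMap ?\<alpha> (FObj R y))"
  note e = d(4)[OF y]
  have cO: "category (DCat D ?O)" and cE: "category (DCat D e\<^sub>c)" using fctr_cats[OF pR] by auto
  have m: "?m \<in> hom (DCat D ?O) (FObj (DFun D ?p) (FObj ?k (FObj R y))) (FObj ?pr y)"
    by (rule comp_hom[OF cO al(1)[OF Ry] fctr_hom[OF pr e]])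
  let ?\<beta> = "((pR \<circ>\<^sub>F ?pr) \<lhd> \<epsilon>) \<bullet> (pR \<lhd> ?\<alpha> \<rhd> R) \<bullet> (\<eta>p \<rhd> (?k \<circ>\<^sub>F R))"
  have "nat_iso ?\<beta> (?k \<circ>\<^sub>F R) (pR \<circ>\<^sub>F ?pr)"
    using D u k a p unfolding derivator_def Der4_def is_ran_def Let_def by blast
  then have "iso_arr (DCat D e\<^sub>c) (NMap ?\<beta> y)"
    using y fctr_cats[OF R] fctr_cats[OF kf] by (simp add: nat_iso_def comp_fctr_def)
  moreover have "NMap ?\<beta> y = Comp (DCat D e\<^sub>c)
      (Comp (DCat D e\<^sub>c) (FArr pR (FArr ?pr (NMap \<epsilon> y))) (FArr pR (NMap ?\<alpha> (FObj R y))))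
      (NMap \<eta>p (FObj ?k (FObj R y)))"
  proof -
    have "NSrc \<epsilon> = DFun D u \<circ>\<^sub>F R" "NSrc \<eta>p = id_fctr (DCat D e\<^sub>c)"
      using a p fctr_cats[OF pf] by (auto simp: adjunction_def is_ntrans_def)
    moreover have "NMap \<epsilon> y \<in> Arr (DCat D J)" using homD[OF e] by blast
    moreover have "NSrc ?\<alpha> = DFun D (obj_fctr K k \<circ>\<^sub>F ?p)" using al(3) by (simp add: is_ntrans_def)
    moreover note fctr_cats[OF R] fctr_cats[OF pR] fctr_cats[OF pr] fctr_cats[OF kf] fctr_cats[OF uf]
      fctr_cats[OF DFun_fctr[OF small_comp[OF small_to_pt[OF sO] small_obj[OF K k]]]]
    ultimately show ?thesis using y Ry fctr_obj[OF kf Ry]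
      by (simp add: vcomp_def rwhisk_def lwhisk_def mk_ntrans_def comp_fctr_def mk_fctr_def id_fctr_def)
  qed
  moreover have "\<dots> = Comp (DCat D e\<^sub>c) (FArr pR ?m) (NMap \<eta>p (FObj ?k (FObj R y)))"
    using fctr_comp[OF pR al(1)[OF Ry] fctr_hom[OF pr e]] by simp
  ultimately have "iso_arr (DCat D e\<^sub>c) (Comp (DCat D e\<^sub>c) (FArr pR ?m) (NMap \<eta>p (FObj ?k (FObj R y))))"
    by simp
  then show ?thesis by (rule iso_transpose_couniversal[OF p pf m fctr_obj[OF kf Ry]])
qed

lemma pointwise_left:
  assumes u: "small_fctr S u J K"
  shows "pointwise_extension (DCat D K) (DCat D J) (DCat D e\<^sub>c) (Obj K) (DFun D u)
     (\<lambda>k. DFun D (obj_fctr K k)) (\<lambda>k. DFun D (over_proj u k)) (\<lambda>k. DFun D (to_pt (over_cat u k)))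
     (\<lambda>k. DCat D (over_cat u k)) (\<lambda>k. NMap (DNat D (over_nt u k)))"
proof
  have K: "small_cat S K" using small_cats[OF u] by auto
  show "is_fctr (DFun D u) (DCat D K) (DCat D J)" by (rule DFun_fctr[OF u])
  fix k assume k: "k \<in> Obj K"
  show "is_fctr (DFun D (obj_fctr K k)) (DCat D K) (DCat D e\<^sub>c)"
    by (rule DFun_fctr[OF small_obj[OF K k]])
  show "is_fctr (DFun D (over_proj u k)) (DCat D J) (DCat D (over_cat u k))"
    by (rule DFun_fctr[OF small_over_proj[OF u]])
  show "is_fctr (DFun D (to_pt (over_cat u k))) (DCat D e\<^sub>c) (DCat D (over_cat u k))"
    by (rule DFun_fctr[OF small_to_pt[OF small_over_under(1)[OF S u]]])
next
  fix y assume y: "y \<in> Obj (DCat D J)"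
  obtain L \<eta> \<epsilon> where a: "adjunction L (DFun D u) \<eta> \<epsilon>" "is_fctr L (DCat D J) (DCat D K)"
    using kan_left[OF u] .
  have "universal (DFun D u) y (FObj L y) (NMap \<eta> y)"
    using adjunction_universal[OF a(1)] y fctr_cats[OF a(2)] by simp
  with Der4_left[OF u _ a y]
  show "\<exists>v m. universal (DFun D u) y v m \<and>
      (\<forall>k\<in>Obj K. universal (DFun D (to_pt (over_cat u k))) (FObj (DFun D (over_proj u k)) y)
         (FObj (DFun D (obj_fctr K k)) v)
         (Comp (DCat D (over_cat u k)) (NMap (DNat D (over_nt u k)) v) (FArr (DFun D (over_proj u k)) m)))"
    by blast
qed (use over_comparison_hom[OF u] conservative small_cats[OF u] in auto)

lemma pointwise_right:
  assumes u: "small_fctr S u J K"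
  shows "pointwise_extension (op_cat (DCat D K)) (op_cat (DCat D J)) (op_cat (DCat D e\<^sub>c)) (Obj K)
     (op_fctr (DFun D u)) (\<lambda>k. op_fctr (DFun D (obj_fctr K k))) (\<lambda>k. op_fctr (DFun D (under_proj u k)))
     (\<lambda>k. op_fctr (DFun D (to_pt (under_cat u k)))) (\<lambda>k. op_cat (DCat D (under_cat u k)))
     (\<lambda>k. NMap (DNat D (under_nt u k)))"
proof
  have K: "small_cat S K" using small_cats[OF u] by auto
  show "is_fctr (op_fctr (DFun D u)) (op_cat (DCat D K)) (op_cat (DCat D J))"
    by (rule is_fctr_op[OF DFun_fctr[OF u]])
  fix k assume k: "k \<in> Obj K"
  show "is_fctr (op_fctr (DFun D (obj_fctr K k))) (op_cat (DCat D K)) (op_cat (DCat D e\<^sub>c))"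
    by (rule is_fctr_op[OF DFun_fctr[OF small_obj[OF K k]]])
  show "is_fctr (op_fctr (DFun D (under_proj u k))) (op_cat (DCat D J)) (op_cat (DCat D (under_cat u k)))"
    by (rule is_fctr_op[OF DFun_fctr[OF small_under_proj[OF u]]])
  show "is_fctr (op_fctr (DFun D (to_pt (under_cat u k)))) (op_cat (DCat D e\<^sub>c)) (op_cat (DCat D (under_cat u k)))"
    by (rule is_fctr_op[OF DFun_fctr[OF small_to_pt[OF small_over_under(2)[OF S u]]]])
next
  fix y assume "y \<in> Obj (op_cat (DCat D J))"
  then have y: "y \<in> Obj (DCat D J)" by simp
  obtain R \<eta> \<epsilon> where a: "adjunction (DFun D u) R \<eta> \<epsilon>" "is_fctr R (DCat D J) (DCat D K)"
    using kan_right[OF u] .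
  have "universal (op_fctr (DFun D u)) y (FObj R y) (NMap \<epsilon> y)"
    using adjunction_couniversal[OF a(1)] y fctr_cats[OF a(2)] by simp
  with Der4_right[OF u _ a(1) y]
  show "\<exists>v m. universal (op_fctr (DFun D u)) y v m \<and>
      (\<forall>k\<in>Obj K. universal (op_fctr (DFun D (to_pt (under_cat u k)))) (FObj (op_fctr (DFun D (under_proj u k))) y)
         (FObj (op_fctr (DFun D (obj_fctr K k))) v)
         (Comp (op_cat (DCat D (under_cat u k))) (NMap (DNat D (under_nt u k)) v)
           (FArr (op_fctr (DFun D (under_proj u k))) m)))"
    by auto
qed (use under_comparison_hom[OF u] conservative small_cats[OF u] in auto)

text \<open>
  A terminal or initial object \<open>t\<close> of a small category makes \<open>t\<^sup>*\<close> an adjoint of \<open>p\<^sup>*\<close> with \<open>t\<^sup>* p\<^sup>* = id\<close>.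
  The transformation \<open>n\<close> connects the identity with the constant functor \<open>t p\<close>, in either
  direction; what is shown are the triangle identities. They hold because \<open>n\<close> becomes an identity
  when it is restricted to \<open>t\<close> or projected to the terminal category.
\<close>

lemma contraction:
  assumes O: "small_cat S O'" and t: "t \<in> Obj O'"
    and n: "is_ntrans n (id_fctr O') (obj_fctr O' t \<circ>\<^sub>F to_pt O') \<or>
            is_ntrans n (obj_fctr O' t \<circ>\<^sub>F to_pt O') (id_fctr O')"
    and nt: "NMap n t = Id O' t"
  shows "z \<in> Obj (DCat D e\<^sub>c) \<Longrightarrow> FObj (DFun D (obj_fctr O' t)) (FObj (DFun D (to_pt O')) z) = z"
    and "f \<in> Arr (DCat D e\<^sub>c) \<Longrightarrow> FArr (DFun D (obj_fctr O' t)) (FArr (DFun D (to_pt O')) f) = f"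
    and "x \<in> Obj (DCat D O') \<Longrightarrow> FArr (DFun D (obj_fctr O' t)) (NMap (DNat D n) x) =
      Id (DCat D e\<^sub>c) (FObj (DFun D (obj_fctr O' t)) x)"
    and "z \<in> Obj (DCat D e\<^sub>c) \<Longrightarrow> NMap (DNat D n) (FObj (DFun D (to_pt O')) z) =
      Id (DCat D O') (FObj (DFun D (to_pt O')) z)"
proof -
  have c: "category O'" using O by (simp add: small_cat_def)
  note p = small_to_pt[OF O] and tf = small_obj[OF O t]
  note pf = is_fctr_to_pt[OF c] and tff = is_fctr_obj[OF c t]
  let ?tp = "obj_fctr O' t \<circ>\<^sub>F to_pt O'"
  note tpf = is_fctr_comp[OF pf tff]
  have "FObj ?tp t = t"
    using t by (simp add: comp_fctr_simps[OF pf]) (simp add: obj_fctr_def to_pt_def ord_cat_def)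
  then have e: "id_fctr O' \<circ>\<^sub>F obj_fctr O' t = obj_fctr O' t" "?tp \<circ>\<^sub>F obj_fctr O' t = obj_fctr O' t"
    using obj_fctr_comp[OF is_fctr_id[OF c] t] obj_fctr_comp[OF tpf t] t by simp_all
  \<comment> \<open>from here on the direction of \<open>n\<close> does not matter: both functors satisfy \<open>p F = p\<close> and \<open>F t = t\<close>\<close>
  obtain F G where n: "is_ntrans n F G" and FG: "small_fctr S F O' O'" "small_fctr S G O' O'"
    and Ft: "F \<circ>\<^sub>F obj_fctr O' t = obj_fctr O' t" "G \<circ>\<^sub>F obj_fctr O' t = obj_fctr O' t"
    using n e small_id[OF O] small_comp[OF p tf] by blast
  have Ff: "is_fctr F O' O'" "is_fctr G O' O'" using FG by (auto simp: small_fctr_def)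
  note h = is_ntrans_hcomp_id_left[OF n Ff(1) pf, unfolded to_pt_comp[OF Ff(1)] to_pt_comp[OF Ff(2)]]
  have np: "id_ntrans (to_pt O') \<star> n = id_ntrans (to_pt O')"
  proof (rule ntrans_eqI[OF h(1) is_ntrans_id[OF pf] pf])
    fix x assume x: "x \<in> Obj O'"
    have "NMap n x \<in> Arr O'" using homD[OF ntrans_hom[OF n Ff(1) x]] by blast
    then show "NMap (id_ntrans (to_pt O') \<star> n) x = NMap (id_ntrans (to_pt O')) x"
      using x by (simp add: h(2) NMap_id[OF pf]) (auto simp: to_pt_def ord_cat_def)
  qed
  note k = is_ntrans_hcomp_id_right[OF n Ff(1) tff, unfolded Ft]
  have nt: "n \<star> id_ntrans (obj_fctr O' t) = id_ntrans (obj_fctr O' t)"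
    by (rule ntrans_eqI[OF k(1) is_ntrans_id[OF tff] tff])
      (use nt in \<open>auto simp: k(2) NMap_id[OF tff] obj_fctr_apply\<close>)
  show "z \<in> Obj (DCat D e\<^sub>c) \<Longrightarrow> FObj (DFun D (obj_fctr O' t)) (FObj (DFun D (to_pt O')) z) = z"
    and "f \<in> Arr (DCat D e\<^sub>c) \<Longrightarrow> FArr (DFun D (obj_fctr O' t)) (FArr (DFun D (to_pt O')) f) = f"
    using DFun_comp_apply[OF tf p] by (simp_all add: to_pt_comp_obj[OF c t] DFun_id[OF small_pt])
  show "x \<in> Obj (DCat D O') \<Longrightarrow> FArr (DFun D (obj_fctr O' t)) (NMap (DNat D n) x) =
      Id (DCat D e\<^sub>c) (FObj (DFun D (obj_fctr O' t)) x)"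
    using DNat_whisker_right[OF n FG tf] DNat_id_apply[OF tf] by (simp add: nt)
  show "z \<in> Obj (DCat D e\<^sub>c) \<Longrightarrow> NMap (DNat D n) (FObj (DFun D (to_pt O')) z) =
      Id (DCat D O') (FObj (DFun D (to_pt O')) z)"
    using DNat_whisker_left[OF n FG p] DNat_id_apply[OF p] by (simp add: np)
qed

text \<open>
  The colimit over a category with a terminal object is the value at that object.
\<close>

lemma terminal_evaluation_iso:
  assumes O: "small_cat S O'" and t: "t \<in> Obj O'" and uniq: "\<And>x. x \<in> Obj O' \<Longrightarrow> \<exists>!f. f \<in> hom O' x t"
    and u: "universal (DFun D (to_pt O')) z v m"
  shows "iso_arr (DCat D e\<^sub>c) (FArr (DFun D (obj_fctr O' t)) m)"
proof -
  have c: "category O'" using O by (simp add: small_cat_def)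
  define \<tau> where "\<tau> = (\<lambda>x. THE f. f \<in> hom O' x t)"
  have \<tau>: "\<tau> x \<in> hom O' x t" if "x \<in> Obj O'" for x
    unfolding \<tau>_def using theI'[OF uniq[OF that]] .
  have eq: "f = g" if "f \<in> hom O' x t" "g \<in> hom O' x t" for f g x
    using uniq hom_obj[OF c that(1)] that by blast
  note p = small_to_pt[OF O] and tf = small_obj[OF O t]
  note pf = is_fctr_to_pt[OF c] and tff = is_fctr_obj[OF c t]
  let ?tp = "obj_fctr O' t \<circ>\<^sub>F to_pt O'"
  note tp = small_comp[OF p tf] and tpf = is_fctr_comp[OF pf tff] and idf = is_fctr_id[OF c]
  have tpo: "FObj ?tp x = t" if "x \<in> Obj O'" for x
    using that by (simp add: comp_fctr_simps[OF pf]) (auto simp: obj_fctr_def to_pt_def ord_cat_def)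
  have tpa: "FArr ?tp f = Id O' t" if "f \<in> Arr O'" for f
    using that by (simp add: comp_fctr_simps[OF pf]) (auto simp: obj_fctr_def to_pt_def ord_cat_def)
  let ?n = "mk_ntrans (id_fctr O') ?tp \<tau>"
  have n: "is_ntrans ?n (id_fctr O') ?tp"
  proof (rule is_ntrans_mk[OF idf tpf])
    show "\<tau> x \<in> hom O' (FObj (id_fctr O') x) (FObj ?tp x)" if "x \<in> Obj O'" for x
      using that \<tau> tpo by simp
    fix f x y assume f: "f \<in> hom O' x y"
    have o: "x \<in> Obj O'" "y \<in> Obj O'" "f \<in> Arr O'" using hom_obj[OF c f] homD[OF f] by auto
    show "Comp O' (FArr ?tp f) (\<tau> x) = Comp O' (\<tau> y) (FArr (id_fctr O') f)"
      using eq[OF \<tau>[OF o(1)] comp_hom[OF c f \<tau>[OF o(2)]]] tpa[OF o(3)] o id_comp[OF c \<tau>[OF o(1)]] by simp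
  qed
  \<comment> \<open>\<open>\<tau> t\<close> is the only endomorphism of \<open>t\<close>\<close>
  have "NMap ?n t = Id O' t" using NMap_mk[OF idf t] eq[OF \<tau>[OF t] id_hom[OF c t]] by simp
  note k = contraction[OF O t _ this]
  note si = small_id[OF O]
  let ?P = "DFun D (to_pt O')" let ?T = "DFun D (obj_fctr O' t)" let ?t = "NMap (DNat D ?n)"
  note P = DFun_fctr[OF p] and T = DFun_fctr[OF tf]
  note N = DNat_ntrans[OF si tp n, unfolded DFun_id[OF O]] and NS = is_fctr_id[OF DCat_category[OF O]]
  have "iso_arr (DCat D e\<^sub>c) (FArr ?T m)"
  proof (rule reflector_universal_iso[OF P T _ _ _ _ _ _ u, where t = ?t])
    show "?t x \<in> hom (DCat D O') x (FObj ?P (FObj ?T x))"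
      if "x \<in> Obj (DCat D O')" for x
      using ntrans_hom[OF N NS, of x] that by (simp add: DFun_comp_apply[OF p tf])
    show "Comp (DCat D O') (FArr ?P (FArr ?T f)) (?t x) = Comp (DCat D O') (?t y) f"
      if "f \<in> hom (DCat D O') x y" for x y f
      using ntrans_nat[OF N NS, of f x y] that homD[OF that]
      by (simp add: DFun_comp_apply[OF p tf])
  qed (use k n in simp_all)
  then show ?thesis by simp
qed

text \<open>
  The limit over a category with an initial object is the value at that object.
\<close>

lemma initial_evaluation_iso:
  assumes O: "small_cat S O'" and t: "t \<in> Obj O'" and uniq: "\<And>x. x \<in> Obj O' \<Longrightarrow> \<exists>!f. f \<in> hom O' t x"
    and u: "universal (op_fctr (DFun D (to_pt O'))) z v m"
  shows "iso_arr (DCat D e\<^sub>c) (FArr (DFun D (obj_fctr O' t)) m)"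
proof -
  have c: "category O'" using O by (simp add: small_cat_def)
  define \<tau> where "\<tau> = (\<lambda>x. THE f. f \<in> hom O' t x)"
  have \<tau>: "\<tau> x \<in> hom O' t x" if "x \<in> Obj O'" for x
    unfolding \<tau>_def using theI'[OF uniq[OF that]] .
  have eq: "f = g" if "f \<in> hom O' t x" "g \<in> hom O' t x" for f g x
    using uniq hom_obj[OF c that(1)] that by blast
  note p = small_to_pt[OF O] and tf = small_obj[OF O t]
  note pf = is_fctr_to_pt[OF c] and tff = is_fctr_obj[OF c t]
  let ?tp = "obj_fctr O' t \<circ>\<^sub>F to_pt O'"
  note tp = small_comp[OF p tf] and tpf = is_fctr_comp[OF pf tff] and idf = is_fctr_id[OF c]
  have tpo: "FObj ?tp x = t" if "x \<in> Obj O'" for x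
    using that by (simp add: comp_fctr_simps[OF pf]) (auto simp: obj_fctr_def to_pt_def ord_cat_def)
  have tpa: "FArr ?tp f = Id O' t" if "f \<in> Arr O'" for f
    using that by (simp add: comp_fctr_simps[OF pf]) (auto simp: obj_fctr_def to_pt_def ord_cat_def)
  let ?n = "mk_ntrans ?tp (id_fctr O') \<tau>"
  have n: "is_ntrans ?n ?tp (id_fctr O')"
  proof (rule is_ntrans_mk[OF tpf idf])
    show "\<tau> x \<in> hom O' (FObj ?tp x) (FObj (id_fctr O') x)" if "x \<in> Obj O'" for x
      using that \<tau> tpo by simp
    fix f x y assume f: "f \<in> hom O' x y"
    have o: "x \<in> Obj O'" "y \<in> Obj O'" "f \<in> Arr O'" using hom_obj[OF c f] homD[OF f] by auto
    show "Comp O' (FArr (id_fctr O') f) (\<tau> x) = Comp O' (\<tau> y) (FArr ?tp f)"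
      using eq[OF \<tau>[OF o(2)] comp_hom[OF c \<tau>[OF o(1)] f]] tpa[OF o(3)] o comp_id[OF c \<tau>[OF o(2)]] by simp
  qed
  have "NMap ?n t = Id O' t" using NMap_mk[OF tpf t] eq[OF \<tau>[OF t] id_hom[OF c t]] by simp
  note k = contraction[OF O t _ this]
  note si = small_id[OF O]
  let ?P = "DFun D (to_pt O')" let ?T = "DFun D (obj_fctr O' t)" let ?t = "NMap (DNat D ?n)"
  note P = DFun_fctr[OF p] and T = DFun_fctr[OF tf]
  note N = DNat_ntrans[OF tp si n, unfolded DFun_id[OF O]] and NS = DFun_fctr[OF tp]
  have "iso_arr (op_cat (DCat D e\<^sub>c)) (FArr (op_fctr ?T) m)"
  proof (rule reflector_universal_iso[OF is_fctr_op[OF P] is_fctr_op[OF T] _ _ _ _ _ _ u, where t = ?t])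
    show "?t x \<in> hom (op_cat (DCat D O')) x (FObj (op_fctr ?P) (FObj (op_fctr ?T) x))"
      if "x \<in> Obj (op_cat (DCat D O'))" for x
      using ntrans_hom[OF N NS, of x] that by (simp add: DFun_comp_apply[OF p tf])
    show "Comp (op_cat (DCat D O')) (FArr (op_fctr ?P) (FArr (op_fctr ?T) f)) (?t x) = Comp (op_cat (DCat D O')) (?t y) f"
      if "f \<in> hom (op_cat (DCat D O')) x y" for x y f
      using ntrans_nat[OF N NS, of f y x] that homD[OF that]
      by (simp add: DFun_comp_apply[OF p tf])
  qed (use k n in simp_all)
  then show ?thesis by simp
qed

section \<open>Kan extensions along full inclusions\<close>

text \<open>
  Applied to the slice at \<open>u j\<close> and its object \<open>t = (j, id)\<close>, with \<open>pr\<close> and \<open>\<alpha>\<close> the projection and the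
  transformation of the slice: restriction to \<open>t\<close> turns \<open>\<alpha>\<close> into an identity and \<open>pr\<^sup>*\<close> into
  evaluation at \<open>j\<close>.
\<close>

lemma evaluate_at_identity:
  assumes u: "small_fctr S u J K" and pr: "small_fctr S pr B J" and b: "small_cat S B" "t \<in> Obj B"
    and a: "is_ntrans \<alpha> (u \<circ>\<^sub>F pr) (obj_fctr K (FObj u j) \<circ>\<^sub>F to_pt B) \<or>
            is_ntrans \<alpha> (obj_fctr K (FObj u j) \<circ>\<^sub>F to_pt B) (u \<circ>\<^sub>F pr)"
    and t: "FObj pr t = j" "NMap \<alpha> t = Id K (FObj u j)"
  shows "v \<in> Obj (DCat D K) \<Longrightarrow> FArr (DFun D (obj_fctr B t)) (NMap (DNat D \<alpha>) v) =
      Id (DCat D e\<^sub>c) (FObj (DFun D (obj_fctr J j)) (FObj (DFun D u) v))"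
    and "m \<in> Arr (DCat D J) \<Longrightarrow> FArr (DFun D (obj_fctr B t)) (FArr (DFun D pr) m) = FArr (DFun D (obj_fctr J j)) m"
proof -
  have f: "is_fctr u J K" "is_fctr pr B J" and sK: "small_cat S J" "small_cat S K" and c: "category B"
    using u pr b by (auto simp: small_fctr_def small_cat_def)
  have j: "j \<in> Obj J" using fctr_obj[OF f(2) b(2)] t by simp
  note k = fctr_obj[OF f(1) j]
  note ob = small_obj[OF sK(2) k] and obJ = small_obj[OF sK(1) j] and ts = small_obj[OF b]
  note up = small_comp[OF pr u] and kp = small_comp[OF small_to_pt[OF b(1)] ob]
  have "FObj (u \<circ>\<^sub>F pr) t = FObj u j" using t comp_fctr_simps(3)[OF f(2) b(2), of u] by simp
  moreover have "FObj (obj_fctr K (FObj u j) \<circ>\<^sub>F to_pt B) t = FObj u j"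
    using comp_fctr_simps(3)[OF is_fctr_to_pt[OF c] b(2), of "obj_fctr K (FObj u j)"]
      fctr_obj[OF is_fctr_to_pt[OF c] b(2)] by (simp add: obj_fctr_apply)
  ultimately have e: "u \<circ>\<^sub>F pr \<circ>\<^sub>F obj_fctr B t = obj_fctr K (FObj u j)"
    "obj_fctr K (FObj u j) \<circ>\<^sub>F to_pt B \<circ>\<^sub>F obj_fctr B t = obj_fctr K (FObj u j)"
    using obj_fctr_comp[OF _ b(2), of "u \<circ>\<^sub>F pr" K] obj_fctr_comp[OF _ b(2), of "obj_fctr K (FObj u j) \<circ>\<^sub>F to_pt B" K]
      up kp by (simp_all add: small_fctr_def)
  obtain F G where n: "is_ntrans \<alpha> F G" and FG: "small_fctr S F B K" "small_fctr S G B K"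
    and Ft: "F \<circ>\<^sub>F obj_fctr B t = obj_fctr K (FObj u j)" "G \<circ>\<^sub>F obj_fctr B t = obj_fctr K (FObj u j)"
    using a e up kp by blast
  have Ff: "is_fctr F B K" and tf: "is_fctr (obj_fctr B t) e\<^sub>c B" and of: "is_fctr (obj_fctr K (FObj u j)) e\<^sub>c K"
    using FG ts ob by (auto simp: small_fctr_def)
  note h = is_ntrans_hcomp_id_right[OF n Ff tf, unfolded Ft]
  have "\<alpha> \<star> id_ntrans (obj_fctr B t) = id_ntrans (obj_fctr K (FObj u j))"
    by (rule ntrans_eqI[OF h(1) is_ntrans_id[OF of] of])
      (use t in \<open>auto simp: h(2) NMap_id[OF of] obj_fctr_apply\<close>)
  then show "v \<in> Obj (DCat D K) \<Longrightarrow> FArr (DFun D (obj_fctr B t)) (NMap (DNat D \<alpha>) v) =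
      Id (DCat D e\<^sub>c) (FObj (DFun D (obj_fctr J j)) (FObj (DFun D u) v))"
    using DNat_whisker_right[OF n FG ts, of v] DNat_id_apply[OF ob, of v]
      DFun_comp_apply(1)[OF obJ u, of v] obj_fctr_comp[OF f(1) j] by simp
  show "m \<in> Arr (DCat D J) \<Longrightarrow> FArr (DFun D (obj_fctr B t)) (FArr (DFun D pr) m) = FArr (DFun D (obj_fctr J j)) m"
    using DFun_comp_apply(2)[OF ts pr, of m] obj_fctr_comp[OF f(2) b(2)] t(1) by simp
qed

text \<open>
  Kan extension along a full inclusion has invertible unit. At an object \<open>j\<close> of the subcategory, the
  slice over \<open>j\<close> has the terminal object \<open>(j, id)\<close>, so evaluating there turns the universal arrow of
  \<open>pointwise\<close> into an isomorphism; but evaluated there it is just \<open>m\<close> at \<open>j\<close>.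
\<close>

lemma universal_left_iso:
  assumes K: "small_cat S K" and univ: "universal (DFun D (subcat_incl K A)) y v m"
  shows "iso_arr (DCat D (full_subcat K A)) m"
proof -
  let ?u = "subcat_incl K A" and ?J = "full_subcat K A"
  have c: "category K" using K by (simp add: small_cat_def)
  note u = small_subcat_incl[OF S K, of A] and uf = is_fctr_subcat_incl[OF c, of A]
  have J: "small_cat S ?J" and cJ: "category ?J" using small_full_subcat[OF S K] category_full_subcat[OF c] by auto
  interpret pw: pointwise_extension "DCat D K" "DCat D ?J" "DCat D e\<^sub>c" "Obj K" "DFun D ?u"
     "\<lambda>k. DFun D (obj_fctr K k)" "\<lambda>k. DFun D (over_proj ?u k)" "\<lambda>k. DFun D (to_pt (over_cat ?u k))"
     "\<lambda>k. DCat D (over_cat ?u k)" "\<lambda>k. NMap (DNat D (over_nt ?u k))"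
    by (rule pointwise_left[OF u])
  have v: "v \<in> Obj (DCat D K)" and m: "m \<in> hom (DCat D ?J) y (FObj (DFun D ?u) v)"
    using univ fctr_cats[OF DFun_fctr[OF u]] by (auto simp: universal_def)
  show ?thesis
  proof (rule conservative[OF J])
    show "m \<in> Arr (DCat D ?J)" using homD[OF m] by blast
    fix j assume jJ: "j \<in> Obj ?J"
    then have j: "j \<in> Obj K" "j \<in> A" by (auto simp: full_subcat_simps)
    let ?O = "over_cat ?u j" and ?t = "Pr j (Id K j)"
    note sO = small_over_under(1)[OF S u, of j]
    note o = over_cat_facts[OF uf, where k = j]
    have uj: "FObj ?u j = j" using subcat_incl_simps(1)[OF j] .
    have t: "?t \<in> Obj ?O" using jJ id_hom[OF c j(1)] by (auto simp: o(2) uj)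
    have fin: "\<exists>!f. f \<in> hom ?O x ?t" if x: "x \<in> Obj ?O" for x
    proof -
      obtain i f where i: "x = Pr i f" "i \<in> Obj ?J" "f \<in> hom K i j"
        using x subcat_incl_simps(1)[of _ K A] by (auto simp: o(2) full_subcat_simps)
      have f: "f \<in> hom ?J i j" using i j by (auto simp: hom_full_subcat full_subcat_simps)
      have e: "Comp K (Id K j) (FArr ?u a) = a" if "a \<in> hom ?J i j" for a
        using subcat_incl_simps(2)[OF that] id_comp[OF c] that by (auto simp: hom_full_subcat)
      show ?thesis
        by (rule ex1I[of _ "Pr x (Pr ?t f)"]) (use x t f e in \<open>auto simp: o(3) i(1)\<close>)
    qed
    let ?pr = "DFun D (over_proj ?u j)" and ?T = "DFun D (obj_fctr ?O ?t)"
    let ?al = "NMap (DNat D (over_nt ?u j)) v"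
    note prs = small_over_proj[OF u, of j] and ts = small_obj[OF sO t] and obJ = small_obj[OF J jJ]
    note nt = over_nt_is_ntrans[OF uf j(1)]
    have tO: "FObj (over_proj ?u j) ?t = j" "NMap (over_nt ?u j) ?t = Id K (FObj ?u j)"
      using t nt(2)[OF t] uj by (simp_all add: over_proj_def)
    have ev: "FArr ?T ?al = Id (DCat D e\<^sub>c) (FObj (DFun D (obj_fctr ?J j)) (FObj (DFun D ?u) v))"
      "FArr ?T (FArr ?pr m) = FArr (DFun D (obj_fctr ?J j)) m"
      using evaluate_at_identity(1)[OF u prs sO t _ tO, of v] evaluate_at_identity(2)[OF u prs sO t _ tO, of m] nt(1) v homD[OF m] uj by simp_all
    have "iso_arr (DCat D e\<^sub>c) (FArr ?T (Comp (DCat D ?O) ?al (FArr ?pr m)))"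
      by (rule terminal_evaluation_iso[OF sO t fin pw.pointwise[OF univ j(1)]])
    moreover have "FArr ?T (Comp (DCat D ?O) ?al (FArr ?pr m)) = FArr (DFun D (obj_fctr ?J j)) m"
      using fctr_comp[OF DFun_fctr[OF ts] fctr_hom[OF DFun_fctr[OF prs] m] pw.al[OF j(1) v]] ev
        id_comp[OF DCat_category[OF small_pt] fctr_hom[OF DFun_fctr[OF obJ] m]] by simp
    ultimately show "iso_arr (DCat D e\<^sub>c) (FArr (DFun D (obj_fctr ?J j)) m)" by simp
  qed
qed

lemma universal_right_iso:
  assumes K: "small_cat S K" and univ: "universal (op_fctr (DFun D (subcat_incl K A))) y v m"
  shows "iso_arr (DCat D (full_subcat K A)) m"
proof -
  let ?u = "subcat_incl K A" and ?J = "full_subcat K A"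
  have c: "category K" using K by (simp add: small_cat_def)
  note u = small_subcat_incl[OF S K, of A] and uf = is_fctr_subcat_incl[OF c, of A]
  have J: "small_cat S ?J" and cJ: "category ?J" using small_full_subcat[OF S K] category_full_subcat[OF c] by auto
  interpret pw: pointwise_extension "op_cat (DCat D K)" "op_cat (DCat D ?J)" "op_cat (DCat D e\<^sub>c)" "Obj K"
     "op_fctr (DFun D ?u)"
     "\<lambda>k. op_fctr (DFun D (obj_fctr K k))" "\<lambda>k. op_fctr (DFun D (under_proj ?u k))"
     "\<lambda>k. op_fctr (DFun D (to_pt (under_cat ?u k)))"
     "\<lambda>k. op_cat (DCat D (under_cat ?u k))" "\<lambda>k. NMap (DNat D (under_nt ?u k))"
    by (rule pointwise_right[OF u])
  have v: "v \<in> Obj (DCat D K)" and m: "m \<in> hom (DCat D ?J) (FObj (DFun D ?u) v) y"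
    using univ fctr_cats[OF DFun_fctr[OF u]] by (auto simp: universal_def)
  show ?thesis
  proof (rule conservative[OF J])
    show "m \<in> Arr (DCat D ?J)" using homD[OF m] by blast
    fix j assume jJ: "j \<in> Obj ?J"
    then have j: "j \<in> Obj K" "j \<in> A" by (auto simp: full_subcat_simps)
    let ?O = "under_cat ?u j" and ?t = "Pr j (Id K j)"
    note sO = small_over_under(2)[OF S u, of j]
    note o = under_cat_facts[OF uf, where k = j]
    have uj: "FObj ?u j = j" using subcat_incl_simps(1)[OF j] .
    have t: "?t \<in> Obj ?O" using jJ id_hom[OF c j(1)] by (auto simp: o(2) uj)
    have init: "\<exists>!f. f \<in> hom ?O ?t x" if x: "x \<in> Obj ?O" for x
    proof -
      obtain i f where i: "x = Pr i f" "i \<in> Obj ?J" "f \<in> hom K j i"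
        using x subcat_incl_simps(1)[of _ K A] by (auto simp: o(2) full_subcat_simps)
      have f: "f \<in> hom ?J j i" using i j by (auto simp: hom_full_subcat full_subcat_simps)
      have e: "Comp K (FArr ?u a) (Id K j) = a" if "a \<in> hom ?J j i" for a
        using subcat_incl_simps(2)[OF that] comp_id[OF c] that by (auto simp: hom_full_subcat)
      show ?thesis
        by (rule ex1I[of _ "Pr ?t (Pr x f)"]) (use x t f e in \<open>auto simp: o(3) i(1)\<close>)
    qed
    let ?pr = "DFun D (under_proj ?u j)" and ?T = "DFun D (obj_fctr ?O ?t)"
    let ?al = "NMap (DNat D (under_nt ?u j)) v"
    note prs = small_under_proj[OF u, of j] and ts = small_obj[OF sO t] and obJ = small_obj[OF J jJ]
    note nt = under_nt_is_ntrans[OF uf j(1)]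
    have tO: "FObj (under_proj ?u j) ?t = j" "NMap (under_nt ?u j) ?t = Id K (FObj ?u j)"
      using t nt(2)[OF t] uj by (simp_all add: under_proj_def)
    have ev: "FArr ?T ?al = Id (DCat D e\<^sub>c) (FObj (DFun D (obj_fctr ?J j)) (FObj (DFun D ?u) v))"
      "FArr ?T (FArr ?pr m) = FArr (DFun D (obj_fctr ?J j)) m"
      using evaluate_at_identity(1)[OF u prs sO t _ tO, of v] evaluate_at_identity(2)[OF u prs sO t _ tO, of m] nt(1) v homD[OF m] uj by simp_all
    have "iso_arr (DCat D e\<^sub>c) (FArr ?T (Comp (DCat D ?O) (FArr ?pr m) ?al))"
      by (rule initial_evaluation_iso[OF sO t init]) (use pw.pointwise[OF univ j(1)] in simp_all)
    moreover have "FArr ?T (Comp (DCat D ?O) (FArr ?pr m) ?al) = FArr (DFun D (obj_fctr ?J j)) m"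
      using fctr_comp[OF DFun_fctr[OF ts] under_comparison_hom(1)[OF u j(1) v] fctr_hom[OF DFun_fctr[OF prs] m]] ev
        comp_id[OF DCat_category[OF small_pt] fctr_hom[OF DFun_fctr[OF obJ] m]] by simp
    ultimately show "iso_arr (DCat D e\<^sub>c) (FArr (DFun D (obj_fctr ?J j)) m)" by simp
  qed
qed

text \<open>
  By the pointwise criterion, being left extended is a condition at each \<open>k\<close> that only depends on the
  slice over \<open>k\<close>. For \<open>k\<close> in a sieve the slice does not change when everything is restricted to the
  sieve.
\<close>

lemma sieve_restriction:
  assumes K: "small_cat S K" and N: "\<And>f. f \<in> Arr K \<Longrightarrow> Cod K f \<in> N \<Longrightarrow> Dom K f \<in> N"
    and e: "left_extended (DFun D (subcat_incl K A)) V"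
  shows "left_extended (DFun D (subcat_incl (full_subcat K N) A)) (FObj (DFun D (subcat_incl K N)) V)"
proof -
  let ?K = "full_subcat K N" and ?u = "subcat_incl K A" and ?q = "subcat_incl K N"
  let ?v = "subcat_incl ?K A"
  have c: "category K" using K by (simp add: small_cat_def)
  have K': "small_cat S ?K" and c': "category ?K" using small_full_subcat[OF S K] category_full_subcat[OF c] by auto
  note u = small_subcat_incl[OF S K, of A] and q = small_subcat_incl[OF S K, of N]
    and v = small_subcat_incl[OF S K', of A]
  note pu = pointwise_extension.left_extended_iff[OF pointwise_left[OF u]]
    and pv = pointwise_extension.left_extended_iff[OF pointwise_left[OF v]]
  have V: "V \<in> Obj (DCat D K)" using e pu by blast
  show ?thesis unfolding pv
  proof (intro conjI ballI)
    show qV: "FObj (DFun D ?q) V \<in> Obj (DCat D ?K)" using fctr_obj[OF DFun_fctr[OF q] V] .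
    fix k assume kK: "k \<in> Obj ?K"
    then have k: "k \<in> Obj K" "k \<in> N" by (auto simp: full_subcat_simps)
    note si = over_sieve[OF c N k, where A = A]
    note prv = small_over_proj[OF v, of k] and pru = small_over_proj[OF u, of k]
    note pt = small_to_pt[OF small_over_under(1)[OF S v, of k]]
    have "universal (DFun D (to_pt (over_cat ?u k)))
        (FObj (DFun D (over_proj ?u k)) (FObj (DFun D ?u) V))
        (FObj (DFun D (obj_fctr K k)) V) (NMap (DNat D (over_nt ?u k)) V)"
      using e k pu by blast
    moreover have "FObj (DFun D (over_proj ?u k)) (FObj (DFun D ?u) V) =
        FObj (DFun D (over_proj ?v k)) (FObj (DFun D ?v) (FObj (DFun D ?q) V))"
      using DFun_comp_apply(1)[OF pru u V] DFun_comp_apply(1)[OF small_comp[OF prv v] q V]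
        DFun_comp_apply(1)[OF prv v qV] si(2) by simp
    moreover have "FObj (DFun D (obj_fctr K k)) V = FObj (DFun D (obj_fctr ?K k)) (FObj (DFun D ?q) V)"
      using DFun_comp_apply(1)[OF small_obj[OF K' kK] q V] subcat_incl_simps(1)[OF k]
        obj_fctr_comp[OF is_fctr_subcat_incl[OF c] kK] by simp
    moreover have "NMap (DNat D (over_nt ?u k)) V = NMap (DNat D (over_nt ?v k)) (FObj (DFun D ?q) V)"
      using DNat_whisker_left[OF over_nt_is_ntrans(1)[OF is_fctr_subcat_incl[OF c'] kK]
            small_comp[OF prv v] small_comp[OF pt small_obj[OF K' kK]] q V] si(3) by simp
    ultimately show "universal (DFun D (to_pt (over_cat ?v k)))
        (FObj (DFun D (over_proj ?v k)) (FObj (DFun D ?v) (FObj (DFun D ?q) V)))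
        (FObj (DFun D (obj_fctr ?K k)) (FObj (DFun D ?q) V)) (NMap (DNat D (over_nt ?v k)) (FObj (DFun D ?q) V))"
      using si(1) by simp
  qed
qed

lemma cosieve_restriction:
  assumes K: "small_cat S K" and N: "\<And>f. f \<in> Arr K \<Longrightarrow> Dom K f \<in> N \<Longrightarrow> Cod K f \<in> N"
    and e: "left_extended (op_fctr (DFun D (subcat_incl K A))) V"
  shows "left_extended (op_fctr (DFun D (subcat_incl (full_subcat K N) A))) (FObj (DFun D (subcat_incl K N)) V)"
proof -
  let ?K = "full_subcat K N" and ?u = "subcat_incl K A" and ?q = "subcat_incl K N"
  let ?v = "subcat_incl ?K A"
  have c: "category K" using K by (simp add: small_cat_def)
  have K': "small_cat S ?K" and c': "category ?K" using small_full_subcat[OF S K] category_full_subcat[OF c] by auto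
  note u = small_subcat_incl[OF S K, of A] and q = small_subcat_incl[OF S K, of N]
    and v = small_subcat_incl[OF S K', of A]
  note pu = pointwise_extension.left_extended_iff[OF pointwise_right[OF u], unfolded op_cat_simps op_fctr_simps]
    and pv = pointwise_extension.left_extended_iff[OF pointwise_right[OF v], unfolded op_cat_simps op_fctr_simps]
  have V: "V \<in> Obj (DCat D K)" using e pu by blast
  show ?thesis unfolding pv
  proof (intro conjI ballI)
    show qV: "FObj (DFun D ?q) V \<in> Obj (DCat D ?K)" using fctr_obj[OF DFun_fctr[OF q] V] .
    fix k assume kK: "k \<in> Obj ?K"
    then have k: "k \<in> Obj K" "k \<in> N" by (auto simp: full_subcat_simps)
    note si = under_cosieve[OF c N k, where A = A]
    note prv = small_under_proj[OF v, of k] and pru = small_under_proj[OF u, of k]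
    note pt = small_to_pt[OF small_over_under(2)[OF S v, of k]]
    have "universal (op_fctr (DFun D (to_pt (under_cat ?u k))))
        (FObj (DFun D (under_proj ?u k)) (FObj (DFun D ?u) V))
        (FObj (DFun D (obj_fctr K k)) V) (NMap (DNat D (under_nt ?u k)) V)"
      using e k pu by blast
    moreover have "FObj (DFun D (under_proj ?u k)) (FObj (DFun D ?u) V) =
        FObj (DFun D (under_proj ?v k)) (FObj (DFun D ?v) (FObj (DFun D ?q) V))"
      using DFun_comp_apply(1)[OF pru u V] DFun_comp_apply(1)[OF small_comp[OF prv v] q V]
        DFun_comp_apply(1)[OF prv v qV] si(2) by simp
    moreover have "FObj (DFun D (obj_fctr K k)) V = FObj (DFun D (obj_fctr ?K k)) (FObj (DFun D ?q) V)"
      using DFun_comp_apply(1)[OF small_obj[OF K' kK] q V] subcat_incl_simps(1)[OF k]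
        obj_fctr_comp[OF is_fctr_subcat_incl[OF c] kK] by simp
    moreover have "NMap (DNat D (under_nt ?u k)) V = NMap (DNat D (under_nt ?v k)) (FObj (DFun D ?q) V)"
      using DNat_whisker_left[OF under_nt_is_ntrans(1)[OF is_fctr_subcat_incl[OF c'] kK]
            small_comp[OF pt small_obj[OF K' kK]] small_comp[OF prv v] q V] si(3) by simp
    ultimately show "universal (op_fctr (DFun D (to_pt (under_cat ?v k))))
        (FObj (DFun D (under_proj ?v k)) (FObj (DFun D ?v) (FObj (DFun D ?q) V)))
        (FObj (DFun D (obj_fctr ?K k)) (FObj (DFun D ?q) V)) (NMap (DNat D (under_nt ?v k)) (FObj (DFun D ?q) V))"
      using si(1) by simp
  qed
qed

lemma coCartesian_iff_left_extended:
  assumes Y: "Y \<in> Obj (DCat D \<box>\<^sub>c)"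
  shows "coCartesian D Y \<longleftrightarrow> left_extended (DFun D i_ul) Y"
proof -
  have sq: "small_cat S (\<box>\<^sub>c :: 'v scat)" using small_sprod_cat[OF S] small_ord_cat[OF S] by blast
  note i = small_subcat_incl[OF S sq, of "{Pr (Num 0) (Num 0), Pr (Num 1) (Num 0), Pr (Num 0) (Num 1)}", folded i_ul_def]
  note f = DFun_fctr[OF i]
  have key: "Y \<in> ess_image L \<longleftrightarrow> left_extended (DFun D i_ul) Y" if a: "adjunction L (DFun D i_ul) \<eta> \<epsilon>" for L \<eta> \<epsilon>
  proof -
    have L: "is_fctr L (FDom L) (DCat D \<box>\<^sub>c)" using adjunction_fctr[OF a] fctr_cats[OF f] by simp
    have "FDom L = FCod (DFun D i_ul)" using adjunctionD(1)[OF a L] fctr_cats by metis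
    then have d: "FDom L = FCod (DFun D i_ul)" "FCod L = DCat D \<box>\<^sub>c" using fctr_cats[OF L] by auto
    have u: "universal (DFun D i_ul) y (FObj L y) (NMap \<eta> y) \<and> iso_arr (FCod (DFun D i_ul)) (NMap \<eta> y)"
      if "y \<in> Obj (FCod (DFun D i_ul))" for y
    proof -
      have "universal (DFun D i_ul) y (FObj L y) (NMap \<eta> y)" using adjunction_universal[OF a] that d by simp
      then show ?thesis
        using universal_left_iso[OF sq, of "{Pr (Num 0) (Num 0), Pr (Num 1) (Num 0), Pr (Num 0) (Num 1)}", folded i_ul_def]
          fctr_cats[OF f] by simp
    qed
    have "is_fctr (DFun D i_ul) (DCat D \<box>\<^sub>c) (FCod (DFun D i_ul))" using f fctr_cats[OF f] by simp
    from ess_image_left_extended[OF this Y u] show ?thesis using Y by (simp add: ess_image_def d)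
  qed
  then show ?thesis unfolding coCartesian_def is_lan_def using kan_left[OF i] by metis
qed

lemma Cartesian_iff_left_extended:
  assumes Y: "Y \<in> Obj (DCat D \<box>\<^sub>c)"
  shows "Cartesian D Y \<longleftrightarrow> left_extended (op_fctr (DFun D i_lr)) Y"
proof -
  have sq: "small_cat S (\<box>\<^sub>c :: 'v scat)" using small_sprod_cat[OF S] small_ord_cat[OF S] by blast
  note i = small_subcat_incl[OF S sq, of "{Pr (Num 1) (Num 0), Pr (Num 0) (Num 1), Pr (Num 1) (Num 1)}", folded i_lr_def]
  note f = DFun_fctr[OF i]
  have key: "Y \<in> ess_image R \<longleftrightarrow> left_extended (op_fctr (DFun D i_lr)) Y" if a: "adjunction (DFun D i_lr) R \<eta> \<epsilon>" for R \<eta> \<epsilon>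
  proof -
    note R = adjunctionD(1)[OF a f]
    have d: "FDom R = FCod (DFun D i_lr)" "FCod R = DCat D \<box>\<^sub>c" using fctr_cats[OF R] fctr_cats[OF f] by auto
    have u: "universal (op_fctr (DFun D i_lr)) y (FObj R y) (NMap \<epsilon> y) \<and>
        iso_arr (op_cat (FCod (DFun D i_lr))) (NMap \<epsilon> y)"
      if "y \<in> Obj (op_cat (FCod (DFun D i_lr)))" for y
    proof -
      have "universal (op_fctr (DFun D i_lr)) y (FObj R y) (NMap \<epsilon> y)"
        using adjunction_couniversal[OF a] that d by simp
      then show ?thesis
        using universal_right_iso[OF sq, of "{Pr (Num 1) (Num 0), Pr (Num 0) (Num 1), Pr (Num 1) (Num 1)}", folded i_lr_def]
          fctr_cats[OF f] by simp
    qed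
    have "is_fctr (op_fctr (DFun D i_lr)) (op_cat (DCat D \<box>\<^sub>c)) (op_cat (FCod (DFun D i_lr)))"
      using is_fctr_op[OF f] fctr_cats[OF f] by simp
    from ess_image_left_extended[OF this _ u] show ?thesis using Y by (simp add: ess_image_def d isomorphic_op)
  qed
  then show ?thesis unfolding Cartesian_def is_ran_def using kan_right[OF i] by metis
qed

end

section \<open>Diagrams on the subsets of a poset\<close>

text \<open>
  Subsets of one fixed poset stand for its full subposets, so that an inclusion is the identity
  function.
\<close>

definition mono_between ::
  "'k set \<Rightarrow> ('k \<Rightarrow> 'k \<Rightarrow> bool) \<Rightarrow> 'k set \<Rightarrow> 'k set \<Rightarrow> ('k \<Rightarrow> 'k) \<Rightarrow> bool" where
  "mono_between K le P Q h \<longleftrightarrow>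
     P \<subseteq> K \<and> Q \<subseteq> K \<and> h ` P \<subseteq> Q \<and> (\<forall>x\<in>P. \<forall>y\<in>P. le x y \<longrightarrow> le (h x) (h y))"

text \<open>
  \<open>E P\<close> is the category of diagrams on the subset \<open>P\<close> of \<open>K\<close>, and \<open>R P Q h\<close> is restriction along a monotone
  map \<open>h : P \<rightarrow> Q\<close>. The transformations between monotone maps are needed only for maps with
  \<open>x \<le> h x\<close>; they become identities where \<open>h\<close> does not move the points. The assumption \<open>replacement\<close>
  provides counits of Kan extension along \<open>A \<subseteq> P\<close>. All assumptions make sense for the opposite
  categories when the order is reversed.
\<close>

locale poset_diagrams =
  fixes K :: "'k set" and le :: "'k \<Rightarrow> 'k \<Rightarrow> bool" and E :: "'k set \<Rightarrow> ('o, 'a) cat"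
    and R :: "'k set \<Rightarrow> 'k set \<Rightarrow> ('k \<Rightarrow> 'k) \<Rightarrow> ('o, 'a, 'o, 'a) fctr"
  assumes R_fctr: "mono_between K le P Q h \<Longrightarrow> is_fctr (R P Q h) (E Q) (E P)"
    and R_id: "P \<subseteq> K \<Longrightarrow> R P P (\<lambda>x. x) = id_fctr (E P)"
    and R_comp: "mono_between K le P Q h \<Longrightarrow> mono_between K le Q W g \<Longrightarrow> R P W (\<lambda>x. g (h x)) = R P Q h \<circ>\<^sub>F R Q W g"
    and R_cong: "(\<And>x. x \<in> P \<Longrightarrow> h x = h' x) \<Longrightarrow> mono_between K le P Q h \<Longrightarrow> R P Q h = R P Q h'"
    and R_inflationary: "mono_between K le P P h \<Longrightarrow> (\<And>x. x \<in> P \<Longrightarrow> le x (h x)) \<Longrightarrow> X \<in> Obj (E P) \<Longrightarrow>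
      \<exists>t \<in> hom (E P) X (FObj (R P P h) X). \<forall>Q g. mono_between K le Q P g \<longrightarrow> (\<forall>x\<in>Q. h (g x) = g x) \<longrightarrow>
         FArr (R Q P g) t = Id (E Q) (FObj (R Q P g) X)"
    and E_conservative: "P \<subseteq> K \<Longrightarrow> f \<in> Arr (E P) \<Longrightarrow>
      (\<And>p. p \<in> P \<Longrightarrow> iso_arr (E {p}) (FArr (R {p} P (\<lambda>x. x)) f)) \<Longrightarrow> iso_arr (E P) f"
    and replacement: "A \<subseteq> P \<Longrightarrow> P \<subseteq> K \<Longrightarrow> V \<in> Obj (E P) \<Longrightarrow>
      \<exists>V' c. c \<in> hom (E P) V' V \<and> left_extended (R A P (\<lambda>x. x)) V' \<and> iso_arr (E A) (FArr (R A P (\<lambda>x. x)) c)"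
    and sieve: "A \<subseteq> P \<Longrightarrow> P \<subseteq> K \<Longrightarrow> N \<subseteq> P \<Longrightarrow> (\<And>x y. x \<in> N \<Longrightarrow> y \<in> P \<Longrightarrow> le y x \<Longrightarrow> y \<in> N) \<Longrightarrow>
      left_extended (R A P (\<lambda>x. x)) V \<Longrightarrow> left_extended (R (A \<inter> N) N (\<lambda>x. x)) (FObj (R N P (\<lambda>x. x)) V)"
begin

abbreviation mon where "mon \<equiv> mono_between K le"


lemma mon_incl: "P \<subseteq> Q \<Longrightarrow> Q \<subseteq> K \<Longrightarrow> mon P Q (\<lambda>x. x)"
  by (auto simp: mono_between_def)

lemma R_comp_apply:
  assumes "mon P Q h" "mon Q W g" "mon P W k" "\<forall>x\<in>P. k x = g (h x)"
  shows "X \<in> Obj (E W) \<Longrightarrow> FObj (R P Q h) (FObj (R Q W g) X) = FObj (R P W k) X"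
    and "f \<in> hom (E W) X Y \<Longrightarrow> FArr (R P Q h) (FArr (R Q W g) f) = FArr (R P W k) f"
proof -
  have "R P W k = R P Q h \<circ>\<^sub>F R Q W g"
    using R_cong[OF _ assms(3)] assms(4) R_comp[OF assms(1,2)] by metis
  then show "X \<in> Obj (E W) \<Longrightarrow> FObj (R P Q h) (FObj (R Q W g) X) = FObj (R P W k) X"
    "f \<in> hom (E W) X Y \<Longrightarrow> FArr (R P Q h) (FArr (R Q W g) f) = FArr (R P W k) f"
    using comp_fctr_simps[OF R_fctr[OF assms(2)], where G = "R P Q h"] by (auto simp: hom_def)
qed

text \<open>
  With \<open>t : X \<rightarrow> s\<^sup>* r\<^sup>* X\<close> the map given by \<open>x \<le> r (s x)\<close>, the assignment \<open>f \<mapsto> s\<^sup>* f \<circ> t\<close> identifies the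
  maps \<open>r\<^sup>* X \<rightarrow> Z\<close> with the maps \<open>X \<rightarrow> s\<^sup>* Z\<close>, with inverse \<open>r\<^sup>*\<close>. As \<open>r\<close> and \<open>s\<close> also restrict to maps
  between \<open>U\<close> and \<open>A\<close>, maps between the restrictions to \<open>U\<close> correspond to maps between the restrictions
  to \<open>A\<close> in the same way.
\<close>

lemma retract_left_extended:
  assumes r: "mon Q P r" and s: "mon P Q s" and sr: "\<And>x. x \<in> Q \<Longrightarrow> s (r x) = x"
    and infl: "\<And>x. x \<in> P \<Longrightarrow> le x (r (s x))"
    and A: "A \<subseteq> P" and U: "U \<subseteq> Q" and sA: "s ` A \<subseteq> U" and rU: "r ` U \<subseteq> A"
    and X: "left_extended (R A P (\<lambda>x. x)) X"
  shows "left_extended (R U Q (\<lambda>x. x)) (FObj (R Q P r) X)"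
proof -
  have K: "P \<subseteq> K" "Q \<subseteq> K" using r by (auto simp: mono_between_def)
  have rs: "mon P P (\<lambda>x. r (s x))" using r s by (auto simp: mono_between_def image_subset_iff)
  have a: "mon A P (\<lambda>x. x)" and i: "mon U Q (\<lambda>x. x)" using A U K mon_incl by auto
  have l: "mon A U s" and r': "mon U A r" using r s A U sA rU by (auto simp: mono_between_def subset_iff image_subset_iff)
  have UP: "mon U P r" and AQ: "mon A Q s" and QQ: "mon Q Q (\<lambda>x. x)" and UU: "mon U U (\<lambda>x. x)"
    using r s A U K by (auto simp: mono_between_def subset_iff image_subset_iff)
  let ?a = "R A P (\<lambda>x. x)" and ?i = "R U Q (\<lambda>x. x)" and ?r = "R Q P r" and ?s = "R P Q s"
    and ?l = "R A U s" and ?r' = "R U A r"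
  note af = R_fctr[OF a] and If = R_fctr[OF i] and rf = R_fctr[OF r] and sf = R_fctr[OF s]
    and lf = R_fctr[OF l] and r'f = R_fctr[OF r']
  note e1 = R_comp_apply[OF a s AQ ballI[OF refl]] and e2 = R_comp_apply[OF l i AQ ballI[OF refl]]
    and e3 = R_comp_apply[OF r' a UP ballI[OF refl]] and e4 = R_comp_apply[OF i r UP ballI[OF refl]]
    and e7 = R_comp_apply[OF s r rs ballI[OF refl]]
  have sr': "\<forall>x\<in>Q. x = s (r x)" "\<forall>x\<in>U. x = s (r x)" using sr U by auto
  note e5 = R_comp_apply[OF r s QQ sr'(1)] and e6 = R_comp_apply[OF r' l UU sr'(2)]
  have c: "category (E P)" "category (E Q)" "category (E U)" "category (E A)"
    using fctr_cats[OF rf] fctr_cats[OF lf] by auto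
  have Xo: "X \<in> Obj (E P)" using X fctr_cats[OF af] by (simp add: left_extended_def)
  let ?Y = "FObj ?r X"
  have Y: "?Y \<in> Obj (E Q)" using fctr_obj[OF rf Xo] .
  obtain t where t0: "t \<in> hom (E P) X (FObj (R P P (\<lambda>x. r (s x))) X)"
    and ti: "\<And>Q' g. mon Q' P g \<Longrightarrow> (\<And>x. x \<in> Q' \<Longrightarrow> r (s (g x)) = g x) \<Longrightarrow>
        FArr (R Q' P g) t = Id (E Q') (FObj (R Q' P g) X)"
    using R_inflationary[OF rs infl Xo] by blast
  have t: "t \<in> hom (E P) X (FObj ?s ?Y)" using t0 e7(1)[OF Xo] by simp
  have rt: "FArr ?r t = Id (E Q) ?Y" using ti[OF r] sr by simp
  have ut: "FArr (R U P r) t = Id (E U) (FObj (R U P r) X)" using ti[OF UP] sr U by (simp add: subset_iff)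
  have at: "FArr ?a t \<in> hom (E A) (FObj ?a X) (FObj ?l (FObj ?i ?Y))"
    using fctr_hom[OF af t] e1(1)[OF Y] e2(1)[OF Y] by simp
  have FD: "FDom ?i = E Q" "FCod ?i = E U" using fctr_cats[OF If] by auto
  show ?thesis unfolding left_extended_def FD
  proof (intro conjI ballI)
    show "?Y \<in> Obj (E Q)" by fact
    fix Z g assume Z: "Z \<in> Obj (E Q)" and g: "g \<in> hom (E U) (FObj ?i ?Y) (FObj ?i Z)"
    \<comment> \<open>\<open>g\<close> is moved from \<open>U\<close> to \<open>A\<close> by restriction along \<open>s\<close> and precomposed with \<open>t\<close>\<close>
    have lg: "FArr ?l g \<in> hom (E A) (FObj ?l (FObj ?i ?Y)) (FObj ?a (FObj ?s Z))"
      using fctr_hom[OF lf g] e1(1)[OF Z] e2(1)[OF Z] by simp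
    obtain h where h: "h \<in> hom (E P) X (FObj ?s Z)" "FArr ?a h = Comp (E A) (FArr ?l g) (FArr ?a t)"
      using left_extended_lift[OF af X fctr_obj[OF sf Z] comp_hom[OF c(4) at lg]] .
    have f: "FArr ?r h \<in> hom (E Q) ?Y Z" using fctr_hom[OF rf h(1)] e5(1)[OF Z] R_id[OF K(2)] Z by simp
    \<comment> \<open>the candidate is \<open>r\<^sup>* h\<close>; on \<open>U\<close> it is \<open>g\<close> because \<open>s r = id\<close> and \<open>t\<close> restricts to an identity there\<close>
    have gU: "FArr ?r' (FArr ?l g) = g" using e6(2)[OF g] R_id[of U] U K homD[OF g] by simp
    have "FArr ?i (FArr ?r h) = FArr ?r' (FArr ?a h)" using e3(2)[OF h(1)] e4(2)[OF h(1)] by simp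
    also have "\<dots> = Comp (E U) g (Id (E U) (FObj ?i ?Y))"
      using h(2) fctr_comp[OF r'f at lg] gU e3(2)[OF t] ut e4(1)[OF Xo] by simp
    also have "\<dots> = g" using comp_id[OF c(3) g] .
    finally have if_g: "FArr ?i (FArr ?r h) = g" .
    \<comment> \<open>the correspondence \<open>f \<mapsto> s\<^sup>* f \<circ> t\<close>, on \<open>Q\<close> and on the corners\<close>
    have up: "FArr ?r (Comp (E P) (FArr ?s f) t) = f"
      and down: "FArr ?a (Comp (E P) (FArr ?s f) t) = Comp (E A) (FArr ?l (FArr ?i f)) (FArr ?a t)"
      and st: "Comp (E P) (FArr ?s f) t \<in> hom (E P) X (FObj ?s Z)"
      if f: "f \<in> hom (E Q) ?Y Z" for f
    proof -
      note sfh = fctr_hom[OF sf f]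
      show "Comp (E P) (FArr ?s f) t \<in> hom (E P) X (FObj ?s Z)" using comp_hom[OF c(1) t sfh] .
      show "FArr ?r (Comp (E P) (FArr ?s f) t) = f"
        using fctr_comp[OF rf t sfh] rt e5(2)[OF f] R_id[OF K(2)] homD[OF f] comp_id[OF c(2) f] by simp
      show "FArr ?a (Comp (E P) (FArr ?s f) t) = Comp (E A) (FArr ?l (FArr ?i f)) (FArr ?a t)"
        using fctr_comp[OF af t sfh] e1(2)[OF f] e2(2)[OF f] by simp
    qed
    show "\<exists>!f. f \<in> hom (E Q) ?Y Z \<and> FArr ?i f = g"
    proof (rule ex1I[of _ "FArr ?r h"])
      fix f' assume f': "f' \<in> hom (E Q) ?Y Z \<and> FArr ?i f' = g"
      have "Comp (E P) (FArr ?s f') t = Comp (E P) (FArr ?s (FArr ?r h)) t"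
        by (rule left_extended_faithful[OF af X]) (use f f' if_g down st in auto)
      then show "f' = FArr ?r h" using up f f' by metis
    qed (use f if_g in auto)
  qed
qed

text \<open>
  A map on \<open>B\<close> is extended by way of its restriction to \<open>A\<close>; that the result agrees with it on
  \<open>B\<close>, and not only on \<open>A\<close>, is what the second hypothesis gives.
\<close>

lemma left_extended_larger:
  assumes AB: "A \<subseteq> B" "B \<subseteq> P" "P \<subseteq> K"
    and X: "left_extended (R A P (\<lambda>x. x)) X" and XB: "left_extended (R A B (\<lambda>x. x)) (FObj (R B P (\<lambda>x. x)) X)"
  shows "left_extended (R B P (\<lambda>x. x)) X"
proof -
  have m: "mon A B (\<lambda>x. x)" "mon B P (\<lambda>x. x)" "mon A P (\<lambda>x. x)" using AB mon_incl by auto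
  let ?a = "R A P (\<lambda>x. x)" and ?b = "R B P (\<lambda>x. x)" and ?c = "R A B (\<lambda>x. x)"
  note f = R_fctr[OF m(1)] R_fctr[OF m(2)] R_fctr[OF m(3)]
  note e = R_comp_apply[OF m(1,2,3) ballI[OF refl]]
  have d: "FDom ?b = E P" "FCod ?b = E B" "FDom ?a = E P" using fctr_cats[OF f(2)] fctr_cats[OF f(3)] by auto
  have Xo: "X \<in> Obj (E P)" using X by (simp add: left_extended_def d)
  show ?thesis unfolding left_extended_def d
  proof (intro conjI ballI)
    fix Z g assume Z: "Z \<in> Obj (E P)" and g: "g \<in> hom (E B) (FObj ?b X) (FObj ?b Z)"
    have cg: "FArr ?c g \<in> hom (E A) (FObj ?a X) (FObj ?a Z)"
      using fctr_hom[OF f(1) g] e(1) Xo Z by simp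
    obtain h where h: "h \<in> hom (E P) X Z" "FArr ?a h = FArr ?c g"
      using left_extended_lift[OF f(3) X Z cg] .
    have "FArr ?b h = g"
      by (rule left_extended_faithful[OF f(1) XB fctr_hom[OF f(2) h(1)] g]) (use h e(2)[OF h(1)] in simp)
    moreover have "h' = h" if "h' \<in> hom (E P) X Z" "FArr ?b h' = g" for h'
      by (rule left_extended_faithful[OF f(3) X that(1) h(1)]) (use h that e(2)[OF that(1)] in simp)
    ultimately show "\<exists>!f. f \<in> hom (E P) X Z \<and> FArr ?b f = g" using h by blast
  qed (rule Xo)
qed

definition iso_at :: "'k set \<Rightarrow> 'a \<Rightarrow> 'k \<Rightarrow> bool" where
  "iso_at P f p \<longleftrightarrow> iso_arr (E {p}) (FArr (R {p} P (\<lambda>x. x)) f)"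

lemma iso_iff_iso_at:
  assumes "P \<subseteq> K" "f \<in> hom (E P) X Y"
  shows "iso_arr (E P) f \<longleftrightarrow> (\<forall>p\<in>P. iso_at P f p)"
proof -
  have "f \<in> Arr (E P)" using homD[OF assms(2)] by blast
  moreover have "mon {p} P (\<lambda>x. x)" if "p \<in> P" for p using that assms(1) by (auto simp: mono_between_def)
  ultimately show ?thesis
    using E_conservative[OF assms(1)] fctr_iso[OF R_fctr] unfolding iso_at_def by metis
qed

end

section \<open>Pasting of squares\<close>

text \<open>
  \<open>K\<close> is the prism, \<open>Q\<close> the square with corner \<open>U\<close>, and \<open>r0, r1, r2\<close> are its three faces. The faces \<open>r0\<close>
  and \<open>r1\<close> have the retractions \<open>s0\<close> and \<open>s1\<close> with \<open>x \<le> r (s x)\<close>. The face \<open>r2\<close> is an isomorphism, with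
  inverse \<open>s2\<close>, onto a downward closed subset \<open>N\<close>. The corner \<open>A\<close> of the prism matches
  \<open>U\<close> on the faces \<open>r1\<close> and \<open>r2\<close>; on \<open>r0\<close> one has to add the point that completes the face \<open>r2\<close>, which
  gives \<open>B\<close>.
\<close>

locale pasting_shape = poset_diagrams K le E R
  for K :: "'k set" and le :: "'k \<Rightarrow> 'k \<Rightarrow> bool" and E :: "'k set \<Rightarrow> ('o, 'a) cat"
    and R :: "'k set \<Rightarrow> 'k set \<Rightarrow> ('k \<Rightarrow> 'k) \<Rightarrow> ('o, 'a, 'o, 'a) fctr" +
  fixes Q U A B N :: "'k set" and r0 r1 r2 s0 s1 s2 :: "'k \<Rightarrow> 'k"
  assumes le_refl: "x \<in> K \<Longrightarrow> le x x"
    and subsets: "U \<subseteq> Q" "A \<subseteq> B" "B \<subseteq> K" "N \<subseteq> K"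
    and mon_r: "mono_between K le Q K r0" "mono_between K le Q K r1" "mono_between K le Q N r2"
    and mon_s: "mono_between K le K Q s0" "mono_between K le K Q s1" "mono_between K le N Q s2"
    and sr: "x \<in> Q \<Longrightarrow> s0 (r0 x) = x" "x \<in> Q \<Longrightarrow> s1 (r1 x) = x" "x \<in> Q \<Longrightarrow> s2 (r2 x) = x"
    and infl: "x \<in> K \<Longrightarrow> le x (r0 (s0 x))" "x \<in> K \<Longrightarrow> le x (r1 (s1 x))"
    and rs2: "x \<in> N \<Longrightarrow> r2 (s2 x) = x"
    and corner: "s0 ` B \<subseteq> U" "r0 ` U \<subseteq> B" "s1 ` A \<subseteq> U" "r1 ` U \<subseteq> A" "s2 ` (A \<inter> N) \<subseteq> U" "r2 ` U \<subseteq> A"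
    and sieves: "x \<in> B \<Longrightarrow> y \<in> K \<Longrightarrow> le y x \<Longrightarrow> y \<in> B" "x \<in> N \<Longrightarrow> y \<in> K \<Longrightarrow> le y x \<Longrightarrow> y \<in> N"
    and cover: "B \<subseteq> A \<union> N" "K \<subseteq> B \<union> r0 ` Q" "K \<subseteq> B \<union> r1 ` Q"
begin

lemma mon_r2: "mon Q K r2"
  using mon_r(3) subsets by (auto simp: mono_between_def)

text \<open>
  The face \<open>r1\<close> is covered by \<open>retract_left_extended\<close>. So is \<open>r0\<close>, with \<open>B\<close> in place of \<open>A\<close>: as \<open>B\<close> is
  downward closed, \<open>X\<close> on \<open>B\<close> is left extended from \<open>A\<close>, and therefore \<open>X\<close> is left extended from \<open>B\<close>. The
  face \<open>r2\<close> is the restriction to \<open>N\<close>, transported along an isomorphism of posets.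
\<close>

lemma faces_left_extended:
  assumes X: "left_extended (R A K (\<lambda>x. x)) X"
  shows "left_extended (R U Q (\<lambda>x. x)) (FObj (R Q K r0) X)"
    and "left_extended (R U Q (\<lambda>x. x)) (FObj (R Q K r1) X)"
    and "left_extended (R U Q (\<lambda>x. x)) (FObj (R Q K r2) X)"
proof -
  have AK: "A \<subseteq> K" using subsets by auto
  have Xo: "X \<in> Obj (E K)"
    using X fctr_cats[OF R_fctr[OF mon_incl[OF AK subset_refl]]] by (simp add: left_extended_def)
  show "left_extended (R U Q (\<lambda>x. x)) (FObj (R Q K r1) X)"
    by (rule retract_left_extended[OF mon_r(2) mon_s(2) sr(2) infl(2) AK subsets(1) corner(3,4) X])
  have "left_extended (R (A \<inter> B) B (\<lambda>x. x)) (FObj (R B K (\<lambda>x. x)) X)"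
    by (rule sieve[OF AK subset_refl subsets(3) sieves(1) X])
  then have "left_extended (R A B (\<lambda>x. x)) (FObj (R B K (\<lambda>x. x)) X)"
    using subsets(2) by (simp add: Int_absorb2)
  then have XB: "left_extended (R B K (\<lambda>x. x)) X" using left_extended_larger[OF subsets(2,3) subset_refl X] by blast
  show "left_extended (R U Q (\<lambda>x. x)) (FObj (R Q K r0) X)"
    by (rule retract_left_extended[OF mon_r(1) mon_s(1) sr(1) infl(1) subsets(3,1) corner(1,2) XB])
  have n: "left_extended (R (A \<inter> N) N (\<lambda>x. x)) (FObj (R N K (\<lambda>x. x)) X)"
    by (rule sieve[OF AK subset_refl subsets(4) sieves(2) X])
  have "r2 ` U \<subseteq> N" using mon_r(3) subsets(1) by (auto simp: mono_between_def image_subset_iff subset_iff)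
  then have rU: "r2 ` U \<subseteq> A \<inter> N" using corner(6) by auto
  have "left_extended (R U Q (\<lambda>x. x)) (FObj (R Q N r2) (FObj (R N K (\<lambda>x. x)) X))"
    by (rule retract_left_extended[OF mon_r(3) mon_s(3) sr(3) _ _ subsets(1) corner(5) rU n])
      (use rs2 le_refl subsets in auto)
  then show "left_extended (R U Q (\<lambda>x. x)) (FObj (R Q K r2) X)"
    using R_comp_apply(1)[OF mon_r(3) mon_incl[OF subsets(4) subset_refl] mon_r2 ballI[OF refl] Xo] by simp
qed

text \<open>
  Compare \<open>X\<close> with an object \<open>X'\<close> left extended from \<open>A\<close> by a map \<open>c\<close> which is invertible on \<open>A\<close>. All faces of
  \<open>X'\<close> are left extended, so whenever a face of \<open>X\<close> is, too, \<open>c\<close> is invertible on this face as soon as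
  it is on its corner. For \<open>r2\<close> the corner lies in \<open>A\<close>; then \<open>c\<close> is invertible on \<open>B\<close>, which contains the
  corner of either other face.
\<close>

lemma left_extended_if_faces:
  assumes X: "X \<in> Obj (E K)" and f2: "left_extended (R U Q (\<lambda>x. x)) (FObj (R Q K r2) X)"
    and f01: "left_extended (R U Q (\<lambda>x. x)) (FObj (R Q K r0) X) \<or> left_extended (R U Q (\<lambda>x. x)) (FObj (R Q K r1) X)"
  shows "left_extended (R A K (\<lambda>x. x)) X"
proof -
  have AK: "A \<subseteq> K" and QK: "Q \<subseteq> K" using subsets mon_r(1) by (auto simp: mono_between_def)
  note a = mon_incl[OF AK subset_refl] and i = mon_incl[OF subsets(1) QK]
  obtain X' c where X': "left_extended (R A K (\<lambda>x. x)) X'" and c: "c \<in> hom (E K) X' X"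
    and ci: "iso_arr (E A) (FArr (R A K (\<lambda>x. x)) c)" using replacement[OF AK subset_refl X] by blast
  \<comment> \<open>the diagrams on the singletons \<open>{p}\<close> and \<open>{r p}\<close> are exchanged by constant maps\<close>
  have along: "iso_at P (FArr (R P K r) c) p \<longleftrightarrow> iso_at K c (r p)"
    if r: "mon P K r" and p: "p \<in> P" for P r p
  proof -
    have m: "mon {p} P (\<lambda>x. x)" "mon {p} {r p} r" "mon {r p} K (\<lambda>x. x)" "mon {p} K r"
      "mon {r p} {p} (\<lambda>_. p)" "mon {p} {p} (\<lambda>x. x)" "mon {r p} {r p} (\<lambda>x. x)" 
      using r p le_refl by (auto simp: mono_between_def)
    have 1: "FArr (R {p} P (\<lambda>x. x)) (FArr (R P K r) c) = FArr (R {p} {r p} r) (FArr (R {r p} K (\<lambda>x. x)) c)"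
      using R_comp_apply(2)[OF m(1) r m(4) ballI[OF refl] c] R_comp_apply(2)[OF m(2,3,4) ballI[OF refl] c] by simp
    let ?d = "FArr (R {r p} K (\<lambda>x. x)) c"
    have d: "?d \<in> hom (E {r p}) (FObj (R {r p} K (\<lambda>x. x)) X') (FObj (R {r p} K (\<lambda>x. x)) X)"
      using fctr_hom[OF R_fctr[OF m(3)] c] .
    have "FArr (R {r p} {p} (\<lambda>_. p)) (FArr (R {p} {r p} r) ?d) = ?d"
      using R_comp_apply(2)[OF m(5,2,7) _ d] R_id[of "{r p}"] m(3) homD[OF d] by (simp add: mono_between_def)
    then show ?thesis
      unfolding iso_at_def 1 using fctr_iso[OF R_fctr[OF m(2)]] fctr_iso[OF R_fctr[OF m(5)]] by metis
  qed
  have face: "iso_at K c (r p)"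
    if r: "mon Q K r" "\<And>p. p \<in> U \<Longrightarrow> iso_at K c (r p)" and p: "p \<in> Q"
      and e: "left_extended (R U Q (\<lambda>x. x)) (FObj (R Q K r) X)" "left_extended (R U Q (\<lambda>x. x)) (FObj (R Q K r) X')"
    for r p
  proof -
    have rU: "mon U K r" using r(1) subsets(1) by (auto simp: mono_between_def subset_iff)
    note rc = fctr_hom[OF R_fctr[OF r(1)] c] and rUc = fctr_hom[OF R_fctr[OF rU] c]
    have "iso_arr (E U) (FArr (R U K r) c)"
      using iso_iff_iso_at[OF _ rUc] along[OF rU] r(2) rU by (auto simp: mono_between_def)
    then have "iso_arr (E U) (FArr (R U Q (\<lambda>x. x)) (FArr (R Q K r) c))"
      using R_comp_apply(2)[OF i r(1) rU ballI[OF refl] c] by simp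
    then have "iso_arr (E Q) (FArr (R Q K r) c)"
      using left_extended_iso[OF R_fctr[OF i] e(2,1) rc] by blast
    then show ?thesis using iso_iff_iso_at[OF QK rc] along[OF r(1) p] p by blast
  qed
  have isoA: "iso_at K c p" if "p \<in> A" for p
    using iso_iff_iso_at[OF AK fctr_hom[OF R_fctr[OF a] c]] ci along[OF a that] that by blast
  note F = faces_left_extended[OF X']
  have "iso_at K c (r2 p)" if "p \<in> Q" for p
    by (rule face[OF mon_r2 _ that f2 F(3)]) (use corner isoA in auto)
  moreover have "x = r2 (s2 x)" "s2 x \<in> Q" if "x \<in> N" for x
    using rs2 mon_s(3) that by (auto simp: mono_between_def)
  ultimately have "iso_at K c p" if "p \<in> N" for p using that by metis
  then have isoB: "iso_at K c p" if "p \<in> B" for p using that isoA cover(1) by blast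
  have "iso_at K c p" if "p \<in> K" for p
    using f01
  proof
    assume e: "left_extended (R U Q (\<lambda>x. x)) (FObj (R Q K r0) X)"
    have "iso_at K c (r0 q)" if "q \<in> Q" for q
      by (rule face[OF mon_r(1) _ that e F(1)]) (use corner isoB in auto)
    then show ?thesis using that isoB cover(2) by blast
  next
    assume e: "left_extended (R U Q (\<lambda>x. x)) (FObj (R Q K r1) X)"
    have "iso_at K c (r1 q)" if "q \<in> Q" for q
      by (rule face[OF mon_r(2) _ that e F(2)]) (use corner isoA in auto)
    then show ?thesis using that isoB cover(3) by blast
  qed
  then have "iso_arr (E K) c" using iso_iff_iso_at[OF subset_refl c] by blast
  then show ?thesis using left_extended_iso_target[OF R_fctr[OF a] X' c] by blast
qed

theorem pasting:
  assumes "X \<in> Obj (E K)" and "left_extended (R U Q (\<lambda>x. x)) (FObj (R Q K r2) X)"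
  shows "left_extended (R U Q (\<lambda>x. x)) (FObj (R Q K r0) X) \<longleftrightarrow> left_extended (R U Q (\<lambda>x. x)) (FObj (R Q K r1) X)"
  using left_extended_if_faces[OF assms] faces_left_extended by blast

end

section \<open>Thin categories\<close>

definition thin :: "('o, 'a) cat \<Rightarrow> bool" where
  "thin C \<longleftrightarrow> (\<forall>x y. \<forall>f\<in>hom C x y. \<forall>g\<in>hom C x y. f = g)"

lemma thin_unique: "thin C \<Longrightarrow> f \<in> hom C x y \<Longrightarrow> g \<in> hom C x y \<Longrightarrow> f = g"
  by (auto simp: thin_def)

lemma thin_full_subcat: "thin C \<Longrightarrow> thin (full_subcat C P)"
  by (auto simp: thin_def hom_full_subcat)

lemma thin_fctr_eq:
  assumes F: "is_fctr F B C" and G: "is_fctr G B C" and C: "thin C"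
    and o: "\<And>x. x \<in> Obj B \<Longrightarrow> FObj F x = FObj G x"
  shows "F = G"
proof (rule fctr_eqI[OF F G o])
  fix f assume f: "f \<in> Arr B"
  have c: "category B" using fctr_cats[OF F] by simp
  note h = homI[OF f refl refl]
  show "FArr F f = FArr G f"
    using thin_unique[OF C fctr_hom[OF F h]] fctr_hom[OF G h] o Dom_in[OF c f] Cod_in[OF c f] by simp
qed

lemma thin_ntrans_eq:
  assumes "is_ntrans s F G" "is_ntrans t F G" "is_fctr F B C" "thin C"
  shows "s = t"
  by (rule ntrans_eqI[OF assms(1,2,3)])
    (use thin_unique[OF assms(4)] ntrans_hom[OF assms(1,3)] ntrans_hom[OF assms(2,3)] in blast)

text \<open>
  In a thin category identities and composites are determined by the hom sets.
\<close>

lemma thin_category_eqI: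
  assumes A: "category A" and B: "category B" and t: "thin A"
    and o: "Obj A = Obj B" and h: "\<And>x y. hom A x y = hom B x y"
  shows "A = B"
proof -
  have arr: "Arr A = Arr B" "\<And>f. f \<in> Arr A \<Longrightarrow> Dom A f = Dom B f" "\<And>f. f \<in> Arr A \<Longrightarrow> Cod A f = Cod B f"
    using h unfolding hom_def set_eq_iff mem_Collect_eq by blast+
  have ext: "Dom A \<in> extensional (Arr A)" "Cod A \<in> extensional (Arr A)" "Id A \<in> extensional (Obj A)"
     "Dom B \<in> extensional (Arr B)" "Cod B \<in> extensional (Arr B)" "Id B \<in> extensional (Obj B)"
    using A B by (auto simp: category_def PiE_def)
  have Dom: "Dom A = Dom B" by (rule extensionalityI[OF ext(1) ext(4)[folded arr(1)] arr(2)])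
  have Cod: "Cod A = Cod B" by (rule extensionalityI[OF ext(2) ext(5)[folded arr(1)] arr(3)])
  have Id: "Id A = Id B"
    by (rule extensionalityI[OF ext(3) ext(6)[folded o]])
      (use thin_unique[OF t id_hom[OF A]] id_hom[OF B] o h in auto)
  have "Comp A g f = Comp B g f" for g f
  proof (cases "f \<in> Arr A \<and> g \<in> Arr A \<and> Cod A f = Dom A g")
    case True
    then have fg: "f \<in> hom A (Dom A f) (Cod A f)" "g \<in> hom A (Cod A f) (Cod A g)" by (auto simp: hom_def)
    show ?thesis using thin_unique[OF t comp_hom[OF A fg]] comp_hom[OF B] fg h by metis
  next
    case False
    then have "Comp A g f = undefined" "Comp B g f = undefined"
      using A B unfolding category_def by (simp_all add: arr(1) Dom Cod)
    then show ?thesis by simp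
  qed
  then show ?thesis using o arr(1) Dom Cod Id by (intro cat.equality) (auto simp: fun_eq_iff)
qed

definition arrow_le :: "('o, 'a) cat \<Rightarrow> 'o \<Rightarrow> 'o \<Rightarrow> bool" where
  "arrow_le C x y \<longleftrightarrow> hom C x y \<noteq> {}"

text \<open>
  \<open>C\<close> is meant to be thin, where \<open>THE\<close> picks the only arrow there is.
\<close>

definition mono_fctr :: "'v scat \<Rightarrow> 'v univ set \<Rightarrow> 'v univ set \<Rightarrow> ('v univ \<Rightarrow> 'v univ) \<Rightarrow> 'v sfctr" where
  "mono_fctr C P Q h = mk_fctr (full_subcat C P) (full_subcat C Q) h
     (\<lambda>f. THE g. g \<in> hom C (h (Dom C f)) (h (Cod C f)))"

lemma mono_between_converse:
  "mono_between K (\<lambda>x y. le y x) P Q h \<longleftrightarrow> mono_between K le P Q h"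
  by (auto simp: mono_between_def)

lemma is_fctr_mono:
  assumes c: "category C" and t: "thin C" and m: "mono_between (Obj C) (arrow_le C) P Q h"
  shows "is_fctr (mono_fctr C P Q h) (full_subcat C P) (full_subcat C Q)"
    and "x \<in> P \<Longrightarrow> FObj (mono_fctr C P Q h) x = h x"
proof -
  have P: "P \<subseteq> Obj C" "Q \<subseteq> Obj C" using m by (auto simp: mono_between_def)
  have hP: "h x \<in> Q" if "x \<in> P" for x using m that by (auto simp: mono_between_def)
  let ?a = "\<lambda>f. THE g. g \<in> hom C (h (Dom C f)) (h (Cod C f))"
  have a: "?a f \<in> hom (full_subcat C Q) (h x) (h y)" if f: "f \<in> hom (full_subcat C P) x y" for f x y
  proof -
    have f': "f \<in> hom C x y" "x \<in> P" "y \<in> P" using f by (auto simp: hom_full_subcat)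
    then have "arrow_le C (h x) (h y)" using m unfolding mono_between_def arrow_le_def by blast
    then obtain g where g: "g \<in> hom C (h x) (h y)" by (auto simp: arrow_le_def)
    have e: "Dom C f = x" "Cod C f = y" using homD[OF f'(1)] by auto
    have "?a f = g" unfolding e by (rule the_equality) (fact g, erule thin_unique[OF t _ g])
    then show ?thesis using g hP f' by (simp add: hom_full_subcat)
  qed
  note cP = category_full_subcat[OF c, of P] and cQ = category_full_subcat[OF c, of Q]
  note tQ = thin_full_subcat[OF t, of Q]
  show "is_fctr (mono_fctr C P Q h) (full_subcat C P) (full_subcat C Q)"
    unfolding mono_fctr_def
  proof (rule is_fctr_mk[OF cP cQ _ a])
    show o: "h x \<in> Obj (full_subcat C Q)" if "x \<in> Obj (full_subcat C P)" for x
      using that hP P by (auto simp: full_subcat_simps)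
    show "?a (Id (full_subcat C P) x) = Id (full_subcat C Q) (h x)" if x: "x \<in> Obj (full_subcat C P)" for x
      by (rule thin_unique[OF tQ a[OF id_hom[OF cP x]] id_hom[OF cQ o[OF x]]])
    show "?a (Comp (full_subcat C P) g f) = Comp (full_subcat C Q) (?a g) (?a f)"
      if f: "f \<in> hom (full_subcat C P) x y" and g: "g \<in> hom (full_subcat C P) y z" for f g x y z
      by (rule thin_unique[OF tQ a[OF comp_hom[OF cP f g]] comp_hom[OF cQ a[OF f] a[OF g]]])
  qed
  show "x \<in> P \<Longrightarrow> FObj (mono_fctr C P Q h) x = h x"
    using m by (auto simp: mono_fctr_def full_subcat_simps mono_between_def)
qed

lemma subcat_incl_mono:
  assumes c: "category C" and t: "thin C" and P: "P \<subseteq> Obj C"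
  shows "subcat_incl (full_subcat C P) A = mono_fctr C (A \<inter> P) P (\<lambda>x. x)"
proof -
  have m: "mono_between (Obj C) (arrow_le C) (A \<inter> P) P (\<lambda>x. x)" using P by (auto simp: mono_between_def)
  have d: "full_subcat (full_subcat C P) A = full_subcat C (A \<inter> P)"
    by (simp add: full_subcat_full_subcat Int_commute)
  show ?thesis
    by (rule thin_fctr_eq[OF is_fctr_subcat_incl[OF category_full_subcat[OF c], of P A, unfolded d]
          is_fctr_mono(1)[OF c t m] thin_full_subcat[OF t]])
      (use is_fctr_mono(2)[OF c t m] in \<open>auto simp: full_subcat_simps subcat_incl_simps\<close>)
qed

text \<open>
  In a thin category functors are determined by their values on objects, and a transformation is a
  pointwise inequality. So the 2-functor \<open>D\<close> yields restriction maps that depend on monotone maps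
  only, composing strictly.
\<close>

locale thin_diagrams = derivator_setting S D
  for S :: "'v univ set \<Rightarrow> bool" and D :: "('v, 'o, 'a) preder" +
  fixes C :: "'v scat"
  assumes C: "small_cat S C" and thin: "thin C"
begin

lemma category_C: "category C" using C by (simp add: small_cat_def)

abbreviation "E P \<equiv> DCat D (full_subcat C P)"

abbreviation "R P Q h \<equiv> DFun D (mono_fctr C P Q h)"

abbreviation "monoC \<equiv> mono_between (Obj C) (arrow_le C)"

lemma small_mono: "monoC P Q h \<Longrightarrow> small_fctr S (mono_fctr C P Q h) (full_subcat C P) (full_subcat C Q)"
  using is_fctr_mono(1)[OF category_C thin] small_full_subcat[OF S C] by (simp add: small_fctr_def)

lemma mono_fctr_id:
  assumes P: "P \<subseteq> Obj C" shows "mono_fctr C P P (\<lambda>x. x) = id_fctr (full_subcat C P)"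
proof -
  have m: "monoC P P (\<lambda>x. x)" using P by (auto simp: mono_between_def)
  show ?thesis
    by (rule thin_fctr_eq[OF is_fctr_mono(1)[OF category_C thin m]
          is_fctr_id[OF category_full_subcat[OF category_C]] thin_full_subcat[OF thin]])
      (simp add: is_fctr_mono(2)[OF category_C thin m] full_subcat_simps)
qed

lemma mono_fctr_comp:
  assumes h: "monoC P Q h" and g: "monoC Q W g"
  shows "mono_fctr C P W (\<lambda>x. g (h x)) = mono_fctr C Q W g \<circ>\<^sub>F mono_fctr C P Q h"
proof -
  have m: "monoC P W (\<lambda>x. g (h x))" using h g by (auto simp: mono_between_def image_subset_iff)
  note f = is_fctr_mono(1)[OF category_C thin]
  have "h x \<in> Q" if "x \<in> P" for x using h that by (auto simp: mono_between_def)
  then show ?thesis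
    by (intro thin_fctr_eq[OF f[OF m] is_fctr_comp[OF f[OF h] f[OF g]] thin_full_subcat[OF thin]])
      (simp add: is_fctr_mono(2)[OF category_C thin] m h g comp_fctr_simps(3)[OF f[OF h]] full_subcat_simps)
qed

lemma mono_fctr_cong:
  assumes e: "\<And>x. x \<in> P \<Longrightarrow> h x = h' x" and m: "monoC P Q h"
  shows "mono_fctr C P Q h = mono_fctr C P Q h'"
proof -
  have m': "monoC P Q h'" using m e unfolding mono_between_def image_subset_iff by metis
  note f = is_fctr_mono[OF category_C thin]
  show ?thesis
    by (rule thin_fctr_eq[OF f(1)[OF m] f(1)[OF m'] thin_full_subcat[OF thin]])
      (simp add: f(2) m m' e full_subcat_simps)
qed

lemma mono_fctr_ntrans:
  assumes m: "monoC P Q h" and m': "monoC P Q h'" and le: "\<And>x. x \<in> P \<Longrightarrow> arrow_le C (h x) (h' x)"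
  shows "\<exists>t. is_ntrans t (mono_fctr C P Q h) (mono_fctr C P Q h')"
proof -
  note f = is_fctr_mono[OF category_C thin]
  define t where "t x = (SOME f. f \<in> hom C (h x) (h' x))" for x
  have t: "t x \<in> hom (full_subcat C Q) (h x) (h' x)" if "x \<in> P" for x
    using le[OF that] m m' that some_in_eq[of "hom C (h x) (h' x)"]
    by (auto simp: arrow_le_def t_def hom_full_subcat mono_between_def some_in_eq)
  have cP: "category (full_subcat C P)" and cQ: "category (full_subcat C Q)"
    using category_full_subcat[OF category_C] by auto
  have "is_ntrans (mk_ntrans (mono_fctr C P Q h) (mono_fctr C P Q h') t) (mono_fctr C P Q h) (mono_fctr C P Q h')"
  proof (rule is_ntrans_mk[OF f(1)[OF m] f(1)[OF m']])
    show T: "t x \<in> hom (full_subcat C Q) (FObj (mono_fctr C P Q h) x) (FObj (mono_fctr C P Q h') x)"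
      if "x \<in> Obj (full_subcat C P)" for x
      using that t by (simp add: full_subcat_simps f(2)[OF m] f(2)[OF m'])
    fix k x y assume k: "k \<in> hom (full_subcat C P) x y"
    note o = hom_obj[OF cP k]
    show "Comp (full_subcat C Q) (FArr (mono_fctr C P Q h') k) (t x) =
        Comp (full_subcat C Q) (t y) (FArr (mono_fctr C P Q h) k)"
      by (rule thin_unique[OF thin_full_subcat[OF thin] comp_hom[OF cQ T fctr_hom[OF f(1)[OF m'] k]]
            comp_hom[OF cQ fctr_hom[OF f(1)[OF m] k] T]]) (use o in auto)
  qed
  then show ?thesis by blast
qed

text \<open>
  The subcategory on one point \<open>p\<close> is not the category \<open>e\<close> itself, but the functor picking \<open>p\<close>
  factors through it.
\<close>

lemma conservative_restriction:
  assumes P: "P \<subseteq> Obj C" and f: "f \<in> Arr (E P)"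
    and i: "\<And>p. p \<in> P \<Longrightarrow> iso_arr (E {p}) (FArr (R {p} P (\<lambda>x. x)) f)"
  shows "iso_arr (E P) f"
proof (rule conservative[OF small_full_subcat[OF S C] f])
  fix j assume "j \<in> Obj (full_subcat C P)"
  then have j: "j \<in> P" "j \<in> Obj (full_subcat C {j})" by (auto simp: full_subcat_simps)
  have m: "monoC {j} P (\<lambda>x. x)" using j P by (auto simp: mono_between_def)
  note ob = small_obj[OF small_full_subcat[OF S C] j(2)]
  have "obj_fctr (full_subcat C P) j = mono_fctr C {j} P (\<lambda>x. x) \<circ>\<^sub>F obj_fctr (full_subcat C {j}) j"
    using obj_fctr_comp[OF is_fctr_mono(1)[OF category_C thin m] j(2)]
      is_fctr_mono(2)[OF category_C thin m] by simp
  then show "iso_arr (DCat D e\<^sub>c) (FArr (DFun D (obj_fctr (full_subcat C P) j)) f)"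
    using DFun_comp_apply(2)[OF ob small_mono[OF m] f] fctr_iso[OF DFun_fctr[OF ob] i[OF j(1)]] by simp
qed

text \<open>
  Whiskered with \<open>g\<close>, the transformation \<open>n\<close> runs between equal functors with values in a thin
  category, so it is the identity.
\<close>

lemma inflationary:
  assumes h: "monoC P P h" and n: "is_ntrans n (id_fctr (full_subcat C P)) (mono_fctr C P P h) \<or>
      is_ntrans n (mono_fctr C P P h) (id_fctr (full_subcat C P))"
    and g: "monoC Q P g" "\<forall>x\<in>Q. h (g x) = g x" and X: "X \<in> Obj (E P)"
  shows "FArr (R Q P g) (NMap (DNat D n) X) =
     Id (E Q) (FObj (R Q P g) X)"
proof -
  let ?P = "full_subcat C P" and ?h = "mono_fctr C P P h" and ?g = "mono_fctr C Q P g"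
  have P: "P \<subseteq> Obj C" and gP: "\<And>x. x \<in> Q \<Longrightarrow> g x \<in> P" using h g by (auto simp: mono_between_def)
  note hf = is_fctr_mono[OF category_C thin h] and gf = is_fctr_mono[OF category_C thin g(1)]
  note idf = is_fctr_id[OF category_full_subcat[OF category_C, of P]]
  note si = small_id[OF small_full_subcat[OF S C, of P]] and sh = small_mono[OF h] and sg = small_mono[OF g(1)]
  have e: "id_fctr ?P \<circ>\<^sub>F ?g = ?g"
    by (rule thin_fctr_eq[OF is_fctr_comp[OF gf(1) idf] gf(1) thin_full_subcat[OF thin]])
      (use fctr_obj[OF gf(1)] in \<open>simp add: comp_fctr_simps[OF gf(1)]\<close>)
  have e': "?h \<circ>\<^sub>F ?g = ?g"
    by (rule thin_fctr_eq[OF is_fctr_comp[OF gf(1) hf(1)] gf(1) thin_full_subcat[OF thin]])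
      (use gP g(2) in \<open>simp add: comp_fctr_simps[OF gf(1)] gf(2) hf(2) full_subcat_simps\<close>)
  have "n \<star> id_ntrans ?g = id_ntrans ?g"
    using n
  proof
    assume "is_ntrans n (id_fctr ?P) ?h"
    from is_ntrans_hcomp_id_right(1)[OF this idf gf(1), unfolded e e']
    show ?thesis by (rule thin_ntrans_eq[OF _ is_ntrans_id[OF gf(1)] gf(1) thin_full_subcat[OF thin]])
  next
    assume "is_ntrans n ?h (id_fctr ?P)"
    from is_ntrans_hcomp_id_right(1)[OF this hf(1) gf(1), unfolded e e']
    show ?thesis by (rule thin_ntrans_eq[OF _ is_ntrans_id[OF gf(1)] gf(1) thin_full_subcat[OF thin]])
  qed
  moreover have "NMap (DNat D (n \<star> id_ntrans ?g)) X = FArr (DFun D ?g) (NMap (DNat D n) X)"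
    using n DNat_whisker_right[OF _ si sh sg X] DNat_whisker_right[OF _ sh si sg X] by blast
  ultimately show ?thesis using DNat_id_apply[OF sg X] by simp
qed

lemma left_diagrams:
  "poset_diagrams (Obj C) (arrow_le C) E R"
proof
  show "is_fctr (R P Q h) (E Q) (E P)"
    if "monoC P Q h" for P Q h using DFun_fctr[OF small_mono[OF that]] .
  show "R P P (\<lambda>x. x) = id_fctr (E P)" if "P \<subseteq> Obj C" for P
    using mono_fctr_id[OF that] DFun_id[OF small_full_subcat[OF S C]] by simp
  show "R P W (\<lambda>x. g (h x)) = R P Q h \<circ>\<^sub>F R Q W g"
    if "monoC P Q h" "monoC Q W g" for P Q W h g
    using mono_fctr_comp[OF that] DFun_comp[OF small_mono[OF that(1)] small_mono[OF that(2)]] by simp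
  show "R P Q h = R P Q h'"
    if "\<And>x. x \<in> P \<Longrightarrow> h x = h' x" "monoC P Q h" for P Q h h'
    using mono_fctr_cong[OF that] by simp
next
  fix P h X
  assume h: "monoC P P h" and le: "\<And>x. x \<in> P \<Longrightarrow> arrow_le C x (h x)" and X: "X \<in> Obj (E P)"
  have P: "P \<subseteq> Obj C" using h by (simp add: mono_between_def)
  have "monoC P P (\<lambda>x. x)" using P by (auto simp: mono_between_def)
  from mono_fctr_ntrans[OF this h le] obtain n where n: "is_ntrans n (id_fctr (full_subcat C P)) (mono_fctr C P P h)"
    unfolding mono_fctr_id[OF P] by blast
  note N = DNat_ntrans[OF small_id[OF small_full_subcat[OF S C]] small_mono[OF h] n,
      unfolded DFun_id[OF small_full_subcat[OF S C]]]
  have "NMap (DNat D n) X \<in> hom (E P) X (FObj (R P P h) X)"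
    using ntrans_hom[OF N is_fctr_id[OF DCat_category[OF small_full_subcat[OF S C]]] X] X by simp
  then show "\<exists>t\<in>hom (E P) X (FObj (R P P h) X).
      \<forall>Q g. monoC Q P g \<longrightarrow> (\<forall>x\<in>Q. h (g x) = g x) \<longrightarrow>
        FArr (R Q P g) t = Id (E Q) (FObj (R Q P g) X)"
    using inflationary[OF h _ _ _ X] n by blast
next
  show "iso_arr (E P) f" if "P \<subseteq> Obj C" "f \<in> Arr (E P)"
    "\<And>p. p \<in> P \<Longrightarrow> iso_arr (E {p}) (FArr (R {p} P (\<lambda>x. x)) f)" for P f
    by (rule conservative_restriction[OF that])
next
  fix A P V assume A: "A \<subseteq> P" and P: "P \<subseteq> Obj C" and V: "V \<in> Obj (E P)"
  let ?u = "subcat_incl (full_subcat C P) A"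
  have u: "?u = mono_fctr C A P (\<lambda>x. x)" using subcat_incl_mono[OF category_C thin P, of A] A
    by (simp add: Int_absorb2)
  have J: "full_subcat (full_subcat C P) A = full_subcat C A"
    using A by (simp add: full_subcat_full_subcat Int_absorb1)
  note su = small_subcat_incl[OF S small_full_subcat[OF S C, of P], of A]
  obtain W m where w: "universal (DFun D ?u) (FObj (DFun D ?u) V) W m"
    using pointwise_extension.universal_exists[OF pointwise_left[OF su] fctr_obj[OF DFun_fctr[OF su] V]] by blast
  show "\<exists>V' c. c \<in> hom (E P) V' V \<and> left_extended (R A P (\<lambda>x. x)) V' \<and>
      iso_arr (E A) (FArr (R A P (\<lambda>x. x)) c)"
    using universal_iso_replacement[OF DFun_fctr[OF su] V w universal_left_iso[OF small_full_subcat[OF S C] w]]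
    unfolding u J by blast
next
  fix A P N V assume A: "A \<subseteq> P" and P: "P \<subseteq> Obj C" and N: "N \<subseteq> P"
    and down: "\<And>x y. x \<in> N \<Longrightarrow> y \<in> P \<Longrightarrow> arrow_le C y x \<Longrightarrow> y \<in> N"
    and e: "left_extended (R A P (\<lambda>x. x)) V"
  have "Dom (full_subcat C P) f \<in> N" if "f \<in> Arr (full_subcat C P)" "Cod (full_subcat C P) f \<in> N" for f
  proof -
    have "f \<in> hom (full_subcat C P) (Dom (full_subcat C P) f) (Cod (full_subcat C P) f)"
      using that by (simp add: hom_def)
    then show ?thesis using down[OF that(2)] by (auto simp: hom_full_subcat arrow_le_def)
  qed
  moreover have "subcat_incl (full_subcat C P) A = mono_fctr C A P (\<lambda>x. x)"
    "subcat_incl (full_subcat C P) N = mono_fctr C N P (\<lambda>x. x)"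
    using subcat_incl_mono[OF category_C thin P] A N by (simp_all add: Int_absorb2)
  moreover have "full_subcat (full_subcat C P) N = full_subcat C N"
    "subcat_incl (full_subcat C N) A = mono_fctr C (A \<inter> N) N (\<lambda>x. x)"
    using N P subcat_incl_mono[OF category_C thin, of N A] by (auto simp: full_subcat_full_subcat Int_absorb1)
  ultimately show "left_extended (R (A \<inter> N) N (\<lambda>x. x)) (FObj (R N P (\<lambda>x. x)) V)"
    using sieve_restriction[OF small_full_subcat[OF S C], of P N A V] e by simp
qed

lemma right_diagrams:
  "poset_diagrams (Obj C) (\<lambda>x y. arrow_le C y x) (\<lambda>P. op_cat (E P))
     (\<lambda>P Q h. op_fctr (R P Q h))"
proof (unfold_locales, unfold mono_between_converse[of "Obj C" "arrow_le C"])
  show "is_fctr (op_fctr (R P Q h)) (op_cat (E Q)) (op_cat (E P))"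
    if "monoC P Q h" for P Q h using is_fctr_op[OF DFun_fctr[OF small_mono[OF that]]] .
  show "op_fctr (R P P (\<lambda>x. x)) = id_fctr (op_cat (E P))" if "P \<subseteq> Obj C" for P
    using mono_fctr_id[OF that] DFun_id[OF small_full_subcat[OF S C]] op_id_fctr by simp
  show "op_fctr (R P W (\<lambda>x. g (h x))) =
      op_fctr (R P Q h) \<circ>\<^sub>F op_fctr (R Q W g)"
    if "monoC P Q h" "monoC Q W g" for P Q W h g
    using mono_fctr_comp[OF that] DFun_comp[OF small_mono[OF that(1)] small_mono[OF that(2)]]
      op_comp_fctr[OF DFun_fctr[OF small_mono[OF that(2)]]] by simp
  show "op_fctr (R P Q h) = op_fctr (R P Q h')"
    if "\<And>x. x \<in> P \<Longrightarrow> h x = h' x" "monoC P Q h" for P Q h h'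
    using mono_fctr_cong[OF that] by simp
next
  fix P h X
  assume h: "monoC P P h" and le: "\<And>x. x \<in> P \<Longrightarrow> arrow_le C (h x) x"
    and "X \<in> Obj (op_cat (E P))"
  then have X: "X \<in> Obj (E P)" by simp
  have P: "P \<subseteq> Obj C" using h by (simp add: mono_between_def)
  have "monoC P P (\<lambda>x. x)" using P by (auto simp: mono_between_def)
  from mono_fctr_ntrans[OF h this le] obtain n where n: "is_ntrans n (mono_fctr C P P h) (id_fctr (full_subcat C P))"
    unfolding mono_fctr_id[OF P] by blast
  note N = DNat_ntrans[OF small_mono[OF h] small_id[OF small_full_subcat[OF S C]] n,
      unfolded DFun_id[OF small_full_subcat[OF S C]]]
  have "NMap (DNat D n) X \<in> hom (E P) (FObj (R P P h) X) X"
    using ntrans_hom[OF N DFun_fctr[OF small_mono[OF h]] X] X by simp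
  then show "\<exists>t\<in>hom (op_cat (E P)) X (FObj (op_fctr (R P P h)) X).
      \<forall>Q g. monoC Q P g \<longrightarrow> (\<forall>x\<in>Q. h (g x) = g x) \<longrightarrow>
        FArr (op_fctr (R Q P g)) t =
        Id (op_cat (E Q)) (FObj (op_fctr (R Q P g)) X)"
    using inflationary[OF h _ _ _ X, of n] n unfolding op_cat_simps op_fctr_simps hom_op by blast
next
  show "iso_arr (op_cat (E P)) f"
    if "P \<subseteq> Obj C" "f \<in> Arr (op_cat (E P))"
    "\<And>p. p \<in> P \<Longrightarrow> iso_arr (op_cat (E {p})) (FArr (op_fctr (R {p} P (\<lambda>x. x))) f)"
    for P f
    using conservative_restriction[OF that(1), of f] that by simp
next
  fix A P V assume A: "A \<subseteq> P" and P: "P \<subseteq> Obj C" and "V \<in> Obj (op_cat (E P))"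
  then have V: "V \<in> Obj (E P)" by simp
  let ?u = "subcat_incl (full_subcat C P) A"
  have u: "?u = mono_fctr C A P (\<lambda>x. x)" using subcat_incl_mono[OF category_C thin P, of A] A
    by (simp add: Int_absorb2)
  have J: "full_subcat (full_subcat C P) A = full_subcat C A"
    using A by (simp add: full_subcat_full_subcat Int_absorb1)
  note su = small_subcat_incl[OF S small_full_subcat[OF S C, of P], of A]
  note fu = is_fctr_op[OF DFun_fctr[OF su]]
  obtain W m where w: "universal (op_fctr (DFun D ?u)) (FObj (DFun D ?u) V) W m"
    using pointwise_extension.universal_exists[OF pointwise_right[OF su], of "FObj (DFun D ?u) V"]
      fctr_obj[OF DFun_fctr[OF su] V] by auto
  have "iso_arr (op_cat (DCat D (full_subcat (full_subcat C P) A))) m"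
    using universal_right_iso[OF small_full_subcat[OF S C] w] by simp
  from universal_iso_replacement[OF fu _ _ this, of V W] w V
  show "\<exists>V' c. c \<in> hom (op_cat (E P)) V' V \<and>
      left_extended (op_fctr (R A P (\<lambda>x. x))) V' \<and>
      iso_arr (op_cat (E A)) (FArr (op_fctr (R A P (\<lambda>x. x))) c)"
    unfolding u J by auto
next
  fix A P N V assume A: "A \<subseteq> P" and P: "P \<subseteq> Obj C" and N: "N \<subseteq> P"
    and up: "\<And>x y. x \<in> N \<Longrightarrow> y \<in> P \<Longrightarrow> arrow_le C x y \<Longrightarrow> y \<in> N"
    and e: "left_extended (op_fctr (R A P (\<lambda>x. x))) V"
  have "Cod (full_subcat C P) f \<in> N" if "f \<in> Arr (full_subcat C P)" "Dom (full_subcat C P) f \<in> N" for f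
  proof -
    have "f \<in> hom (full_subcat C P) (Dom (full_subcat C P) f) (Cod (full_subcat C P) f)"
      using that by (simp add: hom_def)
    then show ?thesis using up[OF that(2)] by (auto simp: hom_full_subcat arrow_le_def)
  qed
  moreover have "subcat_incl (full_subcat C P) A = mono_fctr C A P (\<lambda>x. x)"
    "subcat_incl (full_subcat C P) N = mono_fctr C N P (\<lambda>x. x)"
    using subcat_incl_mono[OF category_C thin P] A N by (simp_all add: Int_absorb2)
  moreover have "full_subcat (full_subcat C P) N = full_subcat C N"
    "subcat_incl (full_subcat C N) A = mono_fctr C (A \<inter> N) N (\<lambda>x. x)"
    using N P subcat_incl_mono[OF category_C thin, of N A] by (auto simp: full_subcat_full_subcat Int_absorb1)
  ultimately show "left_extended (op_fctr (R (A \<inter> N) N (\<lambda>x. x)))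
      (FObj (op_fctr (R N P (\<lambda>x. x))) V)"
    using cosieve_restriction[OF small_full_subcat[OF S C], of P N A V] e by simp
qed

end

section \<open>The prism and its faces\<close>

abbreviation prism_cat :: "'v scat" where "prism_cat \<equiv> [2]\<^sub>c \<times>\<^sub>c [1]\<^sub>c"

lemma category_grid: "category ([m]\<^sub>c \<times>\<^sub>c [n]\<^sub>c)"
  using small_sprod_cat[OF smallness_all small_ord_cat[OF smallness_all] small_ord_cat[OF smallness_all]]
  by (simp add: small_cat_def)

lemma thin_grid: "thin ([m]\<^sub>c \<times>\<^sub>c [n]\<^sub>c)"
  by (auto simp: thin_def hom_sprod_cat hom_ord_cat)

lemma Obj_grid: "Obj ([m]\<^sub>c \<times>\<^sub>c [n]\<^sub>c) = {Pr (Num i) (Num j) | i j. i \<le> m \<and> j \<le> n}"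
  by (auto simp: sprod_cat_def ord_cat_def)

lemma arrow_le_grid:
  "arrow_le ([m]\<^sub>c \<times>\<^sub>c [n]\<^sub>c) (Pr (Num i) (Num j)) (Pr (Num i') (Num j')) \<longleftrightarrow>
     i \<le> i' \<and> i' \<le> m \<and> j \<le> j' \<and> j' \<le> n"
  by (auto simp: arrow_le_def hom_sprod_cat hom_ord_cat)

text \<open>
  For \<open>k = n = 1\<close> and \<open>m = 2\<close>: the square is a full subcategory of the prism on the nose, hence so are
  its corners.
\<close>

lemma full_subcat_grid:
  assumes "k \<le> m"
  shows "full_subcat ([m]\<^sub>c \<times>\<^sub>c [n]\<^sub>c) (Obj ([k]\<^sub>c \<times>\<^sub>c [n]\<^sub>c)) = ([k]\<^sub>c \<times>\<^sub>c [n]\<^sub>c :: 'v scat)"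
proof (rule thin_category_eqI[OF category_full_subcat[OF category_grid] category_grid thin_full_subcat[OF thin_grid]])
  show "Obj (full_subcat ([m]\<^sub>c \<times>\<^sub>c [n]\<^sub>c) (Obj ([k]\<^sub>c \<times>\<^sub>c [n]\<^sub>c))) = (Obj ([k]\<^sub>c \<times>\<^sub>c [n]\<^sub>c) :: 'v univ set)"
    using assms by (auto simp: full_subcat_simps Obj_grid)
  show "hom (full_subcat ([m]\<^sub>c \<times>\<^sub>c [n]\<^sub>c) (Obj ([k]\<^sub>c \<times>\<^sub>c [n]\<^sub>c))) x y = hom ([k]\<^sub>c \<times>\<^sub>c [n]\<^sub>c) x y"
    for x y :: "'v univ"
    using assms unfolding set_eq_iff hom_full_subcat by (auto simp: hom_sprod_cat hom_ord_cat Obj_grid)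
qed

definition row_map :: "(nat \<Rightarrow> nat) \<Rightarrow> 'v univ \<Rightarrow> 'v univ" where
  "row_map h x = Pr (num_map h (pfst x)) (psnd x)"

lemma row_map_apply [simp]: "row_map h (Pr (Num i) y) = Pr (Num (h i)) y"
  by (simp add: row_map_def)

lemma is_fctr_ord:
  assumes "\<And>i j. i \<le> j \<Longrightarrow> j \<le> m \<Longrightarrow> h i \<le> h j \<and> h j \<le> n"
  shows "is_fctr (ord_fctr m n h) [m]\<^sub>c [n]\<^sub>c"
  unfolding ord_fctr_def
proof (rule is_fctr_mk)
  show "category [m]\<^sub>c" "category [n]\<^sub>c"
    using small_ord_cat[OF smallness_all] by (auto simp: small_cat_def)
  have h: "h j \<le> n" if "j \<le> m" for j using assms[of j j] that by simp
  show "num_map h x \<in> Obj [n]\<^sub>c" if "x \<in> Obj [m]\<^sub>c" for x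
    using that h by (auto simp: ord_cat_def)
  show "num_map h (Id [m]\<^sub>c x) = Id [n]\<^sub>c (num_map h x)" if "x \<in> Obj [m]\<^sub>c" for x
    using that h by (auto simp: ord_cat_def)
  show "num_map h f \<in> hom [n]\<^sub>c (num_map h x) (num_map h y)" if "f \<in> hom [m]\<^sub>c x y" for f x y
    using that assms by (auto simp: hom_ord_cat)
  show "num_map h (Comp [m]\<^sub>c g f) = Comp [n]\<^sub>c (num_map h g) (num_map h f)"
    if "f \<in> hom [m]\<^sub>c x y" "g \<in> hom [m]\<^sub>c y z" for f g x y z
    using that assms by (auto simp: hom_ord_cat) (auto simp: ord_cat_def mk_cat_def)
qed

lemma is_fctr_sprod:
  assumes u: "is_fctr u J K" and v: "is_fctr v J' K'"
  shows "is_fctr (u \<times>\<^sub>f v) (J \<times>\<^sub>c J') (K \<times>\<^sub>c K')"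
proof -
  have c: "FDom u = J" "FCod u = K" "FDom v = J'" "FCod v = K'" "category J" "category K"
    "category J'" "category K'" using fctr_cats[OF u] fctr_cats[OF v] by auto
  have p: "category (J \<times>\<^sub>c J')" "category (K \<times>\<^sub>c K')"
    using small_sprod_cat[OF smallness_all] c by (auto simp: small_cat_def)
  have C: "Comp (B \<times>\<^sub>c B') (Pr g g') (Pr f f') = Pr (Comp B g f) (Comp B' g' f')"
    if "f \<in> hom B x y" "g \<in> hom B y z" "f' \<in> hom B' x' y'" "g' \<in> hom B' y' z'"
    for B B' :: "'a scat" and f g f' g' x y z x' y' z'
    using that by (auto simp: sprod_cat_def hom_def)
  have I: "Id (B \<times>\<^sub>c B') (Pr x x') = Pr (Id B x) (Id B' x')" if "x \<in> Obj B" "x' \<in> Obj B'"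
    for B B' :: "'a scat" and x x' using that by (auto simp: sprod_cat_def)
  have O: "Obj (B \<times>\<^sub>c B') = {Pr x y | x y. x \<in> Obj B \<and> y \<in> Obj B'}" for B B' :: "'a scat"
    by (simp add: sprod_cat_def)
  show ?thesis unfolding sprod_fctr_def c
  proof (rule is_fctr_mk[OF p])
    show "Pr (FObj u (pfst x)) (FObj v (psnd x)) \<in> Obj (K \<times>\<^sub>c K')" if "x \<in> Obj (J \<times>\<^sub>c J')" for x
      using that fctr_obj[OF u] fctr_obj[OF v] by (auto simp: O)
    show "Pr (FArr u (pfst f)) (FArr v (psnd f)) \<in>
        hom (K \<times>\<^sub>c K') (Pr (FObj u (pfst x)) (FObj v (psnd x))) (Pr (FObj u (pfst y)) (FObj v (psnd y)))"
      if "f \<in> hom (J \<times>\<^sub>c J') x y" for f x y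
      using that fctr_hom[OF u] fctr_hom[OF v] by (auto simp: hom_sprod_cat)
    show "Pr (FArr u (pfst (Id (J \<times>\<^sub>c J') x))) (FArr v (psnd (Id (J \<times>\<^sub>c J') x))) =
        Id (K \<times>\<^sub>c K') (Pr (FObj u (pfst x)) (FObj v (psnd x)))" if "x \<in> Obj (J \<times>\<^sub>c J')" for x
      using that fctr_obj[OF u] fctr_obj[OF v] fctr_id[OF u] fctr_id[OF v] by (auto simp: O I)
    fix f g x y z assume f: "f \<in> hom (J \<times>\<^sub>c J') x y" and g: "g \<in> hom (J \<times>\<^sub>c J') y z"
    obtain f1 f2 x1 x2 y1 y2 where 1: "f = Pr f1 f2" "y = Pr y1 y2" "f1 \<in> hom J x1 y1" "f2 \<in> hom J' x2 y2"
      using f by (auto simp: hom_sprod_cat)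
    obtain g1 g2 z1 z2 where 2: "g = Pr g1 g2" "g1 \<in> hom J y1 z1" "g2 \<in> hom J' y2 z2"
      using g 1(2) by (auto simp: hom_sprod_cat)
    show "Pr (FArr u (pfst (Comp (J \<times>\<^sub>c J') g f))) (FArr v (psnd (Comp (J \<times>\<^sub>c J') g f))) =
       Comp (K \<times>\<^sub>c K') (Pr (FArr u (pfst g)) (FArr v (psnd g))) (Pr (FArr u (pfst f)) (FArr v (psnd f)))"
      using C[OF 1(3) 2(2) 1(4) 2(3)] fctr_comp[OF u 1(3) 2(2)] fctr_comp[OF v 1(4) 2(3)]
        C[OF fctr_hom[OF u 1(3)] fctr_hom[OF u 2(2)] fctr_hom[OF v 1(4)] fctr_hom[OF v 2(3)]] 1(1) 2(1)
      by simp
  qed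
qed

lemma Obj_prism: "Obj prism_cat = {Pr (Num 0) (Num 0), Pr (Num 1) (Num 0), Pr (Num 2) (Num 0),
    Pr (Num 0) (Num 1), Pr (Num 1) (Num 1), Pr (Num 2) (Num 1)}"
  and Obj_square: "Obj \<box>\<^sub>c = {Pr (Num 0) (Num 0), Pr (Num 1) (Num 0), Pr (Num 0) (Num 1), Pr (Num 1) (Num 1)}"
proof -
  have "i \<le> 2 \<longleftrightarrow> i = 0 \<or> i = 1 \<or> i = 2" "i \<le> 1 \<longleftrightarrow> i = 0 \<or> i = 1" for i :: nat by auto
  then show "Obj prism_cat = {Pr (Num 0) (Num 0), Pr (Num 1) (Num 0), Pr (Num 2) (Num 0),
    Pr (Num 0) (Num 1), Pr (Num 1) (Num 1), Pr (Num 2) (Num 1)}"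
    "Obj \<box>\<^sub>c = {Pr (Num 0) (Num 0), Pr (Num 1) (Num 0), Pr (Num 0) (Num 1), Pr (Num 1) (Num 1)}"
    unfolding Obj_grid by blast+
qed

definition coface_map :: "nat \<Rightarrow> nat \<Rightarrow> nat" where
  "coface_map i j = (if j < i then j else Suc j)"

abbreviation square_pts :: "'v univ set" where "square_pts \<equiv> Obj \<box>\<^sub>c"

lemma mono_coface:
  "mono_between (Obj prism_cat) (arrow_le prism_cat) square_pts (Obj prism_cat) (row_map (coface_map i))"
  unfolding mono_between_def by (auto simp: Obj_grid arrow_le_grid coface_map_def image_subset_iff)

lemma coface_eq_mono:
  "coface i \<times>\<^sub>f id_fctr [1]\<^sub>c = mono_fctr prism_cat square_pts (Obj prism_cat) (row_map (coface_map i))"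
proof -
  have sq: "full_subcat prism_cat square_pts = \<box>\<^sub>c" by (rule full_subcat_grid) simp
  have pr: "full_subcat prism_cat (Obj prism_cat) = prism_cat"
    by (rule full_subcat_all[OF category_grid subset_refl])
  note m = is_fctr_mono[OF category_grid thin_grid mono_coface[of i], unfolded sq pr]
  have c: "is_fctr (coface i) [1]\<^sub>c [2]\<^sub>c" unfolding coface_def by (rule is_fctr_ord) auto
  have o: "category ([1]\<^sub>c)" using small_ord_cat[OF smallness_all] by (auto simp: small_cat_def)
  show ?thesis
  proof (rule thin_fctr_eq[OF is_fctr_sprod[OF c is_fctr_id[OF o]] m(1) thin_grid])
    fix x :: "'a univ" assume x: "x \<in> square_pts"
    then obtain a b where ab: "x = Pr (Num a) (Num b)" "a \<le> 1" "b \<le> 1" by (auto simp: Obj_grid)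
    have O: "Num a \<in> (Obj [1]\<^sub>c :: 'a univ set)" "Num b \<in> (Obj [1]\<^sub>c :: 'a univ set)" using ab by (auto simp: ord_cat_def)
    have d: "FDom (coface i) = [1]\<^sub>c" "FDom (id_fctr [1]\<^sub>c) = [1]\<^sub>c"
      using fctr_cats[OF c] by (auto simp: id_fctr_def)
    show "FObj (coface i \<times>\<^sub>f id_fctr [1]\<^sub>c) x = FObj (mono_fctr prism_cat square_pts (Obj prism_cat) (row_map (coface_map i))) x"
      unfolding sprod_fctr_def d fctr_mk_simps(3)[OF x] m(2)[OF x] unfolding ab(1)
      using O by (simp add: coface_def ord_fctr_def coface_map_def)
  qed
qed

lemma i_ul_eq_mono: "i_ul = mono_fctr prism_cat
    {Pr (Num 0) (Num 0), Pr (Num 1) (Num 0), Pr (Num 0) (Num 1)} square_pts (\<lambda>x. x)"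
  and i_lr_eq_mono: "i_lr = mono_fctr prism_cat
    {Pr (Num 1) (Num 0), Pr (Num 0) (Num 1), Pr (Num 1) (Num 1)} square_pts (\<lambda>x. x)"
proof -
  have sq: "full_subcat prism_cat square_pts = \<box>\<^sub>c" by (rule full_subcat_grid) simp
  have "square_pts \<subseteq> Obj prism_cat" by (auto simp: Obj_grid)
  note m = subcat_incl_mono[OF category_grid thin_grid this, unfolded sq]
  show "i_ul = mono_fctr prism_cat
    {Pr (Num 0) (Num 0), Pr (Num 1) (Num 0), Pr (Num 0) (Num 1)} square_pts (\<lambda>x. x)"
    unfolding i_ul_def m by (rule arg_cong[where f = "\<lambda>A. mono_fctr _ A _ _"]) (auto simp: Obj_grid)
  show "i_lr = mono_fctr prism_cat
    {Pr (Num 1) (Num 0), Pr (Num 0) (Num 1), Pr (Num 1) (Num 1)} square_pts (\<lambda>x. x)"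
    unfolding i_lr_def m by (rule arg_cong[where f = "\<lambda>A. mono_fctr _ A _ _"]) (auto simp: Obj_grid)
qed

context derivator_setting begin

lemma prism_small: "small_cat S (prism_cat :: 'v scat)"
  using small_sprod_cat[OF S] small_ord_cat[OF S] by blast

sublocale prism: thin_diagrams S D prism_cat
  by unfold_locales (use prism_small thin_grid in auto)

text \<open>
  Row \<open>i\<close> consists of the points with first coordinate \<open>i\<close>. Following \<open>s0\<close> or \<open>s1\<close> by its face moves the
  omitted row to the next larger one: row 0 to row 1 for \<open>d\<^sup>0\<close>, row 1 to row 2 for \<open>d\<^sup>1\<close>. For \<open>d\<^sup>2\<close>
  there is no larger row, but its image is downward closed.
\<close>

lemma left_pasting_shape:
  "pasting_shape (Obj prism_cat) (arrow_le prism_cat) (\<lambda>P. DCat D (full_subcat prism_cat P))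
     (\<lambda>P Q h. DFun D (mono_fctr prism_cat P Q h)) square_pts
     {Pr (Num 0) (Num 0), Pr (Num 1) (Num 0), Pr (Num 0) (Num 1)}
     {Pr (Num 0) (Num 0), Pr (Num 1) (Num 0), Pr (Num 2) (Num 0), Pr (Num 0) (Num 1)}
     {Pr (Num 0) (Num 0), Pr (Num 1) (Num 0), Pr (Num 2) (Num 0), Pr (Num 0) (Num 1), Pr (Num 1) (Num 1)}
     square_pts
     (row_map (coface_map 0)) (row_map (coface_map 1)) (row_map (coface_map 2))
     (row_map (\<lambda>i. i - 1)) (row_map (min 1)) (row_map (min 1))"
  by (intro pasting_shape.intro prism.left_diagrams pasting_shape_axioms.intro)
   (auto simp: Obj_prism Obj_square arrow_le_grid coface_map_def mono_between_def simp del: One_nat_def)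

text \<open>
  The mirror image: the order is reversed and \<open>d\<^sup>0\<close> and \<open>d\<^sup>2\<close> change places, so the omitted row moves to
  the next smaller one, and the image of \<open>d\<^sup>0\<close> is upward closed.
\<close>

lemma right_pasting_shape:
  "pasting_shape (Obj prism_cat) (\<lambda>x y. arrow_le prism_cat y x) (\<lambda>P. op_cat (DCat D (full_subcat prism_cat P)))
     (\<lambda>P Q h. op_fctr (DFun D (mono_fctr prism_cat P Q h))) square_pts
     {Pr (Num 1) (Num 0), Pr (Num 0) (Num 1), Pr (Num 1) (Num 1)}
     {Pr (Num 2) (Num 1), Pr (Num 1) (Num 1), Pr (Num 0) (Num 1), Pr (Num 2) (Num 0)}
     {Pr (Num 2) (Num 1), Pr (Num 1) (Num 1), Pr (Num 0) (Num 1), Pr (Num 2) (Num 0), Pr (Num 1) (Num 0)}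
     {Pr (Num 1) (Num 0), Pr (Num 2) (Num 0), Pr (Num 1) (Num 1), Pr (Num 2) (Num 1)}
     (row_map (coface_map 2)) (row_map (coface_map 1)) (row_map (coface_map 0))
     (row_map (min 1)) (row_map (\<lambda>i. i - 1)) (row_map (\<lambda>i. i - 1))"
  by (intro pasting_shape.intro prism.right_diagrams pasting_shape_axioms.intro)
   (auto simp: Obj_prism Obj_square arrow_le_grid coface_map_def mono_between_def simp del: One_nat_def)

end

theorem proposition4p6:
  fixes S :: "'v univ set \<Rightarrow> bool"
    and D :: "('v, 'o, 'a) preder"
    and X :: 'o
  assumes "smallness S"
    and "stable_derivator S D"
    and "X \<in> Obj (DCat D ([2]\<^sub>c \<times>\<^sub>c [1]\<^sub>c))"
  shows "(biCartesian D (face D 0 X) \<and> biCartesian D (face D 1 X) \<longrightarrow> biCartesian D (face D 2 X)) \<and>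
         (biCartesian D (face D 0 X) \<and> biCartesian D (face D 2 X) \<longrightarrow> biCartesian D (face D 1 X)) \<and>
         (biCartesian D (face D 1 X) \<and> biCartesian D (face D 2 X) \<longrightarrow> biCartesian D (face D 0 X))"
proof -
  interpret derivator_setting S D
    using assms by unfold_locales (auto simp: stable_derivator_def)
  have face: "face D i X = FObj (DFun D (mono_fctr prism_cat square_pts (Obj prism_cat) (row_map (coface_map i)))) X"
    for i by (simp only: face_def coface_eq_mono)
  have sq: "full_subcat prism_cat square_pts = \<box>\<^sub>c" by (rule full_subcat_grid) simp
  have pr: "full_subcat prism_cat (Obj prism_cat) = prism_cat"
    by (rule full_subcat_all[OF category_grid subset_refl])
  have F: "face D i X \<in> Obj (DCat D \<box>\<^sub>c)" for i
    unfolding face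
    using fctr_obj[OF DFun_fctr[OF prism.small_mono[OF mono_coface[of i]]]] assms(3) by (simp only: sq pr)
  have left: "coCartesian D (face D 2 X) \<Longrightarrow> coCartesian D (face D 0 X) \<longleftrightarrow> coCartesian D (face D 1 X)"
    using pasting_shape.pasting[OF left_pasting_shape, of X] assms(3)
    unfolding coCartesian_iff_left_extended[OF F] unfolding face i_ul_eq_mono pr by blast
  have right: "Cartesian D (face D 0 X) \<Longrightarrow> Cartesian D (face D 2 X) \<longleftrightarrow> Cartesian D (face D 1 X)"
    using pasting_shape.pasting[OF right_pasting_shape, of X] assms(3)
    unfolding Cartesian_iff_left_extended[OF F] unfolding face i_lr_eq_mono pr op_fctr_simps op_cat_simps by blast
  have "coCartesian D (face D i X) \<longleftrightarrow> Cartesian D (face D i X)" for i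
    using assms(2) F[of i] unfolding stable_derivator_def by blast
  then show ?thesis using left right unfolding biCartesian_def by blast
qed

end
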